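(* Let $x_0\ge 0$ and $T\ge 0$, and suppose the claim sizes are exponentially distributed with parameter $\alpha>0$. Let $V(x_0)$ be the optimal value of the constrained dividend problem $$V(x_0)=\sup\Big\{\mathcal V^D(x_0)\;:\; D\in\Theta,\ \mathbb{E}_{x_0}\Big[\int_0^{\tau^D}e^{-\delta s}ds\Big]\ge K_T\Big\},$$ and for $\Lambda\ge 0$ let $V_\Lambda(x_0)=\sup_{D\in\Theta}\mathcal V^D_\Lambda(x_0)$. Then (i) $V(x_0)\le \inf_{\Lambda\ge 0}V_\Lambda(x_0)$, and (ii) $\inf_{\Lambda\ge 0}V_\Lambda(x_0)\le V(x_0)$. Therefore $\inf_{\Lambda\ge 0}V_\Lambda(x_0)=V(x_0)$.
   Context: Cramér–Lundberg model: fix constants $c,\lambda,\alpha,\delta>0$. On a probability space let $N=(N_t)_{t\ge0}$ be a homogeneous Poisson process of rate $\lambda$, and let $(Y_i)_{i\ge1}$ be i.i.d. exponential random variables with parameter $\alpha$ (density $\alpha e^{-\alpha y}$, $y\ge 0$), independent of $N$. For initial capital $x_0\ge0$ the surplus is $X_t=x_0+ct-\sum_{i=1}^{N_t}Y_i$; $(\mathcal F_t)_{t\ge0}$ is the filtration generated by $X$; $\mathbb E_{x_0}$ denotes expectation when the initial capital is $x_0$. A dividend process $D=(D_t)_{t\ge0}$ (cumulative dividends paid up to time $t$) is admissible if it is nonnegative, nondecreasing, càdlàg and $(\mathcal F_t)$-adapted. The controlled surplus is $X^D_t=x_0+ct-\sum_{i=1}^{N_t}Y_i-D_t$, and the ruin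 time is $\tau^D=\inf\{t\ge0:X^D_t<0\}$. Conventions: $D_{0-}=0$ and $X^D_{0-}=x_0$. $\Theta$ is the set of admissible dividend processes such that dividend payments do not themselves cause ruin, i.e. for all $t$, $D_t-D_{t-}\le\max\{X^D_{t-}-\Delta S_t,0\}$, where $\Delta S_t$ is the size of the claim (if any) occurring at time $t$, and such that $D_t=D_{\tau^D}$ for $t\ge\tau^D$ (no dividends after ruin). For $D\in\Theta$ define $\mathcal V^D(x_0)=\mathbb E_{x_0}\big[\int_0^{\tau^D}e^{-\delta t}dD_t\big]$, where the integral includes a possible lump payment $D_0$ at time $0$. For $T\ge0$ put $K_T=\int_0^Te^{-\delta s}ds$. For $\Lambda\ge0$ define $$\mathcal V^D_\Lambda(x_0)=\mathbb E_{x_0}\Big[\int_0^{\tau^D}e^{-\delta t}dD_t+\Lambda\int_0^{\tau^D}e^{-\delta s}ds\Big]-\Lambda K_T.$$ The supremum over an empty set is $-\infty$ (so $V(x_0)=-\infty$ if no $D\in\Theta$ satisfies the constraint). *)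

theory Defs
  imports "HOL-Probability.Probability"
begin

text \<open>All processes are indexed by real numbers, but only their values at times \<open>t \<ge> 0\<close> matter.
  Path properties and the constraints on dividend processes are required for every outcome
  in \<open>space M\<close>, and filtrations are raw (not completed).\<close>

definition generated_algebra ::
    "'a measure \<Rightarrow> 'i set \<Rightarrow> ('i \<Rightarrow> 'a \<Rightarrow> 'b) \<Rightarrow> 'b measure \<Rightarrow> 'a measure" where
  "generated_algebra M I X K =
     sigma (space M) {X i -` B \<inter> space M | i B. i \<in> I \<and> B \<in> sets K}"

definition natural_filtration ::
    "'a measure \<Rightarrow> (real \<Rightarrow> 'a \<Rightarrow> real) \<Rightarrow> real \<Rightarrow> 'a measure" where
  "natural_filtration M X t = generated_algebra M {0..t} X borel"

definition cadlag :: "(real \<Rightarrow> real) \<Rightarrow> bool" where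
  "cadlag f \<longleftrightarrow> (\<forall>t\<ge>0. continuous (at_right t) f) \<and> (\<forall>t>0. \<exists>l. (f \<longlongrightarrow> l) (at_left t))"

text \<open>\<open>left_value a f t\<close> is \<open>f(t-)\<close>, with the convention \<open>f(0-) = a\<close>.\<close>

definition left_value :: "real \<Rightarrow> (real \<Rightarrow> real) \<Rightarrow> real \<Rightarrow> real" where
  "left_value a f t = (if t = 0 then a else Lim (at_left t) f)"

definition (in prob_space) poisson_process :: "real \<Rightarrow> (real \<Rightarrow> 'a \<Rightarrow> nat) \<Rightarrow> bool" where
  "poisson_process r N \<longleftrightarrow>
     (\<forall>t\<ge>0. N t \<in> measurable M (count_space UNIV)) \<and>
     (\<forall>\<omega>\<in>space M. N 0 \<omega> = 0 \<and> mono_on {0..} (\<lambda>t. N t \<omega>) \<and> cadlag (\<lambda>t. real (N t \<omega>))) \<and>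
     (\<forall>(t :: nat \<Rightarrow> real) n. 0 \<le> t 0 \<and> mono t \<longrightarrow>
        indep_vars (\<lambda>_. count_space UNIV) (\<lambda>i \<omega>. N (t (Suc i)) \<omega> - N (t i) \<omega>) {..<n}) \<and>
     (\<forall>s t. 0 \<le> s \<and> s < t \<longrightarrow>
        distr M (count_space UNIV) (\<lambda>\<omega>. N t \<omega> - N s \<omega>) = measure_pmf (poisson_pmf (r * (t - s))))"

locale cramer_lundberg_exponential = prob_space M
  for M :: "'a measure"
    and N :: "real \<Rightarrow> 'a \<Rightarrow> nat"
    and Y :: "nat \<Rightarrow> 'a \<Rightarrow> real"
    and c r \<alpha> \<delta> :: real +
  assumes c_pos: "c > 0" and r_pos: "r > 0" and \<alpha>_pos: "\<alpha> > 0" and \<delta>_pos: "\<delta> > 0"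
    and poisson_N: "poisson_process r N"
    and indep_Y: "indep_vars (\<lambda>_. borel) Y {1..}"
    and exponential_Y: "\<And>i. i \<ge> 1 \<Longrightarrow> distributed M lborel (Y i) (exponential_density \<alpha>)"
    and indep_N_Y: "indep_set (sets (generated_algebra M {0..} N (count_space UNIV)))
                              (sets (generated_algebra M {1..} Y borel))"

definition total_claims ::
    "(real \<Rightarrow> 'a \<Rightarrow> nat) \<Rightarrow> (nat \<Rightarrow> 'a \<Rightarrow> real) \<Rightarrow> real \<Rightarrow> 'a \<Rightarrow> real" where
  "total_claims N Y t \<omega> = (\<Sum>i=1..N t \<omega>. Y i \<omega>)"

text \<open>In what follows \<open>S\<close> stands for the process of total claims.\<close>

definition surplus :: "real \<Rightarrow> (real \<Rightarrow> 'a \<Rightarrow> real) \<Rightarrow> real \<Rightarrow> real \<Rightarrow> 'a \<Rightarrow> real" where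
  "surplus c S x0 t \<omega> = x0 + c * t - S t \<omega>"

definition controlled_surplus ::
    "real \<Rightarrow> (real \<Rightarrow> 'a \<Rightarrow> real) \<Rightarrow> real \<Rightarrow> (real \<Rightarrow> 'a \<Rightarrow> real) \<Rightarrow> real \<Rightarrow> 'a \<Rightarrow> real" where
  "controlled_surplus c S x0 D t \<omega> = surplus c S x0 t \<omega> - D t \<omega>"

definition ruin_time ::
    "real \<Rightarrow> (real \<Rightarrow> 'a \<Rightarrow> real) \<Rightarrow> real \<Rightarrow> (real \<Rightarrow> 'a \<Rightarrow> real) \<Rightarrow> 'a \<Rightarrow> ereal" where
  "ruin_time c S x0 D \<omega> = Inf {ereal t | t. 0 \<le> t \<and> controlled_surplus c S x0 D t \<omega> < 0}"

definition admissible ::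
    "'a measure \<Rightarrow> real \<Rightarrow> (real \<Rightarrow> 'a \<Rightarrow> real) \<Rightarrow> real \<Rightarrow> (real \<Rightarrow> 'a \<Rightarrow> real) \<Rightarrow> bool" where
  "admissible M c S x0 D \<longleftrightarrow>
     (\<forall>t\<ge>0. D t \<in> borel_measurable (natural_filtration M (surplus c S x0) t)) \<and>
     (\<forall>\<omega>\<in>space M. (\<forall>t\<ge>0. 0 \<le> D t \<omega>) \<and> mono_on {0..} (\<lambda>t. D t \<omega>) \<and> cadlag (\<lambda>t. D t \<omega>))"

definition strategies ::
    "'a measure \<Rightarrow> real \<Rightarrow> (real \<Rightarrow> 'a \<Rightarrow> real) \<Rightarrow> real \<Rightarrow> (real \<Rightarrow> 'a \<Rightarrow> real) set" where
  "strategies M c S x0 = {D. admissible M c S x0 D \<and>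
     (\<forall>\<omega>\<in>space M. \<forall>t\<ge>0.
        D t \<omega> - left_value 0 (\<lambda>s. D s \<omega>) t
          \<le> max (left_value x0 (\<lambda>s. controlled_surplus c S x0 D s \<omega>) t
                 - (S t \<omega> - left_value 0 (\<lambda>s. S s \<omega>) t)) 0) \<and>
     (\<forall>\<omega>\<in>space M. \<forall>t\<ge>0. ruin_time c S x0 D \<omega> \<le> ereal t \<longrightarrow>
        D t \<omega> = D (real_of_ereal (ruin_time c S x0 D \<omega>)) \<omega>)}"

text \<open>Pathwise Lebesgue-Stieltjes integral of \<open>exp (-\<delta> t)\<close> against \<open>d\<close> up to and including \<open>\<tau>\<close>.
  Extending \<open>d\<close> by \<open>0\<close> to negative times turns a lump payment \<open>d 0\<close> into an atom at time \<open>0\<close>.\<close>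

definition discounted_dividends :: "real \<Rightarrow> (real \<Rightarrow> real) \<Rightarrow> ereal \<Rightarrow> ennreal" where
  "discounted_dividends \<delta> d \<tau> =
     (\<integral>\<^sup>+ t\<in>{t. 0 \<le> t \<and> ereal t \<le> \<tau>}. ennreal (exp (- \<delta> * t))
        \<partial>interval_measure (\<lambda>t. if t < 0 then 0 else d t))"

definition discounted_time :: "real \<Rightarrow> ereal \<Rightarrow> ennreal" where
  "discounted_time \<delta> \<tau> =
     (\<integral>\<^sup>+ s\<in>{s. 0 \<le> s \<and> ereal s \<le> \<tau>}. ennreal (exp (- \<delta> * s)) \<partial>lborel)"

definition K :: "real \<Rightarrow> real \<Rightarrow> real" where
  "K \<delta> T = (LBINT s:{0..T}. exp (- \<delta> * s))"

text \<open>All expectations are of nonnegative quantities and hence taken as \<open>[0,\<infinity>]\<close>-valued integrals;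
  \<open>SUP\<close> over the empty set in type \<open>ereal\<close> is \<open>-\<infinity>\<close>.\<close>

definition dividend_value ::
    "'a measure \<Rightarrow> real \<Rightarrow> real \<Rightarrow> (real \<Rightarrow> 'a \<Rightarrow> real) \<Rightarrow> real \<Rightarrow> (real \<Rightarrow> 'a \<Rightarrow> real) \<Rightarrow> ereal" where
  "dividend_value M c \<delta> S x0 D = enn2ereal
     (\<integral>\<^sup>+ \<omega>. discounted_dividends \<delta> (\<lambda>t. D t \<omega>) (ruin_time c S x0 D \<omega>) \<partial>M)"

definition lagrangian_value ::
    "'a measure \<Rightarrow> real \<Rightarrow> real \<Rightarrow> (real \<Rightarrow> 'a \<Rightarrow> real) \<Rightarrow> real \<Rightarrow> real \<Rightarrow> real
      \<Rightarrow> (real \<Rightarrow> 'a \<Rightarrow> real) \<Rightarrow> ereal" where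
  "lagrangian_value M c \<delta> S x0 T \<Lambda> D = enn2ereal
     (\<integral>\<^sup>+ \<omega>. discounted_dividends \<delta> (\<lambda>t. D t \<omega>) (ruin_time c S x0 D \<omega>)
             + ennreal \<Lambda> * discounted_time \<delta> (ruin_time c S x0 D \<omega>) \<partial>M)
     - ereal (\<Lambda> * K \<delta> T)"

definition constrained_value ::
    "'a measure \<Rightarrow> real \<Rightarrow> real \<Rightarrow> (real \<Rightarrow> 'a \<Rightarrow> real) \<Rightarrow> real \<Rightarrow> real \<Rightarrow> ereal" where
  "constrained_value M c \<delta> S x0 T =
     (SUP D \<in> {D \<in> strategies M c S x0.
                 (\<integral>\<^sup>+ \<omega>. discounted_time \<delta> (ruin_time c S x0 D \<omega>) \<partial>M) \<ge> ennreal (K \<delta> T)}.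
        dividend_value M c \<delta> S x0 D)"

definition dual_value ::
    "'a measure \<Rightarrow> real \<Rightarrow> real \<Rightarrow> (real \<Rightarrow> 'a \<Rightarrow> real) \<Rightarrow> real \<Rightarrow> real \<Rightarrow> real \<Rightarrow> ereal" where
  "dual_value M c \<delta> S x0 T \<Lambda> = (SUP D \<in> strategies M c S x0. lagrangian_value M c \<delta> S x0 T \<Lambda> D)"

end

theory Submission
  imports Defs
begin

text \<open>
  For a multiplier \<open>\<Lambda> \<ge> 0\<close> and a barrier \<open>b\<close>, the function \<open>v\<^sub>b + \<Lambda> u\<^sub>b\<close>, with \<open>v\<^sub>b\<close> the dividends and \<open>u\<^sub>b\<close>
  the lifetime of the strategy reflecting at \<open>b\<close>, is explicit for exponential claims. If its second
  derivative vanishes at \<open>b\<close> (smooth fit, which determines \<open>\<Lambda>\<close> from \<open>b\<close>), it is a concave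
  supersolution of the Hamilton-Jacobi-Bellman equation, so it dominates the Lagrangian of every
  strategy. The supersolution property is turned into a bound on expectations by discretising time:
  over a step of length \<open>h\<close> the claims are independent of the past, at most one claim matters up to an
  error of order \<open>h\<^sup>2\<close>, and the errors add up to a multiple of \<open>h\<close>. The same discretisation shows that paying
  the excess over \<open>b\<close> at the times \<open>k h\<close> yields dividends and lifetime as close to \<open>v\<^sub>b\<close> and \<open>u\<^sub>b\<close> as
  desired.

  Since \<open>u\<^sub>b\<close> depends continuously on \<open>b\<close> and tends to the lifetime without dividends as
  \<open>b \<longrightarrow> \<infinity>\<close>, the intermediate value theorem gives a barrier whose lifetime is slightly above
  \<open>K\<^sub>T\<close>; its smooth-fit multiplier closes the duality gap up to an arbitrarily small error. If
  \<open>K\<^sub>T\<close> equals the lifetime without dividends, let \<open>b \<longrightarrow> \<infinity>\<close>; if it is larger, the multipliers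
  force the dual value to \<open>-\<infinity>\<close>.
\<close>

section \<open>The linear problem on a half line\<close>

text \<open>Memoryless claims make everything explicit: applying \<open>d/dx + \<alpha>\<close> to
  \<open>c F' + r conv F - (r + \<delta>) F + L = 0\<close> removes the convolution and leaves a
  linear second order equation. Discretising avoids stochastic calculus for arbitrary strategies:
  only the independence of the next claim from the past of a fixed time is used. The two estimates
  are not mirror images. From above, survival is tested only at the end of a step and all dividends
  of the step are charged there; dividends paid in the step of ruin escape this bookkeeping and
  vanish in the limit because the dividend path does not jump at ruin. From below, two or more
  claims in a step are discarded and a single claim must not exceed the surplus at the start of the
  step, so that survival does not depend on when it occurs. The grid strategies realise a lifetime
  only up to an error, while the constraint is exact. Hence the barrier needs some slack above
  \<open>K\<^sub>T\<close>; its price is slack times multiplier, so the multipliers must be bounded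
  before the slack is chosen.\<close>

locale cl_parameters =
  fixes c r \<alpha> \<delta> :: real
  assumes positive_parameters: "0 < c" "0 < r" "0 < \<alpha>" "0 < \<delta>"
begin

text \<open>\<open>\<rho>\<close> and \<open>- \<gamma>\<close> are the roots of \<open>c *
  s\<^sup>2 + (c * \<alpha> - r - \<delta>) * s - \<delta> * \<alpha> = 0\<close>, Lundberg's
  equation with discounting. The minus sign is split off so that both constants are
  positive.\<close>

definition \<rho> :: real where
  "\<rho> = (sqrt ((c * \<alpha> - r - \<delta>)\<^sup>2 + 4 * c * \<delta> * \<alpha>) - (c * \<alpha> - r - \<delta>)) / (2 * c)"

definition \<gamma> :: real where
  "\<gamma> = (sqrt ((c * \<alpha> - r - \<delta>)\<^sup>2 + 4 * c * \<delta> * \<alpha>) + (c * \<alpha> - r - \<delta>)) / (2 * c)"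

lemma roots_pos: "0 < \<rho>" "0 < \<gamma>"
proof -
  have "\<bar>c * \<alpha> - r - \<delta>\<bar> < sqrt ((c * \<alpha> - r - \<delta>)\<^sup>2 + 4 * c * \<delta> * \<alpha>)"
    by (rule real_less_rsqrt) (use positive_parameters in simp)
  then show "0 < \<rho>" "0 < \<gamma>"
    unfolding \<rho>_def \<gamma>_def using positive_parameters by auto
qed

lemma roots_difference: "c * (\<gamma> - \<rho>) = c * \<alpha> - r - \<delta>"
  unfolding \<rho>_def \<gamma>_def using positive_parameters by (simp add: field_simps)

lemma roots_product: "c * \<rho> * \<gamma> = \<delta> * \<alpha>"
proof -
  define B where "B = c * \<alpha> - r - \<delta>"
  define s where "s = sqrt (B\<^sup>2 + 4 * c * \<delta> * \<alpha>)"
  have s: "s\<^sup>2 = B\<^sup>2 + 4 * c * \<delta> * \<alpha>"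
    unfolding s_def using positive_parameters by (intro real_sqrt_pow2) auto
  have "c * \<rho> * \<gamma> = c * ((s - B) * (s + B)) / (4 * c\<^sup>2)"
    unfolding \<rho>_def \<gamma>_def s_def B_def by (simp add: power2_eq_square)
  also have "(s - B) * (s + B) = 4 * c * \<delta> * \<alpha>"
    using s by (simp add: algebra_simps power2_eq_square)
  finally show ?thesis
    using positive_parameters by (simp add: field_simps power2_eq_square)
qed

text \<open>The quadratic with roots \<open>\<rho>\<close> and \<open>- \<gamma>\<close> takes the
  value \<open>r * \<alpha> > 0\<close> at \<open>- \<alpha>\<close>, so \<open>- \<alpha>\<close>
  lies to the left of both roots. The positivity of \<open>\<alpha> - \<gamma>\<close> is behind
  most sign arguments below.\<close>

lemma \<gamma>_less_\<alpha>: "\<gamma> < \<alpha>"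
proof -
  have "sqrt ((c * \<alpha> - r - \<delta>)\<^sup>2 + 4 * c * \<delta> * \<alpha>) < c * \<alpha> + r + \<delta>"
    by (rule real_less_lsqrt)
       (use positive_parameters in \<open>auto simp: power2_eq_square algebra_simps add_pos_pos\<close>)
  then show ?thesis
    unfolding \<gamma>_def using positive_parameters by (simp add: field_simps)
qed

text \<open>This and the next identity are the unreduced form
  \<open>r + \<delta> - c * s = r * \<alpha> / (s + \<alpha>)\<close> of Lundberg's equation at
  \<open>s = \<rho>\<close> and \<open>s = - \<gamma>\<close>, the form in which the convolution of
  an exponential produces it.\<close>

lemma root_equation_\<rho>: "(r + \<delta> - c * \<rho>) * (\<rho> + \<alpha>) = r * \<alpha>"
  using roots_difference roots_product by algebra

lemma root_equation_\<gamma>: "(r + \<delta> + c * \<gamma>) * (\<alpha> - \<gamma>) = r * \<alpha>"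
  using roots_difference roots_product by algebra

text \<open>Up to a constant factor the \<delta>-scale function of the risk process. The convolution
  of \<open>exp (s * x)\<close> contains a multiple of \<open>exp (- \<alpha> * x)\<close>; the two
  coefficients are chosen so that these terms cancel, which leaves a solution of the homogeneous
  equation.\<close>

definition scale :: "real \<Rightarrow> real" where
  "scale x = (\<rho> + \<alpha>) * exp (\<rho> * x) - (\<alpha> - \<gamma>) * exp (- \<gamma> * x)"

definition scale' :: "real \<Rightarrow> real" where
  "scale' x = \<rho> * (\<rho> + \<alpha>) * exp (\<rho> * x) + \<gamma> * (\<alpha> - \<gamma>) * exp (- \<gamma> * x)"

definition scale'' :: "real \<Rightarrow> real" where
  "scale'' x = \<rho>\<^sup>2 * (\<rho> + \<alpha>) * exp (\<rho> * x) - \<gamma>\<^sup>2 * (\<alpha> - \<gamma>) * exp (- \<gamma> * x)"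

text \<open>Expected discounted time to ruin without dividends, written as
  \<open>(1 - E exp (- \<delta> * \<tau>)) / \<delta>\<close>; the ruin transform is
  \<open>(\<alpha> - \<gamma>) / \<alpha> * exp (- \<gamma> * x)\<close>. It is the bounded solution
  with running reward 1.\<close>

definition lifetime :: "real \<Rightarrow> real" where
  "lifetime x = (1 - (\<alpha> - \<gamma>) / \<alpha> * exp (- \<gamma> * x)) / \<delta>"

definition lifetime' :: "real \<Rightarrow> real" where
  "lifetime' x = \<gamma> * (\<alpha> - \<gamma>) / (\<alpha> * \<delta>) * exp (- \<gamma> * x)"

text \<open>The general solution with running reward \<open>L\<close>; the free parameter
  \<open>p\<close> is fixed later by the boundary condition at the barrier.\<close>

definition harm :: "real \<Rightarrow> real \<Rightarrow> real \<Rightarrow> real" where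
  "harm p L x = p * scale x + L * lifetime x"

definition harm' :: "real \<Rightarrow> real \<Rightarrow> real \<Rightarrow> real" where
  "harm' p L x = p * scale' x + L * lifetime' x"

definition harm'' :: "real \<Rightarrow> real \<Rightarrow> real \<Rightarrow> real" where
  "harm'' p L x = p * scale'' x - \<gamma> * L * lifetime' x"

section \<open>Derivatives and signs of the explicit solutions\<close>

lemma DERIV_scale: "(scale has_real_derivative scale' x) (at x within S)"
  unfolding scale_def[abs_def] scale'_def by (auto intro!: derivative_eq_intros)

lemma DERIV_scale': "(scale' has_real_derivative scale'' x) (at x within S)"
  unfolding scale'_def[abs_def] scale''_def
  by (auto intro!: derivative_eq_intros simp: power2_eq_square)

lemma DERIV_lifetime: "(lifetime has_real_derivative lifetime' x) (at x within S)"
proof -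
  have "(lifetime has_real_derivative (- ((\<alpha> - \<gamma>) / \<alpha> * (exp (- \<gamma> * x) * (- \<gamma>)))) / \<delta>) (at x within S)"
    unfolding lifetime_def[abs_def] by (rule derivative_eq_intros refl | use positive_parameters in simp)+
  then show ?thesis unfolding lifetime'_def by (simp add: field_simps)
qed

lemma DERIV_lifetime': "(lifetime' has_real_derivative - \<gamma> * lifetime' x) (at x within S)"
  unfolding lifetime'_def[abs_def]
  using positive_parameters by (auto intro!: derivative_eq_intros)

lemma DERIV_harm: "(harm p L has_real_derivative harm' p L x) (at x within S)"
  unfolding harm_def[abs_def] harm'_def
  by (auto intro!: derivative_eq_intros DERIV_scale DERIV_lifetime)

lemma DERIV_harm': "(harm' p L has_real_derivative harm'' p L x) (at x within S)"
  unfolding harm'_def[abs_def] harm''_def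
  by (auto intro!: derivative_eq_intros DERIV_scale' DERIV_lifetime')

lemma continuous_on_harm'' [continuous_intros]: "continuous_on S (harm'' p L)"
  unfolding harm''_def[abs_def] scale''_def[abs_def] lifetime'_def[abs_def]
  by (intro continuous_intros)

lemma scale'_pos: "0 < scale' x"
  unfolding scale'_def using roots_pos \<gamma>_less_\<alpha> positive_parameters
  by (intro add_pos_pos mult_pos_pos) auto

lemma lifetime'_pos: "0 < lifetime' x"
  unfolding lifetime'_def using roots_pos \<gamma>_less_\<alpha> positive_parameters
  by (intro divide_pos_pos mult_pos_pos) auto

lemma lifetime_nonneg: assumes "0 \<le> x" shows "0 \<le> lifetime x"
proof -
  have "lifetime 0 \<le> lifetime x"
    by (rule DERIV_nonneg_imp_nondecreasing[OF assms]) (use DERIV_lifetime lifetime'_pos less_imp_le in blast)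
  moreover have "0 < lifetime 0"
    unfolding lifetime_def using roots_pos positive_parameters by (simp add: field_simps)
  ultimately show ?thesis by simp
qed

lemma lifetime_le: "lifetime x \<le> 1 / \<delta>"
  unfolding lifetime_def using \<gamma>_less_\<alpha> positive_parameters by (simp add: divide_right_mono)

text \<open>\<open>conv F x\<close> is the expectation of \<open>F (x - Y)\<close> over \<open>Y \<le> x\<close> for an exponential claim \<open>Y\<close>.\<close>

definition conv :: "(real \<Rightarrow> real) \<Rightarrow> real \<Rightarrow> real" where
  "conv F x = exp (- \<alpha> * x) * integral {0..x} (\<lambda>z. \<alpha> * exp (\<alpha> * z) * F z)"

text \<open>The integrand has an elementary antiderivative, and the two root equations then match
  the coefficients of each exponential. Since \<open>conv F x\<close> only sees \<open>F\<close> on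
  \<open>{0..x}\<close>, agreement there is enough: a function that is modified above a barrier
  still satisfies the equation below it.\<close>

lemma conv_harm:
  assumes "0 \<le> x" and F: "\<And>z. 0 \<le> z \<Longrightarrow> z \<le> x \<Longrightarrow> F z = harm p L z"
  shows "r * conv F x = (r + \<delta>) * harm p L x - c * harm' p L x - L"
proof -
  \<comment> \<open>Integration divides by \<open>\<rho> + \<alpha>\<close> and
    \<open>\<alpha> - \<gamma>\<close>, which cancels the coefficients of \<open>scale\<close> and
    of \<open>lifetime\<close>. The normalisation has \<open>G 0 = 0\<close>, so no term
    \<open>exp (- \<alpha> * x)\<close> survives.\<close>
  define G where "G z = p * \<alpha> * (exp ((\<rho> + \<alpha>) * z) - exp ((\<alpha> - \<gamma>) * z))
      + L / \<delta> * (exp (\<alpha> * z) - exp ((\<alpha> - \<gamma>) * z))" for z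
  have e: "exp ((\<rho> + \<alpha>) * z) = exp (\<alpha> * z) * exp (\<rho> * z)" for z
    by (simp add: algebra_simps flip: exp_add)
  have e': "exp ((\<alpha> - \<gamma>) * z) = exp (\<alpha> * z) * exp (- \<gamma> * z)" for z
    by (simp add: algebra_simps flip: exp_add)
  have dG: "(G has_real_derivative \<alpha> * exp (\<alpha> * z) * harm p L z) (at z within S)" for z S
  proof -
    have "(G has_real_derivative p * \<alpha> * (exp ((\<rho> + \<alpha>) * z) * (\<rho> + \<alpha>) - exp ((\<alpha> - \<gamma>) * z) * (\<alpha> - \<gamma>))
      + L / \<delta> * (exp (\<alpha> * z) * \<alpha> - exp ((\<alpha> - \<gamma>) * z) * (\<alpha> - \<gamma>))) (at z within S)"
      unfolding G_def[abs_def] by (rule derivative_eq_intros refl | use positive_parameters in simp)+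
    also have "p * \<alpha> * (exp ((\<rho> + \<alpha>) * z) * (\<rho> + \<alpha>) - exp ((\<alpha> - \<gamma>) * z) * (\<alpha> - \<gamma>))
      + L / \<delta> * (exp (\<alpha> * z) * \<alpha> - exp ((\<alpha> - \<gamma>) * z) * (\<alpha> - \<gamma>)) = \<alpha> * exp (\<alpha> * z) * harm p L z"
      unfolding e e' harm_def scale_def lifetime_def
      using positive_parameters by (simp add: field_simps)
    finally show ?thesis .
  qed
  have "((\<lambda>z. \<alpha> * exp (\<alpha> * z) * harm p L z) has_integral G x - G 0) {0..x}"
    using assms(1) by (intro fundamental_theorem_of_calculus) (auto intro: dG simp flip: has_real_derivative_iff_has_vector_derivative)
  then have "integral {0..x} (\<lambda>z. \<alpha> * exp (\<alpha> * z) * harm p L z) = G x"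
    by (simp add: integral_unique G_def)
  moreover have "integral {0..x} (\<lambda>z. \<alpha> * exp (\<alpha> * z) * F z) = integral {0..x} (\<lambda>z. \<alpha> * exp (\<alpha> * z) * harm p L z)"
    by (rule integral_cong) (use F in auto)
  ultimately have "conv F x = exp (- \<alpha> * x) * G x"
    by (simp add: conv_def)
  also have "\<dots> = (exp (- \<alpha> * x) * exp (\<alpha> * x)) * (p * \<alpha> * (exp (\<rho> * x) - exp (- \<gamma> * x)) + L / \<delta> * (1 - exp (- \<gamma> * x)))"
    unfolding G_def e e' by (simp add: algebra_simps)
  also have "exp (- \<alpha> * x) * exp (\<alpha> * x) = 1" by (simp flip: exp_add)
  finally have "conv F x = p * \<alpha> * (exp (\<rho> * x) - exp (- \<gamma> * x)) + L / \<delta> * (1 - exp (- \<gamma> * x))"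
    by simp
  then have "r * conv F x = p * (r * \<alpha> * exp (\<rho> * x) - r * \<alpha> * exp (- \<gamma> * x)) + L * (r / \<delta> * (1 - exp (- \<gamma> * x)))"
    by (simp only:) (simp add: algebra_simps)
  also have "r * \<alpha> * exp (\<rho> * x) - r * \<alpha> * exp (- \<gamma> * x) = (r + \<delta>) * scale x - c * scale' x"
    unfolding scale_def scale'_def root_equation_\<rho>[symmetric]
    using root_equation_\<gamma> root_equation_\<rho> by algebra
  also have "r / \<delta> * (1 - exp (- \<gamma> * x)) = (r + \<delta>) * lifetime x - c * lifetime' x - 1"
  proof -
    have "(r + \<delta>) * lifetime x - c * lifetime' x - 1
      = r / \<delta> - ((r + \<delta> + c * \<gamma>) * (\<alpha> - \<gamma>)) / (\<alpha> * \<delta>) * exp (- \<gamma> * x)"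
      unfolding lifetime_def lifetime'_def using positive_parameters by (simp add: field_simps)
    then show ?thesis
      unfolding root_equation_\<gamma> using positive_parameters by (simp add: field_simps)
  qed
  finally show ?thesis
    unfolding harm_def harm'_def by (simp add: algebra_simps)
qed

text \<open>The first order equation satisfied by \<open>conv F\<close> is the analytic form of the
  memorylessness of the claims.\<close>

lemma DERIV_conv:
  assumes F: "continuous_on {0..} F" and "0 < x"
  shows "(conv F has_real_derivative \<alpha> * (F x - conv F x)) (at x)"
proof -
  have "((\<lambda>u. integral {0..u} (\<lambda>z. \<alpha> * exp (\<alpha> * z) * F z)) has_real_derivative \<alpha> * exp (\<alpha> * x) * F x)
      (at x within {0..x + 1})"
    using assms by (intro integral_has_real_derivative continuous_intros continuous_on_subset[OF F]) auto
  moreover have "at x within {0..x + 1} = at x"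
    by (rule at_within_Icc_at) (use assms in auto)
  ultimately have d: "((\<lambda>u. integral {0..u} (\<lambda>z. \<alpha> * exp (\<alpha> * z) * F z)) has_real_derivative \<alpha> * exp (\<alpha> * x) * F x) (at x)"
    by simp
  have ee: "exp (- \<alpha> * x) * exp (\<alpha> * x) = 1" by (simp flip: exp_add)
  have "(conv F has_real_derivative exp (- \<alpha> * x) * (- \<alpha>) * integral {0..x} (\<lambda>z. \<alpha> * exp (\<alpha> * z) * F z)
      + (\<alpha> * exp (\<alpha> * x) * F x) * exp (- \<alpha> * x)) (at x)"
    unfolding conv_def[abs_def] by (rule derivative_eq_intros d refl | simp)+
  also have "exp (- \<alpha> * x) * (- \<alpha>) * integral {0..x} (\<lambda>z. \<alpha> * exp (\<alpha> * z) * F z)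
      + (\<alpha> * exp (\<alpha> * x) * F x) * exp (- \<alpha> * x) = \<alpha> * (F x - conv F x)"
    using ee unfolding conv_def by algebra
  finally show ?thesis .
qed

lemma continuous_on_conv:
  assumes F: "continuous_on {0..} F"
  shows "continuous_on {0..} (conv F)"
proof -
  have "continuous_on {0..b} (conv F)" for b
    unfolding conv_def[abs_def]
    by (intro continuous_intros indefinite_integral_continuous_1 integrable_continuous_real
        continuous_on_subset[OF F]) auto
  then have c: "continuous (at x within {0..}) (conv F)" if "0 \<le> x" for x
  proof -
    have "continuous (at x within {0..x+1}) (conv F)"
      using \<open>continuous_on {0..x+1} (conv F)\<close> that by (auto simp: continuous_on_eq_continuous_within)
    moreover have "at x within {0..x+1} = at x within {0..}"
      by (rule at_within_nhd[where S="{x-1<..<x+1}"]) auto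
    ultimately show ?thesis by simp
  qed
  then show ?thesis by (auto simp: continuous_on_eq_continuous_within)
qed

lemma conv_nonneg:
  assumes F: "continuous_on {0..} F" and "\<And>x. 0 \<le> x \<Longrightarrow> 0 \<le> F x"
  shows "0 \<le> conv F x"
  unfolding conv_def using positive_parameters
  by (intro mult_nonneg_nonneg integral_nonneg integrable_continuous_real continuous_intros
      continuous_on_subset[OF F]) (auto intro: assms)

lemma conv_le:
  assumes F: "continuous_on {0..} F" and "0 \<le> x" and "0 \<le> B" and "\<And>z. 0 \<le> z \<Longrightarrow> z \<le> x \<Longrightarrow> F z \<le> B"
  shows "conv F x \<le> B"
proof -
  have "integral {0..x} (\<lambda>z. \<alpha> * exp (\<alpha> * z) * F z) \<le> B * exp (\<alpha> * x) - B * exp (\<alpha> * 0)"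
  proof (rule has_integral_le)
    show "((\<lambda>z. \<alpha> * exp (\<alpha> * z) * F z) has_integral integral {0..x} (\<lambda>z. \<alpha> * exp (\<alpha> * z) * F z)) {0..x}"
      by (intro integrable_integral integrable_continuous_real continuous_intros continuous_on_subset[OF F]) auto
    show "((\<lambda>z. \<alpha> * exp (\<alpha> * z) * B) has_integral B * exp (\<alpha> * x) - B * exp (\<alpha> * 0)) {0..x}"
      using assms(2) by (intro fundamental_theorem_of_calculus)
         (auto intro!: derivative_eq_intros simp flip: has_real_derivative_iff_has_vector_derivative)
  qed (use assms positive_parameters in auto)
  also have "\<dots> \<le> B * exp (\<alpha> * x)" using assms by simp
  finally have "conv F x \<le> exp (- \<alpha> * x) * (B * exp (\<alpha> * x))"
    unfolding conv_def by (intro mult_left_mono) auto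
  also have "\<dots> = B" by (simp add: exp_minus)
  finally show ?thesis .
qed

text \<open>The derivative \<open>\<alpha> * (F z - conv F z)\<close> is at most
  \<open>\<alpha> * F (x + s)\<close>. This replaces the convolution at the end of a time step by
  the one at its beginning, at a cost linear in the step.\<close>

lemma conv_add_le:
  assumes F: "continuous_on {0..} F" and nonneg: "\<And>x. 0 \<le> x \<Longrightarrow> 0 \<le> F x"
    and mono: "\<And>x y. 0 \<le> x \<Longrightarrow> x \<le> y \<Longrightarrow> F x \<le> F y" and "0 \<le> x" "0 \<le> s"
  shows "conv F (x + s) \<le> conv F x + s * \<alpha> * F (x + s)"
proof (cases "s = 0")
  case False
  then have "x < x + s" using assms by simp
  moreover have "continuous_on {x..x+s} (conv F)"
    using continuous_on_conv[OF F] by (rule continuous_on_subset) (use assms in auto)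
  moreover have "(conv F has_real_derivative \<alpha> * (F z - conv F z)) (at z)" if "x < z" for z
    using that assms by (intro DERIV_conv) auto
  ultimately obtain z where z: "x < z" "z < x + s"
      and "conv F (x + s) - conv F x = (x + s - x) * (\<alpha> * (F z - conv F z))"
    using MVT[of x "x + s" "conv F"] by (metis DERIV_unique real_differentiable_def)
  moreover have "\<alpha> * (F z - conv F z) \<le> \<alpha> * F (x + s)"
  proof -
    have "F z \<le> F (x + s)" using z assms(4) by (intro mono) auto
    then show ?thesis
      using conv_nonneg[OF F nonneg, of z] positive_parameters by (intro mult_left_mono) auto
  qed
  ultimately have "conv F (x + s) - conv F x = s * (\<alpha> * (F z - conv F z))"
    and "\<alpha> * (F z - conv F z) \<le> \<alpha> * F (x + s)" by auto
  then have "conv F (x + s) - conv F x \<le> s * (\<alpha> * F (x + s))"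
    using assms(5) mult_left_mono by metis
  then show ?thesis by (simp add: mult.assoc)
qed simp

end

section \<open>Barrier value functions\<close>

context cl_parameters
begin

text \<open>The left side is the discounted expectation after a step of length \<open>h\<close>: no
  claim, one claim charged after all premiums, and at least two claims, bounded as if they cost
  nothing. Concavity bounds the gain from premiums by its linear part, the generator inequality
  controls the order \<open>h\<close>, and linear growth of \<open>F\<close> gives the factor
  \<open>1 + x\<close> in the error.\<close>

lemma one_step_upper:
  fixes F F' :: "real \<Rightarrow> real"
  assumes cont: "continuous_on {0..} F" and nonneg: "\<And>x. 0 \<le> x \<Longrightarrow> 0 \<le> F x"
    and mono: "\<And>x y. 0 \<le> x \<Longrightarrow> x \<le> y \<Longrightarrow> F x \<le> F y"
    and concave: "\<And>x s. 0 \<le> x \<Longrightarrow> 0 \<le> s \<Longrightarrow> F (x + s) \<le> F x + s * F' x"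
    and F': "\<And>x. 0 \<le> x \<Longrightarrow> 0 \<le> F' x \<and> F' x \<le> A"
    and growth: "\<And>x. 0 \<le> x \<Longrightarrow> F x \<le> A * (1 + x)"
    and hjb: "\<And>x. 0 \<le> x \<Longrightarrow> c * F' x + r * conv F x - (r + \<delta>) * F x + L \<le> 0"
  obtains C where "0 \<le> C" and "\<And>x h. 0 \<le> x \<Longrightarrow> 0 \<le> h \<Longrightarrow> h \<le> 1 \<Longrightarrow>
    exp (- \<delta> * h) * (exp (- r * h) * F (x + c * h) + r * h * exp (- r * h) * conv F (x + c * h)
      + (r * h)\<^sup>2 * F (x + c * h)) + L * h \<le> F x + C * h\<^sup>2 * (1 + x)"
proof
  have A: "0 \<le> A" using F'[of 0] by auto
  define C where "C = r * c * \<alpha> * A * (1 + c) + r\<^sup>2 * A * (1 + c) + (r + \<delta>)\<^sup>2 * (A + c * A + r * A)"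
  show "0 \<le> C" unfolding C_def using A positive_parameters by (intro add_nonneg_nonneg mult_nonneg_nonneg) auto
  fix x h :: real assume x: "0 \<le> x" and h: "0 \<le> h" "h \<le> 1"
  define a where "a = r + \<delta>"
  define q where "q = exp (- a * h)"
  have a: "0 < a" using positive_parameters by (simp add: a_def)
  have q0: "0 < q" "q \<le> 1" using a h by (auto simp: q_def)
  \<comment> \<open>With \<open>y = a * h\<close> this is \<open>exp (- y) \<le> 1 / (1 + y)\<close>
    together with \<open>(1 - y + y\<^sup>2) * (1 + y) = 1 + y ^ 3 \<ge> 1\<close>.\<close>
  have q: "q \<le> 1 - a * h + (a * h)\<^sup>2"
  proof -
    have "0 \<le> a * h" using a h by simp
    have "1 + a * h \<le> exp (a * h)" by (rule exp_ge_add_one_self)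
    then have "q * (1 + a * h) \<le> q * exp (a * h)" using q0 by (intro mult_left_mono) auto
    also have "\<dots> = 1" by (simp add: q_def flip: exp_add)
    also have "\<dots> \<le> (1 - a * h + (a * h)\<^sup>2) * (1 + a * h)"
    proof -
      have "(1 - a * h + (a * h)\<^sup>2) * (1 + a * h) = 1 + (a * h) ^ 3"
        by (simp add: algebra_simps power2_eq_square power3_eq_cube)
      then show ?thesis using \<open>0 \<le> a * h\<close> by simp
    qed
    finally show ?thesis using \<open>0 \<le> a * h\<close> by (simp add: mult_le_cancel_right)
  qed
  define f2 where "f2 = F (x + c * h)"
  have ch: "0 \<le> c * h" using positive_parameters h by simp
  have f2: "0 \<le> f2" "f2 \<le> A * (1 + c) * (1 + x)"
  proof -
    show "0 \<le> f2" unfolding f2_def using x ch by (intro nonneg) auto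
    have "c * h \<le> c * 1" using h positive_parameters by (intro mult_left_mono) auto
    then have "1 + (x + c * h) \<le> 1 + x + c" by simp
    also have "\<dots> \<le> (1 + c) * (1 + x)" using x positive_parameters by (simp add: algebra_simps)
    finally have "A * (1 + (x + c * h)) \<le> A * ((1 + c) * (1 + x))" using A by (intro mult_left_mono)
    then show "f2 \<le> A * (1 + c) * (1 + x)" unfolding f2_def using growth[of "x + c * h"] x ch by (simp add: mult.assoc)
  qed
  have f2': "f2 \<le> F x + c * h * F' x" unfolding f2_def using x ch by (intro concave)
  have conv: "conv F (x + c * h) \<le> conv F x + c * h * \<alpha> * f2"
    unfolding f2_def using x ch by (intro conv_add_le cont nonneg mono) auto
  have conv0: "0 \<le> conv F x" by (intro conv_nonneg cont nonneg)
  have conv1: "conv F x \<le> A * (1 + x)"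
  proof (rule conv_le[OF cont x])
    show "F z \<le> A * (1 + x)" if "0 \<le> z" "z \<le> x" for z
      using mono[OF that] growth[OF x] by simp
  qed (use A x in simp)
  \<comment> \<open>\<open>U\<close> is the undiscounted expectation after the step to first order
    in \<open>h\<close>. It must be nonnegative because it is multiplied by an upper bound of
    \<open>q\<close>.\<close>
  define U where "U = F x + h * (c * F' x + r * conv F x)"
  have U0: "0 \<le> U" unfolding U_def using F'[of x] conv0 x h positive_parameters nonneg[of x]
    by (intro add_nonneg_nonneg mult_nonneg_nonneg) auto
  have Ax: "A \<le> A * (1 + x)" using A x by (simp add: algebra_simps)
  have W: "c * F' x + r * conv F x \<le> c * (A * (1 + x)) + r * (A * (1 + x))"
    using F'[of x] conv1 x positive_parameters Ax by (intro add_mono mult_left_mono) auto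
  have W0: "0 \<le> c * F' x + r * conv F x" using F'[of x] conv0 x positive_parameters by auto
  have U1: "U \<le> (A + c * A + r * A) * (1 + x)"
  proof -
    have "h * (c * F' x + r * conv F x) \<le> 1 * (c * F' x + r * conv F x)"
      using W0 h by (intro mult_right_mono) auto
    then show ?thesis unfolding U_def using growth[of x] W x by (simp add: algebra_simps)
  qed
  have "exp (- \<delta> * h) * (exp (- r * h) * f2 + r * h * exp (- r * h) * conv F (x + c * h) + (r * h)\<^sup>2 * f2)
      = q * (f2 + h * r * conv F (x + c * h)) + exp (- \<delta> * h) * (r * h)\<^sup>2 * f2"
    unfolding q_def a_def by (simp add: algebra_simps flip: exp_add)
  also have "q * (f2 + h * r * conv F (x + c * h)) \<le> q * (U + r * c * \<alpha> * h\<^sup>2 * f2)"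
  proof (rule mult_left_mono)
    have "h * r * conv F (x + c * h) \<le> h * r * (conv F x + c * h * \<alpha> * f2)"
      using h positive_parameters conv by (intro mult_left_mono) auto
    then show "f2 + h * r * conv F (x + c * h) \<le> U + r * c * \<alpha> * h\<^sup>2 * f2"
      using f2' unfolding U_def by (simp add: algebra_simps power2_eq_square)
  qed (use q0 in auto)
  also have "q * (U + r * c * \<alpha> * h\<^sup>2 * f2) \<le> q * U + r * c * \<alpha> * h\<^sup>2 * f2"
  proof -
    have "0 \<le> r * c * \<alpha> * h\<^sup>2 * f2" using f2 positive_parameters by simp
    from mult_right_mono[OF q0(2) this] show ?thesis by (simp add: algebra_simps)
  qed
  also have "q * U \<le> (1 - a * h + (a * h)\<^sup>2) * U" using q U0 by (rule mult_right_mono)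
  also have "\<dots> = F x + h * (c * F' x + r * conv F x - a * F x) - a * h\<^sup>2 * (c * F' x + r * conv F x) + (a * h)\<^sup>2 * U"
    unfolding U_def by (simp add: algebra_simps power2_eq_square)
  also have "\<dots> \<le> F x + h * (- L) + (a * h)\<^sup>2 * ((A + c * A + r * A) * (1 + x))"
  proof -
    have "h * (c * F' x + r * conv F x - a * F x) \<le> h * (- L)"
      using hjb[OF x] h by (intro mult_left_mono) (auto simp: a_def)
    moreover have "0 \<le> a * h\<^sup>2 * (c * F' x + r * conv F x)" using W0 a by simp
    moreover have "(a * h)\<^sup>2 * U \<le> (a * h)\<^sup>2 * ((A + c * A + r * A) * (1 + x))"
      using U1 by (intro mult_left_mono) auto
    ultimately show ?thesis by linarith
  qed
  also have "exp (- \<delta> * h) * (r * h)\<^sup>2 * f2 \<le> 1 * (r * h)\<^sup>2 * (A * (1 + c) * (1 + x))"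
    using f2 h positive_parameters by (intro mult_mono) auto
  also have "r * c * \<alpha> * h\<^sup>2 * f2 \<le> r * c * \<alpha> * h\<^sup>2 * (A * (1 + c) * (1 + x))"
    using f2 positive_parameters by (intro mult_left_mono) auto
  finally show "exp (- \<delta> * h) * (exp (- r * h) * F (x + c * h) + r * h * exp (- r * h) * conv F (x + c * h)
      + (r * h)\<^sup>2 * F (x + c * h)) + L * h \<le> F x + C * h\<^sup>2 * (1 + x)"
    unfolding f2_def[symmetric] C_def a_def by (simp add: algebra_simps power2_eq_square)
qed

text \<open>For the reverse inequality a quadratic Taylor remainder replaces concavity, and equality
  in the generator equation is required only on \<open>S\<close>, the set of states in which the
  surplus can be after a payment. The single claim is subtracted from \<open>x\<close> rather than
  from \<open>x + c * h\<close>: a claim of size at most \<open>x\<close> is survived at whatever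
  moment of the step it occurs.\<close>

lemma one_step_lower:
  fixes F F' :: "real \<Rightarrow> real"
  assumes cont: "continuous_on {0..} F" and nonneg: "\<And>x. 0 \<le> x \<Longrightarrow> 0 \<le> F x"
    and taylor: "\<And>x s. x \<in> S \<Longrightarrow> 0 \<le> s \<Longrightarrow> F x + s * F' x - B * s\<^sup>2 \<le> F (x + s)"
    and F': "\<And>x. x \<in> S \<Longrightarrow> 0 \<le> F' x \<and> F' x \<le> A"
    and bound: "\<And>x z. x \<in> S \<Longrightarrow> 0 \<le> z \<Longrightarrow> z \<le> x \<Longrightarrow> F z \<le> A"
    and S: "S \<subseteq> {0..}" and B: "0 \<le> B" and A: "0 \<le> A"
    and eq: "\<And>x. x \<in> S \<Longrightarrow> c * F' x + r * conv F x - (r + \<delta>) * F x + L = 0"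
  obtains C where "0 \<le> C" and "\<And>x h. x \<in> S \<Longrightarrow> 0 \<le> h \<Longrightarrow> h \<le> 1 \<Longrightarrow>
    F x \<le> exp (- \<delta> * h) * (exp (- r * h) * F (x + c * h) + r * h * exp (- r * h) * conv F x)
      + L * h + C * h\<^sup>2"
proof
  define C where "C = (r + \<delta>) * (c * A + r * A) + B * c\<^sup>2"
  show "0 \<le> C" unfolding C_def using A B positive_parameters by (intro add_nonneg_nonneg mult_nonneg_nonneg) auto
  fix x h :: real assume x: "x \<in> S" and h: "0 \<le> h" "h \<le> 1"
  then have x0: "0 \<le> x" using S by auto
  define a where "a = r + \<delta>"
  define q where "q = exp (- a * h)"
  have a: "0 < a" using positive_parameters by (simp add: a_def)
  have q0: "0 < q" "q \<le> 1" using a h by (auto simp: q_def)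
  have q: "1 - a * h \<le> q" unfolding q_def using exp_ge_add_one_self[of "- a * h"] by simp
  have ch: "0 \<le> c * h" using positive_parameters h by simp
  have conv0: "0 \<le> conv F x" by (intro conv_nonneg cont nonneg)
  have conv1: "conv F x \<le> A" using bound[OF x] x0 A by (intro conv_le cont) auto
  define W where "W = c * F' x + r * conv F x"
  have W: "0 \<le> W" "W \<le> c * A + r * A"
    unfolding W_def using F'[OF x] conv0 conv1 positive_parameters by (auto intro!: add_mono mult_left_mono)
  \<comment> \<open>Because \<open>W - a * F x = - L\<close>, the product
    \<open>(1 - a * h) * (F x + h * W)\<close> equals \<open>F x - L * h\<close> up to
    \<open>a * h\<^sup>2 * W\<close>; this and the Taylor remainder are the two parts of
    \<open>C\<close>.\<close>
  have "F x - L * h - C * h\<^sup>2 \<le> (1 - a * h) * (F x + h * W) - B * c\<^sup>2 * h\<^sup>2"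
  proof -
    have "W - a * F x = - L" using eq[OF x] by (simp add: W_def a_def)
    then have "h * (W - a * F x) = h * (- L)" by simp
    moreover have "a * h\<^sup>2 * W \<le> a * h\<^sup>2 * (c * A + r * A)" using W a by (intro mult_left_mono) auto
    ultimately show ?thesis unfolding C_def a_def[symmetric] by (simp add: algebra_simps power2_eq_square)
  qed
  also have "\<dots> \<le> q * (F x + h * W) - q * (B * c\<^sup>2 * h\<^sup>2)"
  proof -
    have "0 \<le> F x + h * W" using W h nonneg[OF x0] by simp
    from mult_right_mono[OF q this] show ?thesis
      using mult_right_mono[OF q0(2), of "B * c\<^sup>2 * h\<^sup>2"] B by simp
  qed
  also have "\<dots> = q * (F x + (c * h) * F' x - B * (c * h)\<^sup>2 + r * h * conv F x)"
    unfolding W_def by (simp add: algebra_simps power2_eq_square)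
  also have "\<dots> \<le> q * (F (x + c * h) + r * h * conv F x)"
    using taylor[OF x ch] q0 by (intro mult_left_mono) auto
  also have "\<dots> = exp (- \<delta> * h) * (exp (- r * h) * F (x + c * h) + r * h * exp (- r * h) * conv F x)"
    unfolding q_def a_def by (simp add: algebra_simps flip: exp_add)
  finally show "F x \<le> exp (- \<delta> * h) * (exp (- r * h) * F (x + c * h) + r * h * exp (- r * h) * conv F x)
      + L * h + C * h\<^sup>2" by simp
qed

text \<open>Solves the reflection condition \<open>harm' p L b = \<theta>\<close> for
  \<open>p\<close>: at the barrier an additional unit of surplus is paid out at once and is worth
  \<open>\<theta>\<close>.\<close>

definition barrier_coeff :: "real \<Rightarrow> real \<Rightarrow> real \<Rightarrow> real" where
  "barrier_coeff \<theta> L b = (\<theta> - L * lifetime' b) / scale' b"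

text \<open>The value of \<open>\<theta>\<close> times the discounted dividends plus \<open>L\<close> times the discounted lifetime under
  the strategy that reflects the surplus at the barrier \<open>b\<close>.\<close>

definition barrier_value :: "real \<Rightarrow> real \<Rightarrow> real \<Rightarrow> real \<Rightarrow> real" where
  "barrier_value \<theta> L b x = harm (barrier_coeff \<theta> L b) L (min b x) + \<theta> * max (x - b) 0"

definition barrier_value' :: "real \<Rightarrow> real \<Rightarrow> real \<Rightarrow> real \<Rightarrow> real" where
  "barrier_value' \<theta> L b x = harm' (barrier_coeff \<theta> L b) L (min b x)"

lemma harm'_barrier: "harm' (barrier_coeff \<theta> L b) L b = \<theta>"
  unfolding harm'_def barrier_coeff_def using scale'_pos[of b] by simp

section \<open>Regularity, monotonicity and sign of the barrier functions\<close>

lemma DERIV_barrier_value: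
  "(barrier_value \<theta> L b has_real_derivative barrier_value' \<theta> L b x) (at x)"
proof -
  let ?h = "harm (barrier_coeff \<theta> L b) L"
  have eq: "barrier_value \<theta> L b = (\<lambda>x. if x \<in> {..b} then ?h x else ?h b + \<theta> * (x - b))"
    unfolding barrier_value_def by (auto simp: fun_eq_iff min_def max_def)
  have "((\<lambda>x. if x \<in> {..b} then ?h x else ?h b + \<theta> * (x - b)) has_derivative
      (if x \<in> {..b} then (*) (harm' (barrier_coeff \<theta> L b) L x) else (*) \<theta>)) (at x within {..b} \<union> {b<..})"
  proof (rule has_derivative_If_within_closures[where T = "{b<..}" and f' = "\<lambda>x. (*) (harm' (barrier_coeff \<theta> L b) L x)" and g' = "\<lambda>_. (*) \<theta>"])
    show "x \<in> {..b} \<union> {b<..}" by auto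
    show "(?h has_derivative (*) (harm' (barrier_coeff \<theta> L b) L x)) (at x within {..b} \<union> closure {..b} \<inter> closure {b<..})"
      using DERIV_harm by (simp add: has_field_derivative_def)
    show "((\<lambda>x. ?h b + \<theta> * (x - b)) has_derivative (*) \<theta>) (at x within {b<..} \<union> closure {..b} \<inter> closure {b<..})"
      by (auto intro!: derivative_eq_intros)
    assume "x \<in> closure {..b}" "x \<in> closure {b<..}"
    then have "x = b" by auto
    then show "?h x = ?h b + \<theta> * (x - b)" "(*) (harm' (barrier_coeff \<theta> L b) L x) = (*) \<theta>"
      by (auto simp: harm'_barrier)
  qed
  moreover have "(if x \<in> {..b} then (*) (harm' (barrier_coeff \<theta> L b) L x) else (*) \<theta>)
      = (*) (barrier_value' \<theta> L b x)"
    by (auto simp: barrier_value'_def min_def harm'_barrier)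
  moreover have "{..b} \<union> {b<..} = (UNIV :: real set)" by auto
  ultimately show ?thesis unfolding eq has_field_derivative_def by simp
qed

lemma continuous_on_barrier_value: "continuous_on S (barrier_value \<theta> L b)"
  by (meson DERIV_barrier_value DERIV_isCont continuous_at_imp_continuous_on)

text \<open>Positivity does not hold term by term, since for \<open>\<theta> = 0\<close> the
  coefficient of \<open>scale\<close> is negative when \<open>L > 0\<close>. After multiplication by
  \<open>scale' b\<close> it amounts to the ratio \<open>lifetime' / scale'\<close> being
  decreasing; there the products of two decaying exponentials cancel, which leaves a comparison of
  \<open>exp (- \<gamma> * y)\<close> with \<open>exp (\<rho> * y)\<close>.\<close>

lemma barrier_value'_nonneg:
  assumes "0 \<le> \<theta>" "0 \<le> L"
  shows "0 \<le> barrier_value' \<theta> L b x"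
proof -
  let ?x = "min b x"
  have eq: "exp (- \<gamma> * b) * exp (\<rho> * y) \<le> exp (- \<gamma> * y) * exp (\<rho> * b)" if "y \<le> b" for y
  proof -
    have "- \<gamma> * b + \<rho> * y \<le> - \<gamma> * y + \<rho> * b"
      using that roots_pos by (intro add_mono) (auto intro: mult_left_mono)
    then show ?thesis by (simp flip: exp_add)
  qed
  have "lifetime' b * scale' y \<le> lifetime' y * scale' b" if "y \<le> b" for y
  proof -
    define k where "k = \<gamma> * (\<alpha> - \<gamma>) / (\<alpha> * \<delta>)"
    have "0 \<le> k" unfolding k_def using roots_pos \<gamma>_less_\<alpha> positive_parameters by auto
    have "lifetime' y * scale' b - lifetime' b * scale' y
      = k * (\<rho> * (\<rho> + \<alpha>)) * (exp (- \<gamma> * y) * exp (\<rho> * b) - exp (- \<gamma> * b) * exp (\<rho> * y))"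
      unfolding lifetime'_def scale'_def k_def[symmetric] by (simp add: algebra_simps)
    moreover have "0 \<le> k * (\<rho> * (\<rho> + \<alpha>)) * (exp (- \<gamma> * y) * exp (\<rho> * b) - exp (- \<gamma> * b) * exp (\<rho> * y))"
      using eq[OF that] \<open>0 \<le> k\<close> roots_pos positive_parameters by (intro mult_nonneg_nonneg) auto
    ultimately show ?thesis by linarith
  qed
  from this[of ?x] have "0 \<le> L * (lifetime' ?x * scale' b - lifetime' b * scale' ?x)" using assms by simp
  moreover have "0 \<le> \<theta> * scale' ?x" using assms scale'_pos[of ?x] by simp
  ultimately have "0 \<le> (\<theta> * scale' ?x + L * (lifetime' ?x * scale' b - lifetime' b * scale' ?x)) / scale' b"
    using scale'_pos[of b] by simp
  also have "\<dots> = barrier_value' \<theta> L b x"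
    unfolding barrier_value'_def harm'_def barrier_coeff_def using scale'_pos[of b] by (simp add: field_simps)
  finally show ?thesis .
qed

lemma barrier_value_mono:
  assumes "0 \<le> \<theta>" "0 \<le> L" "x \<le> y"
  shows "barrier_value \<theta> L b x \<le> barrier_value \<theta> L b y"
  by (rule DERIV_nonneg_imp_nondecreasing[OF assms(3)])
     (use DERIV_barrier_value barrier_value'_nonneg[OF assms(1,2)] in blast)

lemma barrier_value_equation:
  assumes "0 \<le> x" "x \<le> b"
  shows "c * barrier_value' \<theta> L b x + r * conv (barrier_value \<theta> L b) x - (r + \<delta>) * barrier_value \<theta> L b x + L = 0"
  using conv_harm[OF assms(1), of "barrier_value \<theta> L b" "barrier_coeff \<theta> L b" L] assms
  by (simp add: barrier_value_def barrier_value'_def)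

lemma conv_0: "conv F 0 = 0"
  by (simp add: conv_def)

text \<open>At 0 the convolution vanishes, so the equation expresses the value at 0 through the
  nonnegative slope and \<open>L\<close>; monotonicity does the rest.\<close>

lemma barrier_value_nonneg:
  assumes "0 \<le> \<theta>" "0 \<le> L" "0 \<le> b" "0 \<le> x"
  shows "0 \<le> barrier_value \<theta> L b x"
proof -
  have "(r + \<delta>) * barrier_value \<theta> L b 0 = c * barrier_value' \<theta> L b 0 + L"
    using barrier_value_equation[of 0 b \<theta> L] assms by (simp add: conv_0)
  then have "0 \<le> (r + \<delta>) * barrier_value \<theta> L b 0"
    using barrier_value'_nonneg[OF assms(1,2), of b 0] positive_parameters assms by simp
  then have "0 \<le> barrier_value \<theta> L b 0"
    using positive_parameters by (simp add: zero_le_mult_iff)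
  then show ?thesis using barrier_value_mono[OF assms(1,2,4), of b] by simp
qed

lemma barrier_value_jump: "barrier_value \<theta> L b x = barrier_value \<theta> L b (min b x) + \<theta> * max (x - b) 0"
  by (simp add: barrier_value_def)

text \<open>For a general barrier the second derivative may jump at \<open>b\<close>. Lipschitz
  continuity of the first derivative, which is constant beyond \<open>b\<close>, still yields a
  quadratic Taylor remainder.\<close>

lemma barrier_value'_lipschitz:
  assumes "0 \<le> b"
  obtains B where "0 \<le> B"
    "\<And>x y. 0 \<le> x \<Longrightarrow> x \<le> y \<Longrightarrow> \<bar>barrier_value' \<theta> L b y - barrier_value' \<theta> L b x\<bar> \<le> B * (y - x)"
proof -
  let ?p = "barrier_coeff \<theta> L b"
  have "bounded (harm'' ?p L ` {0..b})"
    by (intro compact_imp_bounded compact_continuous_image continuous_intros) auto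
  then obtain B where B: "\<forall>x\<in>{0..b}. \<bar>harm'' ?p L x\<bar> \<le> B" "0 < B"
    unfolding bounded_pos by auto
  have "\<bar>barrier_value' \<theta> L b y - barrier_value' \<theta> L b x\<bar> \<le> B * (y - x)" if "0 \<le> x" "x \<le> y" for x y
  proof -
    have "norm (harm' ?p L (min b y) - harm' ?p L (min b x)) \<le> B * norm (min b y - min b x)"
    proof (rule field_differentiable_bound[of "{0..b}" "harm' ?p L" "harm'' ?p L"])
      show "norm (harm'' ?p L z) \<le> B" if "z \<in> {0..b}" for z using B(1) that by simp
      show "min b x \<in> {0..b}" "min b y \<in> {0..b}" using \<open>0 \<le> x\<close> \<open>x \<le> y\<close> assms by auto
    qed (auto intro: DERIV_harm')
    also have "\<dots> \<le> B * (y - x)" using that B by (intro mult_left_mono) auto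
    finally show ?thesis by (simp add: barrier_value'_def)
  qed
  with B(2) show ?thesis by (intro that[of B]) auto
qed

lemma barrier_value_MVT:
  assumes "0 \<le> s"
  obtains z where "x \<le> z" "z \<le> x + s" "barrier_value \<theta> L b (x + s) = barrier_value \<theta> L b x + s * barrier_value' \<theta> L b z"
proof (cases "s = 0")
  case True then show ?thesis using that[of x] by simp
next
  case False
  then have "x < x + s" using assms by simp
  from MVT2[OF this DERIV_barrier_value[of \<theta> L b]] obtain z where "x < z" "z < x + s"
    "barrier_value \<theta> L b (x + s) - barrier_value \<theta> L b x = (x + s - x) * barrier_value' \<theta> L b z" by metis
  then show ?thesis using that[of z] by simp
qed

text \<open>After a payment the surplus lies in \<open>{0..b}\<close>, where the equation holds with
  equality. Only \<open>x + c * h\<close> can exceed \<open>b\<close>, and there the linear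
  extension of slope \<open>\<theta>\<close> accounts for the excess about to be paid.\<close>

lemma barrier_value_one_step_lower:
  assumes "0 \<le> \<theta>" "0 \<le> L" "0 \<le> b"
  obtains C where "0 \<le> C" and "\<And>x h. x \<in> {0..b} \<Longrightarrow> 0 \<le> h \<Longrightarrow> h \<le> 1 \<Longrightarrow>
    barrier_value \<theta> L b x \<le> exp (- \<delta> * h) * (exp (- r * h) * barrier_value \<theta> L b (x + c * h)
      + r * h * exp (- r * h) * conv (barrier_value \<theta> L b) x) + L * h + C * h\<^sup>2"
proof -
  let ?F = "barrier_value \<theta> L b" and ?F' = "barrier_value' \<theta> L b"
  obtain B where B: "0 \<le> B"
    "\<And>x y. 0 \<le> x \<Longrightarrow> x \<le> y \<Longrightarrow> \<bar>?F' y - ?F' x\<bar> \<le> B * (y - x)"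
    using barrier_value'_lipschitz[OF assms(3)] by blast
  have taylor: "?F x + s * ?F' x - B * s\<^sup>2 \<le> ?F (x + s)" if "x \<in> {0..b}" "0 \<le> s" for x s
  proof -
    obtain z where z: "x \<le> z" "z \<le> x + s" "?F (x + s) = ?F x + s * ?F' z"
      using barrier_value_MVT[OF \<open>0 \<le> s\<close>] by blast
    have "?F' x - B * s \<le> ?F' z"
    proof -
      have "B * (z - x) \<le> B * s" using z B by (intro mult_left_mono) auto
      then show ?thesis using B(2)[of x z] z that by auto
    qed
    then have "s * (?F' x - B * s) \<le> s * ?F' z" using that by (intro mult_left_mono)
    then show ?thesis using z by (simp add: algebra_simps power2_eq_square)
  qed
  define A where "A = max (?F b) (\<theta> + B * b)"
  have F'A: "?F' x \<le> A" if "x \<in> {0..b}" for x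
  proof -
    have "B * (b - x) \<le> B * b" using that B by (intro mult_left_mono) auto
    moreover have "?F' b = \<theta>" by (simp add: barrier_value'_def harm'_barrier)
    ultimately show ?thesis using B(2)[of x b] that unfolding A_def by auto
  qed
  have FA: "?F z \<le> A" if "z \<le> b" for z
    using barrier_value_mono[OF assms(1,2) that, of b] by (simp add: A_def)
  have A0: "0 \<le> A" using barrier_value_nonneg[OF assms assms(3)] by (simp add: A_def)
  show ?thesis
  proof (rule one_step_lower[of ?F "{0..b}" ?F' B A L])
    fix C assume "0 \<le> C" and "\<And>x h. x \<in> {0..b} \<Longrightarrow> 0 \<le> h \<Longrightarrow> h \<le> 1 \<Longrightarrow>
      ?F x \<le> exp (- \<delta> * h) * (exp (- r * h) * ?F (x + c * h) + r * h * exp (- r * h) * conv ?F x) + L * h + C * h\<^sup>2"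
    then show thesis by (rule that)
  next
    fix x assume "x \<in> {0..b}"
    then show "c * ?F' x + r * conv ?F x - (r + \<delta>) * ?F x + L = 0"
      by (intro barrier_value_equation) auto
  qed (simp_all add: FA F'A A0 taylor B(1) continuous_on_barrier_value barrier_value_nonneg[OF assms]
          barrier_value'_nonneg[OF assms(1,2)])
qed

text \<open>Without a barrier the states fill the half line. The error is still uniform, because
  \<open>lifetime\<close>, its slope and its curvature \<open>\<gamma> * lifetime'\<close> are
  bounded there.\<close>

lemma lifetime_one_step_lower:
  obtains C where "0 \<le> C" and "\<And>x h. x \<in> {0..} \<Longrightarrow> 0 \<le> h \<Longrightarrow> h \<le> 1 \<Longrightarrow>
    lifetime x \<le> exp (- \<delta> * h) * (exp (- r * h) * lifetime (x + c * h)
      + r * h * exp (- r * h) * conv lifetime x) + 1 * h + C * h\<^sup>2"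
proof -
  have cont: "continuous_on S lifetime" for S
    using DERIV_lifetime DERIV_continuous_on by blast
  have decr: "lifetime' z \<le> lifetime' x" if "x \<le> z" for x z
    unfolding lifetime'_def using that roots_pos \<gamma>_less_\<alpha> positive_parameters
    by (intro mult_left_mono) auto
  have incr: "lifetime' x - \<gamma> * lifetime' 0 * s \<le> lifetime' z" if "0 \<le> x" "x \<le> z" "z \<le> x + s" for x z s
  proof (cases "x = z")
    case True then show ?thesis using that roots_pos lifetime'_pos[of 0] by auto
  next
    case False
    then have "x < z" using that by simp
    from MVT2[OF this DERIV_lifetime'] obtain y where y: "x < y" "y < z"
      "lifetime' z - lifetime' x = (z - x) * (- \<gamma> * lifetime' y)" by metis
    have "\<gamma> * lifetime' y * (z - x) \<le> \<gamma> * lifetime' 0 * s"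
      using decr[of 0 y] y that roots_pos lifetime'_pos[of y] lifetime'_pos[of 0] by (intro mult_mono) auto
    then show ?thesis using y by (simp add: algebra_simps)
  qed
  have taylor: "lifetime x + s * lifetime' x - \<gamma> * lifetime' 0 * s\<^sup>2 \<le> lifetime (x + s)" if "x \<in> {0..}" "0 \<le> s" for x s
  proof (cases "s = 0")
    case False
    then have "x < x + s" using that by simp
    from MVT2[OF this DERIV_lifetime] obtain z where z: "x < z" "z < x + s"
      "lifetime (x + s) - lifetime x = (x + s - x) * lifetime' z" by metis
    have "s * (lifetime' x - \<gamma> * lifetime' 0 * s) \<le> s * lifetime' z"
      using incr[of x z s] z that by (intro mult_left_mono) auto
    then show ?thesis using z by (simp add: algebra_simps power2_eq_square)
  qed simp
  have eq: "c * lifetime' x + r * conv lifetime x - (r + \<delta>) * lifetime x + 1 = 0" if "x \<in> {0..}" for x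
    using conv_harm[of x lifetime 0 1] that by (simp add: harm_def harm'_def)
  have b1: "0 \<le> lifetime' x \<and> lifetime' x \<le> max (1 / \<delta>) (lifetime' 0)" if "x \<in> {0..}" for x
    using decr[of 0 x] lifetime'_pos[of x] that by auto
  have b2: "lifetime z \<le> max (1 / \<delta>) (lifetime' 0)" for z using lifetime_le[of z] by simp
  have b3: "0 \<le> max (1 / \<delta>) (lifetime' 0)" "0 \<le> \<gamma> * lifetime' 0"
    using positive_parameters roots_pos lifetime'_pos[of 0] by (auto simp: le_max_iff_disj)
  show ?thesis
  proof (rule one_step_lower[of lifetime "{0..}" lifetime' "\<gamma> * lifetime' 0" "max (1 / \<delta>) (lifetime' 0)" 1])
    fix C assume "0 \<le> C" and "\<And>x h. x \<in> {0..} \<Longrightarrow> 0 \<le> h \<Longrightarrow> h \<le> 1 \<Longrightarrow>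
      lifetime x \<le> exp (- \<delta> * h) * (exp (- r * h) * lifetime (x + c * h) + r * h * exp (- r * h) * conv lifetime x)
        + 1 * h + C * h\<^sup>2"
    then show thesis by (rule that)
  qed (fact cont lifetime_nonneg taylor eq subset_refl b3 b1 | rule b2)+
qed

text \<open>Beyond the barrier, \<open>exp (\<alpha> x)\<close> times the generator term is decreasing, and it vanishes at the
  barrier; the convexity hypothesis at \<open>b\<close> says that its slope there is at most \<open>0\<close>.\<close>

lemma barrier_value_hjb:
  assumes "0 \<le> L" "0 \<le> b" "0 \<le> harm'' (barrier_coeff 1 L b) L b" and x: "0 \<le> x"
  shows "c * barrier_value' 1 L b x + r * conv (barrier_value 1 L b) x - (r + \<delta>) * barrier_value 1 L b x + L \<le> 0"
proof (cases "x \<le> b")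
  case True then show ?thesis using barrier_value_equation[OF x] by simp
next
  case False
  let ?F = "barrier_value 1 L b" and ?p = "barrier_coeff 1 L b"
  define H where "H z = c + r * conv ?F z - (r + \<delta>) * ?F z + L" for z
  \<comment> \<open>Up to the factor \<open>exp (\<alpha> * b)\<close> this is the right derivative
    of \<open>exp (\<alpha> * z) * H z\<close> at \<open>b\<close>. The solutions satisfy \<open>c
    F'' + (c \<alpha> - r - \<delta>) F' - \<delta> \<alpha> F + \<alpha> L = 0\<close>, proved
    separately for \<open>scale\<close> and \<open>lifetime\<close>, which turns it into
    \<open>- c * harm''\<close>.\<close>
  have slope: "- \<alpha> * \<delta> * ?F b + \<alpha> * (c + L) - (r + \<delta>) \<le> 0"
  proof -
    have "- \<alpha> * \<delta> * ?F b + \<alpha> * (c + L) - (r + \<delta>)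
        = - \<alpha> * \<delta> * harm ?p L b + \<alpha> * (c * harm' ?p L b + L) - (r + \<delta>) * harm' ?p L b"
      by (simp add: barrier_value_def harm'_barrier)
    also have "\<dots> = - c * harm'' ?p L b"
    proof -
      have s: "c * scale'' b + (c * \<alpha> - r - \<delta>) * scale' b - \<delta> * \<alpha> * scale b = 0"
      proof -
        have "c * \<rho>\<^sup>2 + (c * \<alpha> - r - \<delta>) * \<rho> - \<delta> * \<alpha> = 0" "c * \<gamma>\<^sup>2 - (c * \<alpha> - r - \<delta>) * \<gamma> - \<delta> * \<alpha> = 0"
          using roots_difference roots_product by algebra+
        then show ?thesis unfolding scale''_def scale'_def scale_def by algebra
      qed
      have l: "c * (- \<gamma> * lifetime' b) + (c * \<alpha> - r - \<delta>) * lifetime' b - \<delta> * \<alpha> * lifetime b + \<alpha> = 0"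
      proof -
        have "c * \<gamma>\<^sup>2 - (c * \<alpha> - r - \<delta>) * \<gamma> - \<delta> * \<alpha> = 0"
          using roots_difference roots_product by algebra
        moreover have "c * (- \<gamma> * lifetime' b) + (c * \<alpha> - r - \<delta>) * lifetime' b - \<delta> * \<alpha> * lifetime b + \<alpha>
          = - (\<alpha> - \<gamma>) * exp (- \<gamma> * b) * (c * \<gamma>\<^sup>2 - (c * \<alpha> - r - \<delta>) * \<gamma> - \<delta> * \<alpha>) / (\<alpha> * \<delta>)"
          unfolding lifetime'_def lifetime_def using positive_parameters
          by (simp add: field_simps power2_eq_square)
        ultimately show ?thesis by simp
      qed
      show ?thesis unfolding harm_def harm'_def harm''_def using s l by algebra
    qed
    also have "\<dots> \<le> 0" using assms positive_parameters by simp
    finally show ?thesis .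
  qed
  have cont: "continuous_on {0..} ?F" by (rule continuous_on_barrier_value)
  have "exp (\<alpha> * x) * H x \<le> exp (\<alpha> * b) * H b"
  proof (rule DERIV_nonpos_imp_decreasing_open[where f = "\<lambda>z. exp (\<alpha> * z) * H z"])
    show "b \<le> x" using False by simp
    show "continuous_on {b..x} (\<lambda>z. exp (\<alpha> * z) * H z)"
      unfolding H_def by (intro continuous_intros continuous_on_subset[OF continuous_on_conv[OF cont]]
          continuous_on_barrier_value) (use assms in auto)
    fix z assume z: "b < z" "z < x"
    have Fz: "barrier_value' 1 L b z = 1" using z by (simp add: barrier_value'_def harm'_barrier)
    have "((\<lambda>z. exp (\<alpha> * z) * H z) has_real_derivative
       exp (\<alpha> * z) * \<alpha> * H z + (r * (\<alpha> * (?F z - conv ?F z)) - (r + \<delta>) * barrier_value' 1 L b z) * exp (\<alpha> * z)) (at z)"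
      unfolding H_def
      by (rule derivative_eq_intros DERIV_conv[OF cont] DERIV_barrier_value refl | use z assms in simp)+
    \<comment> \<open>The convolution terms cancel. The remaining bracket is decreasing in
      \<open>?F z\<close>, hence at most its value at the barrier, which is
      \<open>slope\<close>.\<close>
    moreover have "exp (\<alpha> * z) * \<alpha> * H z + (r * (\<alpha> * (?F z - conv ?F z)) - (r + \<delta>) * barrier_value' 1 L b z) * exp (\<alpha> * z)
      = exp (\<alpha> * z) * (- \<alpha> * \<delta> * ?F z + \<alpha> * (c + L) - (r + \<delta>))"
      unfolding H_def Fz by (simp add: algebra_simps)
    moreover have "\<alpha> * \<delta> * ?F b \<le> \<alpha> * \<delta> * ?F z"
      using barrier_value_mono[of 1 L b z b] z assms positive_parameters by (intro mult_left_mono) auto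
    then have "exp (\<alpha> * z) * (- \<alpha> * \<delta> * ?F z + \<alpha> * (c + L) - (r + \<delta>)) \<le> 0"
      using slope by (intro mult_nonneg_nonpos) auto
    ultimately show "\<exists>y. ((\<lambda>z. exp (\<alpha> * z) * H z) has_real_derivative y) (at z) \<and> y \<le> 0" by metis
  qed
  also have "H b = 0"
    using barrier_value_equation[of b b 1 L] assms by (simp add: H_def barrier_value'_def harm'_barrier)
  finally have "H x \<le> 0" by (simp add: mult_le_0_iff)
  moreover have "barrier_value' 1 L b x = 1" using False by (simp add: barrier_value'_def harm'_barrier)
  ultimately show ?thesis by (simp add: H_def)
qed

text \<open>Concavity below \<open>b\<close> and slope 1 above it make the derivative decreasing and
  at least 1. The first property feeds the one-step inequality; the second shows that paying
  \<open>d\<close> never gains more than the value lost.\<close>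

lemma barrier_value_supersolution:
  assumes "0 \<le> L" "0 \<le> b" "0 \<le> harm'' (barrier_coeff 1 L b) L b"
    and concave: "\<And>x. 0 \<le> x \<Longrightarrow> x < b \<Longrightarrow> harm'' (barrier_coeff 1 L b) L x \<le> 0"
  obtains C where "0 \<le> C" and "\<And>x h. 0 \<le> x \<Longrightarrow> 0 \<le> h \<Longrightarrow> h \<le> 1 \<Longrightarrow>
    exp (- \<delta> * h) * (exp (- r * h) * barrier_value 1 L b (x + c * h)
      + r * h * exp (- r * h) * conv (barrier_value 1 L b) (x + c * h)
      + (r * h)\<^sup>2 * barrier_value 1 L b (x + c * h)) + L * h \<le> barrier_value 1 L b x + C * h\<^sup>2 * (1 + x)"
    and "\<And>x d. 0 \<le> d \<Longrightarrow> d \<le> x \<Longrightarrow> barrier_value 1 L b (x - d) + d \<le> barrier_value 1 L b x"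
proof -
  let ?F = "barrier_value 1 L b" and ?F' = "barrier_value' 1 L b"
  have decr: "?F' y \<le> ?F' x" if "0 \<le> x" "x \<le> y" for x y
    unfolding barrier_value'_def
  proof (rule DERIV_nonpos_imp_decreasing_open[of _ _ "harm' (barrier_coeff 1 L b) L"])
    show "min b x \<le> min b y" using that by auto
    show "continuous_on {min b x..min b y} (harm' (barrier_coeff 1 L b) L)"
      by (meson DERIV_harm' DERIV_continuous_on)
    fix z assume "min b x < z" "z < min b y"
    then have "harm'' (barrier_coeff 1 L b) L z \<le> 0" using that assms(2) by (intro concave) auto
    then show "\<exists>y. (harm' (barrier_coeff 1 L b) L has_real_derivative y) (at z) \<and> y \<le> 0"
      using DERIV_harm' by blast
  qed
  have F'1: "1 \<le> ?F' x" if "0 \<le> x" for x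
    using decr[of x "max b x"] that by (simp add: barrier_value'_def harm'_barrier min_absorb1)
  have conc: "?F (x + s) \<le> ?F x + s * ?F' x" if "0 \<le> x" "0 \<le> s" for x s
  proof -
    obtain z where z: "x \<le> z" "?F (x + s) = ?F x + s * ?F' z"
      using barrier_value_MVT[OF \<open>0 \<le> s\<close>, of x 1 L b] by metis
    moreover have "s * ?F' z \<le> s * ?F' x" using decr[of x z] z that by (intro mult_left_mono) auto
    ultimately show ?thesis by simp
  qed
  have nonneg: "0 \<le> ?F x" if "0 \<le> x" for x using barrier_value_nonneg[of 1 L b x] assms that by simp
  define A where "A = ?F 0 + ?F' 0"
  have growth: "?F x \<le> A * (1 + x)" if "0 \<le> x" for x
  proof -
    have "0 \<le> x * ?F 0" using that nonneg[of 0] by simp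
    then show ?thesis using conc[of 0 x] F'1[of 0] that by (simp add: A_def algebra_simps)
  qed
  have "?F' x \<le> A" if "0 \<le> x" for x using decr[of 0 x] nonneg[of 0] that by (simp add: A_def)
  with F'1 have F': "0 \<le> ?F' x \<and> ?F' x \<le> A" if "0 \<le> x" for x using that by fastforce
  have slope1: "?F (x - d) + d \<le> ?F x" if "0 \<le> d" "d \<le> x" for x d
  proof -
    obtain z where z: "x - d \<le> z" "?F (x - d + d) = ?F (x - d) + d * ?F' z"
      using barrier_value_MVT[OF \<open>0 \<le> d\<close>, of "x - d" 1 L b] by metis
    moreover have "d * 1 \<le> d * ?F' z" using F'1[of z] z that by (intro mult_left_mono) auto
    ultimately show ?thesis by simp
  qed
  show ?thesis
  proof (rule one_step_upper[of ?F ?F' A L])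
    fix C assume C: "0 \<le> C" "\<And>x h. 0 \<le> x \<Longrightarrow> 0 \<le> h \<Longrightarrow> h \<le> 1 \<Longrightarrow>
      exp (- \<delta> * h) * (exp (- r * h) * ?F (x + c * h) + r * h * exp (- r * h) * conv ?F (x + c * h)
      + (r * h)\<^sup>2 * ?F (x + c * h)) + L * h \<le> ?F x + C * h\<^sup>2 * (1 + x)"
    show thesis by (rule that[OF C slope1])
  next
    show "?F x \<le> ?F y" if "x \<le> y" for x y using assms(1) that by (intro barrier_value_mono) auto
  next
    show "c * ?F' x + r * conv ?F x - (r + \<delta>) * ?F x + L \<le> 0" if "0 \<le> x" for x
      by (rule barrier_value_hjb[OF assms(1-3) that])
  qed (fact continuous_on_barrier_value nonneg conc F' growth)+
qed


text \<open>This combination annihilates the decaying exponential. It is the determinant of the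
  smooth-fit system, and the single positive exponential that remains gives both its sign and its
  growth.\<close>

lemma scale''_plus: "scale'' b + \<gamma> * scale' b = \<rho> * (\<rho> + \<gamma>) * (\<rho> + \<alpha>) * exp (\<rho> * b)"
  unfolding scale''_def scale'_def by (simp add: algebra_simps power2_eq_square)

lemma scale''_plus_pos: "0 < scale'' b + \<gamma> * scale' b"
  unfolding scale''_plus using roots_pos positive_parameters by simp

lemma scale''_mono: "x \<le> y \<Longrightarrow> scale'' x \<le> scale'' y"
  unfolding scale''_def using roots_pos \<gamma>_less_\<alpha> positive_parameters
  by (intro diff_mono mult_left_mono) auto

lemma lifetime'_antimono: "x \<le> y \<Longrightarrow> lifetime' y \<le> lifetime' x"
  unfolding lifetime'_def using roots_pos \<gamma>_less_\<alpha> positive_parameters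
  by (intro mult_left_mono) auto

text \<open>Smooth fit: with this multiplier the value function at the barrier \<open>b\<close> is twice differentiable
  at \<open>b\<close>.\<close>

definition multiplier :: "real \<Rightarrow> real" where
  "multiplier b = scale'' b / (lifetime' b * (scale'' b + \<gamma> * scale' b))"

lemma multiplier_nonneg: "0 \<le> scale'' b \<Longrightarrow> 0 \<le> multiplier b"
  unfolding multiplier_def using scale''_plus_pos[of b] lifetime'_pos[of b] by simp

text \<open>Unit slope and vanishing curvature at \<open>b\<close> read
  \<open>p * scale' b + m = 1\<close> and \<open>p * scale'' b = \<gamma> * m\<close> with
  \<open>m = L * lifetime' b\<close>. Solving this linear system gives both \<open>p\<close> and the
  formula for \<open>multiplier\<close>.\<close>

lemma barrier_coeff_multiplier: "barrier_coeff 1 (multiplier b) b = \<gamma> / (scale'' b + \<gamma> * scale' b)"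
proof -
  define s where "s = scale'' b + \<gamma> * scale' b"
  have "multiplier b * lifetime' b = scale'' b / s"
    unfolding multiplier_def s_def using lifetime'_pos[of b] by simp
  then have "barrier_coeff 1 (multiplier b) b = (1 - scale'' b / s) / scale' b"
    unfolding barrier_coeff_def by simp
  also have "1 - scale'' b / s = \<gamma> * scale' b / s"
    using scale''_plus_pos[of b] unfolding s_def by (simp add: field_simps)
  finally show ?thesis using scale'_pos[of b] by (simp add: s_def)
qed

lemma harm''_multiplier: "harm'' (barrier_coeff 1 (multiplier b) b) (multiplier b) b = 0"
  unfolding harm''_def barrier_coeff_multiplier unfolding multiplier_def
  using lifetime'_pos[of b] by simp

lemma harm''_mono:
  assumes "0 \<le> p" "0 \<le> L" "x \<le> y"
  shows "harm'' p L x \<le> harm'' p L y"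
  unfolding harm''_def using assms roots_pos lifetime'_antimono[OF assms(3)] scale''_mono[OF assms(3)]
  by (intro diff_mono mult_left_mono) auto

text \<open>The curvature is increasing in \<open>x\<close>, since \<open>scale''\<close> increases
  and \<open>lifetime'\<close> decreases; it vanishes at \<open>b\<close> by the choice of the
  multiplier, so it is nonpositive below.\<close>

lemma multiplier_supersolution:
  assumes "0 \<le> scale'' b" "x \<le> b"
  shows "harm'' (barrier_coeff 1 (multiplier b) b) (multiplier b) x \<le> 0"
proof -
  have "0 \<le> barrier_coeff 1 (multiplier b) b"
    unfolding barrier_coeff_multiplier using scale''_plus_pos[of b] roots_pos by simp
  from harm''_mono[OF this multiplier_nonneg[OF assms(1)] assms(2)] show ?thesis
    by (simp add: harm''_multiplier)
qed

lemma filterlim_exp_pos_multiple: "0 < (k :: real) \<Longrightarrow> filterlim (\<lambda>x. exp (k * x)) at_top at_top"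
  by (intro filterlim_compose[OF exp_at_top] filterlim_tendsto_pos_mult_at_top[OF tendsto_const] filterlim_ident)

lemma tendsto_exp_neg_multiple: "0 < (k :: real) \<Longrightarrow> ((\<lambda>x. exp (- k * x)) \<longlongrightarrow> 0) at_top"
  using tendsto_inverse_0_at_top[OF filterlim_exp_pos_multiple, of k] by (simp add: exp_minus)

text \<open>\<open>b0\<close> minimises \<open>scale'\<close> on the half line and is the optimal
  barrier of the problem without constraint, i.e. with multiplier 0. From \<open>b0\<close> upwards
  the smooth-fit multiplier is nonnegative.\<close>

lemma optimal_barrier_zero:
  obtains b0 where "0 \<le> b0" "0 \<le> scale'' b0"
    "\<And>x. 0 \<le> x \<Longrightarrow> x < b0 \<Longrightarrow> scale'' x \<le> 0"
proof (cases "0 \<le> scale'' 0")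
  case True then show ?thesis using that[of 0] by auto
next
  case False
  \<comment> \<open>At \<open>u\<close> the growing term of \<open>scale''\<close> has reached the
    size that the decaying one has at 0, so \<open>scale'' u \<ge> 0\<close> and the sign changes in
    between.\<close>
  define u where "u = ln (\<gamma>\<^sup>2 * (\<alpha> - \<gamma>) / (\<rho>\<^sup>2 * (\<rho> + \<alpha>))) / \<rho>"
  have pos: "0 < \<rho>\<^sup>2 * (\<rho> + \<alpha>)" "0 < \<gamma>\<^sup>2 * (\<alpha> - \<gamma>)" using roots_pos \<gamma>_less_\<alpha> positive_parameters by auto
  have "\<rho>\<^sup>2 * (\<rho> + \<alpha>) < \<gamma>\<^sup>2 * (\<alpha> - \<gamma>)" using False by (simp add: scale''_def)
  then have u: "0 \<le> u" unfolding u_def using pos roots_pos by simp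
  have "\<rho>\<^sup>2 * (\<rho> + \<alpha>) * exp (\<rho> * u) = \<gamma>\<^sup>2 * (\<alpha> - \<gamma>)"
    unfolding u_def using pos roots_pos by (simp add: field_simps)
  moreover have "\<gamma>\<^sup>2 * (\<alpha> - \<gamma>) * exp (- \<gamma> * u) \<le> \<gamma>\<^sup>2 * (\<alpha> - \<gamma>) * 1"
    using pos u roots_pos by (intro mult_left_mono) auto
  ultimately have "0 \<le> scale'' u" by (simp add: scale''_def)
  moreover have "continuous_on {0..u} scale''"
    unfolding scale''_def[abs_def] by (intro continuous_intros)
  ultimately obtain b0 where b0: "0 \<le> b0" "scale'' b0 = 0"
    using IVT'[of scale'' 0 0 u] False u by auto
  show ?thesis
    by (rule that[OF b0(1)]) (use b0 scale''_mono[of _ b0] in auto)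
qed

lemma barrier_value_split: "barrier_value 1 L b x = barrier_value 1 0 b x + L * barrier_value 0 1 b x"
  unfolding barrier_value_def harm_def barrier_coeff_def using scale'_pos[of b] by (simp add: field_simps)

section \<open>Dependence on the barrier: continuity and limits\<close>

lemma continuous_on_multiplier: "continuous_on S multiplier"
proof -
  have "lifetime' x * (scale'' x + \<gamma> * scale' x) \<noteq> 0" for x
    using lifetime'_pos[of x] scale''_plus_pos[of x] by simp
  moreover have "continuous_on S scale''" "continuous_on S scale'" "continuous_on S lifetime'"
    unfolding scale''_def[abs_def] scale'_def[abs_def] lifetime'_def[abs_def] by (intro continuous_intros)+
  ultimately show ?thesis
    unfolding multiplier_def[abs_def] by (intro continuous_intros) auto
qed

lemma continuous_on_barrier_lifetime: "continuous_on S (\<lambda>b. barrier_value 0 1 b x)"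
proof -
  have "scale' b \<noteq> 0" for b using scale'_pos[of b] by simp
  moreover have "continuous_on S scale'" "continuous_on S lifetime'"
    "continuous_on S (\<lambda>b. scale (min b x))" "continuous_on S (\<lambda>b. lifetime (min b x))"
    unfolding scale_def[abs_def] lifetime_def[abs_def] scale'_def[abs_def] lifetime'_def[abs_def]
    using positive_parameters by (intro continuous_intros; simp)+
  ultimately show ?thesis
    unfolding barrier_value_def harm_def barrier_coeff_def by (intro continuous_intros) auto
qed

lemma filterlim_scale': "filterlim scale' at_top at_top"
proof (rule filterlim_at_top_mono)
  show "filterlim (\<lambda>x. \<rho> * (\<rho> + \<alpha>) * exp (\<rho> * x)) at_top at_top"
    using roots_pos positive_parameters
    by (intro filterlim_tendsto_pos_mult_at_top[OF tendsto_const] filterlim_exp_pos_multiple) auto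
  show "eventually (\<lambda>x. \<rho> * (\<rho> + \<alpha>) * exp (\<rho> * x) \<le> scale' x) at_top"
    unfolding scale'_def using roots_pos \<gamma>_less_\<alpha> by (intro always_eventually) auto
qed

text \<open>For \<open>b \<ge> x\<close> the loss of lifetime due to reflection is exactly
  \<open>lifetime' b / scale' b * scale x\<close>, whose numerator stays bounded while the
  denominator grows.\<close>

lemma tendsto_barrier_lifetime: "((\<lambda>b. barrier_value 0 1 b x) \<longlongrightarrow> lifetime x) at_top"
proof -
  have u: "((\<lambda>b. lifetime' 0 / scale' b) \<longlongrightarrow> 0) at_top"
    by (intro tendsto_divide_0[OF tendsto_const] filterlim_at_top_imp_at_infinity filterlim_scale')
  have "((\<lambda>b. lifetime' b / scale' b) \<longlongrightarrow> 0) at_top"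
  proof (rule tendsto_sandwich[OF _ _ tendsto_const u])
    show "eventually (\<lambda>b. 0 \<le> lifetime' b / scale' b) at_top"
      using lifetime'_pos scale'_pos by (intro always_eventually) (auto intro: less_imp_le divide_pos_pos)
    show "eventually (\<lambda>b. lifetime' b / scale' b \<le> lifetime' 0 / scale' b) at_top"
      using eventually_ge_at_top[of 0]
      by eventually_elim (auto intro!: divide_right_mono lifetime'_antimono less_imp_le[OF scale'_pos])
  qed
  then have "((\<lambda>b. lifetime x - lifetime' b / scale' b * scale x) \<longlongrightarrow> lifetime x - 0 * scale x) at_top"
    by (intro tendsto_intros)
  moreover have "eventually (\<lambda>b. lifetime x - lifetime' b / scale' b * scale x = barrier_value 0 1 b x) at_top"
    using eventually_ge_at_top[of x]
    by eventually_elim (simp add: barrier_value_def harm_def barrier_coeff_def min_absorb2)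
  ultimately show ?thesis using tendsto_cong by fastforce
qed

text \<open>The multiplier factors into a term converging to
  \<open>1 - \<gamma> / (\<rho> + \<gamma>) > 0\<close> and \<open>1 / lifetime' b\<close>, which
  grows like \<open>exp (\<gamma> * b)\<close>. This growth forces the dual value to minus infinity
  when the constraint is infeasible.\<close>

lemma filterlim_multiplier: "filterlim multiplier at_top at_top"
proof -
  have eq: "multiplier b = (1 - \<gamma> * (scale' b / (scale'' b + \<gamma> * scale' b))) * (1 / lifetime' b)" for b
  proof -
    have "1 - \<gamma> * (scale' b / (scale'' b + \<gamma> * scale' b)) = scale'' b / (scale'' b + \<gamma> * scale' b)"
      using scale''_plus_pos[of b] by (simp add: field_simps)
    then show ?thesis unfolding multiplier_def by simp
  qed
  have "scale' b / (scale'' b + \<gamma> * scale' b)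
      = 1 / (\<rho> + \<gamma>) + \<gamma> * (\<alpha> - \<gamma>) / (\<rho> * (\<rho> + \<gamma>) * (\<rho> + \<alpha>)) * (exp (- \<gamma> * b) * exp (- \<rho> * b))" for b
  proof -
    have nz: "\<rho> \<noteq> 0" "\<rho> + \<gamma> \<noteq> 0" "\<rho> + \<alpha> \<noteq> 0" using roots_pos positive_parameters by auto
    have "exp (- \<rho> * b) = 1 / exp (\<rho> * b)" by (simp add: exp_minus divide_inverse)
    then show ?thesis
      unfolding scale''_plus unfolding scale'_def add_divide_distrib using nz by simp
  qed
  moreover have "((\<lambda>b. 1 / (\<rho> + \<gamma>) + \<gamma> * (\<alpha> - \<gamma>) / (\<rho> * (\<rho> + \<gamma>) * (\<rho> + \<alpha>)) * (exp (- \<gamma> * b) * exp (- \<rho> * b)))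
      \<longlongrightarrow> 1 / (\<rho> + \<gamma>) + \<gamma> * (\<alpha> - \<gamma>) / (\<rho> * (\<rho> + \<gamma>) * (\<rho> + \<alpha>)) * (0 * 0)) at_top"
    by (intro tendsto_add tendsto_mult tendsto_const tendsto_exp_neg_multiple roots_pos)
  ultimately have "((\<lambda>b. scale' b / (scale'' b + \<gamma> * scale' b)) \<longlongrightarrow> 1 / (\<rho> + \<gamma>)) at_top"
    by simp
  then have "((\<lambda>b. 1 - \<gamma> * (scale' b / (scale'' b + \<gamma> * scale' b))) \<longlongrightarrow> 1 - \<gamma> * (1 / (\<rho> + \<gamma>))) at_top"
    by (intro tendsto_diff tendsto_mult tendsto_const)
  moreover have "0 < 1 - \<gamma> * (1 / (\<rho> + \<gamma>))" using roots_pos by (simp add: field_simps)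
  moreover have "filterlim (\<lambda>b. 1 / lifetime' b) at_top at_top"
  proof -
    define k where "k = \<gamma> * (\<alpha> - \<gamma>) / (\<alpha> * \<delta>)"
    have "0 < k" unfolding k_def using roots_pos \<gamma>_less_\<alpha> positive_parameters by auto
    then have "filterlim (\<lambda>b. 1 / k * exp (\<gamma> * b)) at_top at_top"
      by (intro filterlim_tendsto_pos_mult_at_top[OF tendsto_const] filterlim_exp_pos_multiple roots_pos) auto
    moreover have "1 / k * exp (\<gamma> * b) = 1 / lifetime' b" for b
      unfolding lifetime'_def k_def[symmetric] by (simp add: exp_minus divide_simps)
    ultimately show ?thesis by simp
  qed
  ultimately show ?thesis unfolding eq
    by (rule filterlim_tendsto_pos_mult_at_top)
qed

text \<open>Although the multiplier explodes, the coefficient of \<open>scale\<close> decays like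
  \<open>exp (- \<rho> * b)\<close>, so for fixed capital only the lifetime part of the dual bound
  matters in the limit.\<close>

lemma tendsto_coeff_multiplier: "((\<lambda>b. barrier_coeff 1 (multiplier b) b) \<longlongrightarrow> 0) at_top"
  unfolding barrier_coeff_multiplier scale''_plus using roots_pos positive_parameters
  by (intro tendsto_divide_0[OF tendsto_const] filterlim_at_top_imp_at_infinity
      filterlim_tendsto_pos_mult_at_top[OF tendsto_const] filterlim_exp_pos_multiple) auto

end

section \<open>Independence of the next claim from the past\<close>

lemma space_generated_algebra: "space (generated_algebra M I X R) = space M"
  unfolding generated_algebra_def by (simp add: space_measure_of_conv)

lemma sets_generated_algebra:
  "sets (generated_algebra M I X R) = sigma_sets (space M) {X i -` B \<inter> space M | i B. i \<in> I \<and> B \<in> sets R}"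
  unfolding generated_algebra_def by (rule sets_measure_of) auto

lemma measurable_generated_algebra:
  assumes "i \<in> I" "\<And>\<omega>. \<omega> \<in> space M \<Longrightarrow> X i \<omega> \<in> space R"
  shows "X i \<in> measurable (generated_algebra M I X R) R"
  unfolding measurable_def space_generated_algebra sets_generated_algebra
  using assms by (auto intro!: sigma_sets.Basic)

lemma sets_generated_algebra_subset:
  assumes "\<And>i. i \<in> I \<Longrightarrow> X i \<in> measurable M R"
  shows "sets (generated_algebra M I X R) \<subseteq> sets M"
  unfolding sets_generated_algebra
  by (rule sets.sigma_sets_subset) (use assms in \<open>auto intro: measurable_sets\<close>)

sublocale cramer_lundberg_exponential \<subseteq> cl_parameters
  by unfold_locales (fact c_pos r_pos \<alpha>_pos \<delta>_pos)+

context cramer_lundberg_exponential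
begin

abbreviation S :: "real \<Rightarrow> 'a \<Rightarrow> real" where "S \<equiv> total_claims N Y"

abbreviation claim_law :: "real measure" where
  "claim_law \<equiv> density lborel (exponential_density \<alpha>)"

lemma measurable_N [measurable]: "0 \<le> t \<Longrightarrow> N t \<in> measurable M (count_space UNIV)"
  using poisson_N by (auto simp: poisson_process_def)

lemma measurable_Y [measurable]: "1 \<le> i \<Longrightarrow> Y i \<in> borel_measurable M"
  using exponential_Y[of i] by (auto simp: distributed_def)

lemma N_0: "\<omega> \<in> space M \<Longrightarrow> N 0 \<omega> = 0"
  using poisson_N by (auto simp: poisson_process_def)

lemma N_mono: "\<omega> \<in> space M \<Longrightarrow> 0 \<le> s \<Longrightarrow> s \<le> t \<Longrightarrow> N s \<omega> \<le> N t \<omega>"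
  using poisson_N by (auto simp: poisson_process_def mono_on_def)

lemma N_cadlag: "\<omega> \<in> space M \<Longrightarrow> cadlag (\<lambda>t. real (N t \<omega>))"
  using poisson_N by (auto simp: poisson_process_def)

lemma measurable_S [measurable]: assumes "0 \<le> t" shows "S t \<in> borel_measurable M"
  unfolding total_claims_def
proof (rule measurable_compose_countable[where g = "N t" and f = "\<lambda>n \<omega>. \<Sum>i=1..n. Y i \<omega>"])
  show "(\<lambda>\<omega>. \<Sum>i=1..n. Y i \<omega>) \<in> borel_measurable M" for n
    by (intro borel_measurable_sum measurable_Y) auto
qed (use assms in measurable)

lemma measurable_surplus: "0 \<le> t \<Longrightarrow> surplus c S x0 t \<in> borel_measurable M"
  unfolding surplus_def by measurable

lemma sets_natural_filtration: "sets (natural_filtration M (surplus c S x0) t) \<subseteq> sets M"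
  unfolding natural_filtration_def by (rule sets_generated_algebra_subset) (auto intro: measurable_surplus)

lemma space_natural_filtration: "space (natural_filtration M X t) = space M"
  unfolding natural_filtration_def by (rule space_generated_algebra)

lemma measurable_natural_filtration:
  "f \<in> measurable (natural_filtration M (surplus c S x0) t) R \<Longrightarrow> f \<in> measurable M R"
  using sets_natural_filtration[of x0 t] by (auto simp: measurable_def space_natural_filtration)

text \<open>Independence is given only for increments along one monotone sequence of times. The
  values of \<open>N\<close> on a finite set of times up to \<open>t\<close> are partial sums of
  such increments, so a cylinder event becomes an event about all increments but the last.\<close>

lemma indep_cylinder_increment:
  assumes t: "0 \<le> t" "t < u" and I: "finite I" "I \<subseteq> {0..t}"
  shows "prob ({\<omega>\<in>space M. \<forall>s\<in>I. N s \<omega> \<in> B s} \<inter> {\<omega>\<in>space M. N u \<omega> - N t \<omega> \<in> J})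
    = prob {\<omega>\<in>space M. \<forall>s\<in>I. N s \<omega> \<in> B s} * prob {\<omega>\<in>space M. N u \<omega> - N t \<omega> \<in> J}"
proof -
  \<comment> \<open>Time 0 is added so that the partial sums start from \<open>N 0 = 0\<close>, and
    time \<open>t\<close> so that the last increment is the one over \<open>(t, u]\<close>.\<close>
  define xs where "xs = sorted_list_of_set (insert 0 (insert t I))"
  define n where "n = length xs"
  have set_xs: "set xs = insert 0 (insert t I)" and sorted: "sorted xs"
    unfolding xs_def using I by (simp_all only: set_sorted_list_of_set sorted_sorted_list_of_set finite_insert)
  have n: "0 < n" using set_xs by (auto simp: n_def)
  have xs_le: "xs ! i \<le> t" "0 \<le> xs ! i" if "i < n" for i
    using that set_xs nth_mem[of i xs] I t by (auto simp: n_def)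
  have xs0: "xs ! 0 = 0"
  proof -
    obtain k where "k < n" "xs ! k = 0" using set_xs unfolding n_def by (metis in_set_conv_nth insertI1)
    then show ?thesis using sorted_nth_mono[OF sorted, of 0 k] xs_le(2)[OF n] by (auto simp: n_def)
  qed
  have xsn: "xs ! (n - 1) = t"
  proof -
    obtain k where "k < n" "xs ! k = t" using set_xs unfolding n_def by (metis in_set_conv_nth insertI1 insertI2)
    then show ?thesis using sorted_nth_mono[OF sorted, of k "n - 1"] xs_le(1)[of "n - 1"] n by (auto simp: n_def)
  qed
  \<comment> \<open>The definition of a Poisson process speaks of infinite sequences of times; from
    index \<open>n\<close> on the sequence stays at \<open>u\<close>, so increment
    \<open>n - 1\<close> leads from \<open>t\<close> to \<open>u\<close>.\<close>
  define \<tau> where "\<tau> i = (if i < n then xs ! i else u)" for i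
  have \<tau>0: "\<tau> 0 = 0" using n xs0 by (simp add: \<tau>_def)
  have \<tau>_mono: "mono \<tau>"
    unfolding mono_def \<tau>_def using sorted_nth_mono[OF sorted] xs_le t
    by (auto simp: n_def) (metis less_imp_le order_trans)
  define \<Delta> where "\<Delta> i \<omega> = N (\<tau> (Suc i)) \<omega> - N (\<tau> i) \<omega>" for i \<omega>
  have ind: "indep_vars (\<lambda>_. count_space UNIV) \<Delta> {..<n}"
    using poisson_N \<tau>_mono \<tau>0 unfolding poisson_process_def \<Delta>_def by auto
  have tele: "N (\<tau> i) \<omega> = (\<Sum>k<i. \<Delta> k \<omega>)" if "\<omega> \<in> space M" for i \<omega>
  proof (induction i)
    case 0 then show ?case using N_0[OF that] by (simp add: \<tau>0)
  next
    case (Suc i)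
    have "0 \<le> \<tau> i" using monoD[OF \<tau>_mono, of 0 i] \<tau>0 by simp
    then have "N (\<tau> i) \<omega> \<le> N (\<tau> (Suc i)) \<omega>"
      using N_mono[OF that] monoD[OF \<tau>_mono, of i "Suc i"] by simp
    then show ?case using Suc by (simp add: \<Delta>_def)
  qed
  have last: "\<Delta> (n - Suc 0) \<omega> = N u \<omega> - N t \<omega>" for \<omega>
    unfolding \<Delta>_def \<tau>_def using n xsn by simp
  let ?P = "\<lambda>K. PiM K (\<lambda>_. count_space UNIV :: nat measure)"
  have iv: "indep_var (?P {..<n-1}) (\<lambda>\<omega>. restrict (\<lambda>i. \<Delta> i \<omega>) {..<n-1}) (?P {n-1}) (\<lambda>\<omega>. restrict (\<lambda>i. \<Delta> i \<omega>) {n-1})"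
    using n by (intro indep_var_restrict[OF ind]) auto
  define Q1 where "Q1 = {v \<in> space (?P {..<n-1}). \<forall>i<n. xs ! i \<in> I \<longrightarrow> (\<Sum>k<i. v k) \<in> B (xs ! i)}"
  define Q2 where "Q2 = {v \<in> space (?P {n-1}). v (n-1) \<in> J}"
  \<comment> \<open>A finite product of copies of the discrete natural numbers is again discrete, so
    every set of increments is measurable.\<close>
  have P: "?P K = count_space (PiE K (\<lambda>_. UNIV))" if "finite K" for K
    by (rule count_space_PiM_finite[OF that]) simp
  have Q: "Q1 \<in> sets (?P {..<n-1})" "Q2 \<in> sets (?P {n-1})"
    unfolding Q1_def Q2_def by (auto simp: P)
  have e1: "(\<lambda>\<omega>. restrict (\<lambda>i. \<Delta> i \<omega>) {..<n-1}) -` Q1 \<inter> space M = {\<omega>\<in>space M. \<forall>s\<in>I. N s \<omega> \<in> B s}"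
  proof -
    have sum: "(\<Sum>k<i. restrict (\<lambda>i. \<Delta> i \<omega>) {..<n-1} k) = (\<Sum>k<i. \<Delta> k \<omega>)" if "i < n" for i \<omega>
      by (rule sum.cong) (use that in auto)
    have "(\<lambda>\<omega>. restrict (\<lambda>i. \<Delta> i \<omega>) {..<n-1}) -` Q1 \<inter> space M
      = {\<omega>\<in>space M. \<forall>i<n. xs ! i \<in> I \<longrightarrow> (\<Sum>k<i. restrict (\<lambda>i. \<Delta> i \<omega>) {..<n-1} k) \<in> B (xs ! i)}"
      unfolding Q1_def by (auto simp: space_PiM simp del: restrict_apply)
    also have "\<dots> = {\<omega>\<in>space M. \<forall>i<n. xs ! i \<in> I \<longrightarrow> (\<Sum>k<i. \<Delta> k \<omega>) \<in> B (xs ! i)}"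
      using sum by (auto simp del: restrict_apply)
    also have "\<dots> = {\<omega>\<in>space M. \<forall>i<n. xs ! i \<in> I \<longrightarrow> N (xs ! i) \<omega> \<in> B (xs ! i)}"
    proof -
      have "N (xs ! i) \<omega> = (\<Sum>k<i. \<Delta> k \<omega>)" if "\<omega> \<in> space M" "i < n" for i \<omega>
        using tele[OF that(1), of i] that(2) by (simp add: \<tau>_def)
      then show ?thesis by auto
    qed
    also have "\<dots> = {\<omega>\<in>space M. \<forall>s\<in>I. N s \<omega> \<in> B s}"
      using set_xs by (auto simp: n_def in_set_conv_nth all_set_conv_all_nth) (metis in_set_conv_nth insertI2)
    finally show ?thesis .
  qed
  have e2: "(\<lambda>\<omega>. restrict (\<lambda>i. \<Delta> i \<omega>) {n-1}) -` Q2 \<inter> space M = {\<omega>\<in>space M. N u \<omega> - N t \<omega> \<in> J}"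
    unfolding Q2_def using last by (auto simp: space_PiM)
  have "(\<lambda>\<omega>. (restrict (\<lambda>i. \<Delta> i \<omega>) {..<n-1}, restrict (\<lambda>i. \<Delta> i \<omega>) {n-1})) -` (Q1 \<times> Q2) \<inter> space M
     = {\<omega>\<in>space M. \<forall>s\<in>I. N s \<omega> \<in> B s} \<inter> {\<omega>\<in>space M. N u \<omega> - N t \<omega> \<in> J}"
    using e1 e2 by auto
  then show ?thesis using indep_varD[OF iv Q] unfolding e1 e2 by simp
qed

lemma indep_Y_next:
  assumes Q: "Q \<in> sets (PiM {1..n} (\<lambda>_. borel))" and B: "B \<in> sets borel"
  shows "prob ({\<omega>\<in>space M. restrict (\<lambda>i. Y i \<omega>) {1..n} \<in> Q} \<inter> {\<omega>\<in>space M. Y (Suc n) \<omega> \<in> B})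
    = prob {\<omega>\<in>space M. restrict (\<lambda>i. Y i \<omega>) {1..n} \<in> Q} * prob {\<omega>\<in>space M. Y (Suc n) \<omega> \<in> B}"
proof -
  have iv: "indep_var (PiM {1..n} (\<lambda>_. borel)) (\<lambda>\<omega>. restrict (\<lambda>i. Y i \<omega>) {1..n})
      (PiM {Suc n} (\<lambda>_. borel)) (\<lambda>\<omega>. restrict (\<lambda>i. Y i \<omega>) {Suc n})"
    by (rule indep_var_restrict[OF indep_Y]) auto
  define Q2 :: "(nat \<Rightarrow> real) set" where "Q2 = (\<lambda>v. v (Suc n)) -` B \<inter> space (PiM {Suc n} (\<lambda>_. borel))"
  have Q2: "Q2 \<in> sets (PiM {Suc n} (\<lambda>_. borel))"
    unfolding Q2_def
    using measurable_sets[OF measurable_component_singleton[of "Suc n" "{Suc n}" "\<lambda>_. borel"], of B] B by simp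
  have Q2_iff: "restrict (\<lambda>i. Y i \<omega>) {Suc n} \<in> Q2 \<longleftrightarrow> Y (Suc n) \<omega> \<in> B" for \<omega>
    by (simp add: Q2_def space_PiM)
  have "(\<lambda>\<omega>. (restrict (\<lambda>i. Y i \<omega>) {1..n}, restrict (\<lambda>i. Y i \<omega>) {Suc n})) -` (Q \<times> Q2) \<inter> space M
    = {\<omega>\<in>space M. restrict (\<lambda>i. Y i \<omega>) {1..n} \<in> Q} \<inter> {\<omega>\<in>space M. Y (Suc n) \<omega> \<in> B}"
    "(\<lambda>\<omega>. restrict (\<lambda>i. Y i \<omega>) {1..n}) -` Q \<inter> space M = {\<omega>\<in>space M. restrict (\<lambda>i. Y i \<omega>) {1..n} \<in> Q}"
    "(\<lambda>\<omega>. restrict (\<lambda>i. Y i \<omega>) {Suc n}) -` Q2 \<inter> space M = {\<omega>\<in>space M. Y (Suc n) \<omega> \<in> B}"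
    by (simp_all only: Q2_iff[symmetric]) auto
  then show ?thesis using indep_varD[OF iv Q Q2] by simp
qed

text \<open>An intersection-stable family separating the past of \<open>N\<close> from the first
  \<open>n\<close> claims. The surplus mixes both sources, so its filtration has no such product
  structure; the rectangles provide it on the event \<open>N t = n\<close>.\<close>

definition history_rectangles :: "real \<Rightarrow> nat \<Rightarrow> 'a set set" where
  "history_rectangles t n =
    {{\<omega>\<in>space M. \<forall>s\<in>I. N s \<omega> \<in> B s} \<inter> {\<omega>\<in>space M. restrict (\<lambda>i. Y i \<omega>) {1..n} \<in> Q} | I B Q.
      finite I \<and> I \<subseteq> {0..t} \<and> Q \<in> sets (PiM {1..n} (\<lambda>_. borel))}"

lemma history_rectanglesI:
  assumes "finite I" "I \<subseteq> {0..t}" "Q \<in> sets (PiM {1..n} (\<lambda>_. borel))"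
  shows "{\<omega>\<in>space M. \<forall>s\<in>I. N s \<omega> \<in> B s} \<inter> {\<omega>\<in>space M. restrict (\<lambda>i. Y i \<omega>) {1..n} \<in> Q} \<in> history_rectangles t n"
  unfolding history_rectangles_def using assms by blast

lemma Int_stable_history_rectangles: "Int_stable (history_rectangles t n)"
proof (rule Int_stableI)
  fix a b assume "a \<in> history_rectangles t n" "b \<in> history_rectangles t n"
  then obtain I B Q I' B' Q' where
    a: "a = {\<omega>\<in>space M. \<forall>s\<in>I. N s \<omega> \<in> B s} \<inter> {\<omega>\<in>space M. restrict (\<lambda>i. Y i \<omega>) {1..n} \<in> Q}"
      "finite I" "I \<subseteq> {0..t}" "Q \<in> sets (PiM {1..n} (\<lambda>_. borel))" and
    b: "b = {\<omega>\<in>space M. \<forall>s\<in>I'. N s \<omega> \<in> B' s} \<inter> {\<omega>\<in>space M. restrict (\<lambda>i. Y i \<omega>) {1..n} \<in> Q'}"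
      "finite I'" "I' \<subseteq> {0..t}" "Q' \<in> sets (PiM {1..n} (\<lambda>_. borel))"
    unfolding history_rectangles_def by blast
  define B'' where "B'' s = (if s \<in> I then B s else UNIV) \<inter> (if s \<in> I' then B' s else UNIV)" for s
  have "a \<inter> b = {\<omega>\<in>space M. \<forall>s\<in>I \<union> I'. N s \<omega> \<in> B'' s} \<inter> {\<omega>\<in>space M. restrict (\<lambda>i. Y i \<omega>) {1..n} \<in> Q \<inter> Q'}"
    unfolding a b B''_def by (auto split: if_splits)
  moreover have "finite (I \<union> I')" "I \<union> I' \<subseteq> {0..t}" "Q \<inter> Q' \<in> sets (PiM {1..n} (\<lambda>_. borel))"
    using a b by auto
  ultimately show "a \<inter> b \<in> history_rectangles t n" unfolding history_rectangles_def by blast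
qed

lemma history_rectangles_subset: "history_rectangles t n \<subseteq> Pow (space M)"
  unfolding history_rectangles_def by auto

lemma measurable_N_history:
  assumes "0 \<le> s" "s \<le> t"
  shows "N s \<in> measurable (sigma (space M) (history_rectangles t n)) (count_space UNIV)"
proof (rule measurableI)
  fix A :: "nat set"
  have "{\<omega>\<in>space M. \<forall>s'\<in>{s}. N s' \<omega> \<in> A} \<inter> {\<omega>\<in>space M. restrict (\<lambda>i. Y i \<omega>) {1..n} \<in> space (PiM {1..n} (\<lambda>_. borel))}
      \<in> history_rectangles t n"
    using assms by (intro history_rectanglesI) auto
  moreover have "{\<omega>\<in>space M. \<forall>s'\<in>{s}. N s' \<omega> \<in> A} \<inter> {\<omega>\<in>space M. restrict (\<lambda>i. Y i \<omega>) {1..n} \<in> space (PiM {1..n} (\<lambda>_. borel))}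
    = N s -` A \<inter> space M" by (auto simp: space_PiM)
  ultimately show "N s -` A \<inter> space (sigma (space M) (history_rectangles t n)) \<in> sets (sigma (space M) (history_rectangles t n))"
    using history_rectangles_subset by (auto simp: space_measure_of sets_measure_of intro: sigma_sets.Basic)
qed simp

lemma measurable_Y_history:
  assumes "i \<in> {1..n}"
  shows "Y i \<in> borel_measurable (sigma (space M) (history_rectangles t n))"
proof (rule measurableI)
  fix A :: "real set" assume A: "A \<in> sets borel"
  define Q :: "(nat \<Rightarrow> real) set" where "Q = (\<lambda>v. v i) -` A \<inter> space (PiM {1..n} (\<lambda>_. borel))"
  have "Q \<in> sets (PiM {1..n} (\<lambda>_. borel))"
    unfolding Q_def
    using measurable_sets[OF measurable_component_singleton[of i "{1..n}" "\<lambda>_. borel"], of A] A assms by simp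
  then have "{\<omega>\<in>space M. \<forall>s'\<in>{}. N s' \<omega> \<in> UNIV} \<inter> {\<omega>\<in>space M. restrict (\<lambda>i. Y i \<omega>) {1..n} \<in> Q}
      \<in> history_rectangles t n"
    by (intro history_rectanglesI) auto
  moreover have "{\<omega>\<in>space M. \<forall>s'\<in>{}. N s' \<omega> \<in> UNIV} \<inter> {\<omega>\<in>space M. restrict (\<lambda>i. Y i \<omega>) {1..n} \<in> Q}
    = Y i -` A \<inter> space M" using assms by (auto simp: space_PiM Q_def)
  ultimately show "Y i -` A \<inter> space (sigma (space M) (history_rectangles t n)) \<in> sets (sigma (space M) (history_rectangles t n))"
    using history_rectangles_subset by (auto simp: space_measure_of sets_measure_of intro: sigma_sets.Basic)
qed simp

text \<open>On \<open>N t = n\<close> the surplus up to time \<open>t\<close> only involves the first \<open>n\<close> claims.\<close>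

lemma natural_filtration_history:
  assumes t: "0 \<le> t" and A: "A \<in> sets (natural_filtration M (surplus c S x0) t)"
  shows "A \<inter> {\<omega>\<in>space M. N t \<omega> = n} \<in> sigma_sets (space M) (history_rectangles t n)"
proof -
  let ?H = "sigma (space M) (history_rectangles t n)"
  have H: "sets ?H = sigma_sets (space M) (history_rectangles t n)" "space ?H = space M"
    using history_rectangles_subset by (auto simp: space_measure_of sets_measure_of)
  have Nt: "{\<omega>\<in>space M. N t \<omega> = n} \<in> sets ?H"
    using measurable_sets[OF measurable_N_history[OF t order_refl, of n], of "{n}"] H
    by (simp add: vimage_def Int_def conj_commute)
  have "A \<in> sigma_sets (space M) {surplus c S x0 i -` B \<inter> space M | i B. i \<in> {0..t} \<and> B \<in> sets borel}"
    using A unfolding natural_filtration_def sets_generated_algebra .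
  then have "A \<inter> {\<omega>\<in>space M. N t \<omega> = n} \<in> sets ?H"
  proof induction
    case (Basic a)
    then obtain s B where a: "a = surplus c S x0 s -` B \<inter> space M" "0 \<le> s" "s \<le> t" "B \<in> sets borel" by auto
    \<comment> \<open>Truncating the number of claims at \<open>n\<close> makes the variable
      measurable for the rectangles everywhere. On \<open>N t = n\<close> it is the surplus at
      \<open>s\<close>, because \<open>N s \<le> N t\<close>.\<close>
    define X where "X \<omega> = x0 + c * s - (\<Sum>i=1..min (N s \<omega>) n. Y i \<omega>)" for \<omega>
    have "(\<lambda>\<omega>. \<Sum>i=1..min (N s \<omega>) n. Y i \<omega>) \<in> borel_measurable ?H"
    proof (rule measurable_compose_countable[where g = "N s" and f = "\<lambda>m \<omega>. \<Sum>i=1..min m n. Y i \<omega>"])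
      show "(\<lambda>\<omega>. \<Sum>i=1..min m n. Y i \<omega>) \<in> borel_measurable ?H" for m
        by (intro borel_measurable_sum measurable_Y_history) auto
    qed (use a measurable_N_history in auto)
    then have "X \<in> borel_measurable ?H" unfolding X_def[abs_def] by measurable
    from measurable_sets[OF this a(4)] have "X -` B \<inter> space M \<in> sets ?H" by (simp add: H)
    with Nt have "(X -` B \<inter> space M) \<inter> {\<omega>\<in>space M. N t \<omega> = n} \<in> sets ?H" by auto
    also have "(X -` B \<inter> space M) \<inter> {\<omega>\<in>space M. N t \<omega> = n} = a \<inter> {\<omega>\<in>space M. N t \<omega> = n}"
      unfolding a(1) X_def surplus_def total_claims_def using N_mono[OF _ a(2,3)] by (auto simp: min_absorb1)
    finally show ?case .
  next
    case (Compl a)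
    have "(space M - a) \<inter> {\<omega>\<in>space M. N t \<omega> = n} = {\<omega>\<in>space M. N t \<omega> = n} - a \<inter> {\<omega>\<in>space M. N t \<omega> = n}"
      by auto
    then show ?case using Compl Nt by auto
  next
    case (Union a)
    have "(\<Union>i. a i) \<inter> {\<omega>\<in>space M. N t \<omega> = n} = (\<Union>i. a i \<inter> {\<omega>\<in>space M. N t \<omega> = n})" by auto
    moreover have "(\<Union>i. a i \<inter> {\<omega>\<in>space M. N t \<omega> = n}) \<in> sets ?H" using Union by (intro sets.countable_UN) auto
    ultimately show ?case by simp
  qed auto
  then show ?thesis using H by simp
qed

lemma indep_N_Y_prob:
  assumes "a \<in> sets (generated_algebra M {0..} N (count_space UNIV))" "b \<in> sets (generated_algebra M {1..} Y borel)"
  shows "prob (a \<inter> b) = prob a * prob b"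
  using indep_setD[OF indep_N_Y assms] .

text \<open>For a rectangle the four events pair up: the past of \<open>N\<close> with the
  increment, the first \<open>n\<close> claims with claim \<open>Suc n\<close>, and the two pairs
  are independent of each other. The product formula passes to complements and disjoint unions,
  hence to the generated sigma-algebra.\<close>

lemma indep_history:
  assumes t: "0 \<le> t" "t < u" and B: "B \<in> sets borel"
    and A: "A \<in> sigma_sets (space M) (history_rectangles t n)"
  shows "prob (A \<inter> ({\<omega>\<in>space M. N u \<omega> - N t \<omega> \<in> J} \<inter> {\<omega>\<in>space M. Y (Suc n) \<omega> \<in> B}))
    = prob A * (prob {\<omega>\<in>space M. N u \<omega> - N t \<omega> \<in> J} * prob {\<omega>\<in>space M. Y (Suc n) \<omega> \<in> B})"
proof -
  define D where "D = {\<omega>\<in>space M. N u \<omega> - N t \<omega> \<in> J}"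
  define E where "E = {\<omega>\<in>space M. Y (Suc n) \<omega> \<in> B}"
  let ?GN = "generated_algebra M {0..} N (count_space UNIV)" and ?GY = "generated_algebra M {1..} Y borel"
  have [measurable]: "N s \<in> measurable ?GN (count_space UNIV)" if "0 \<le> s" for s
    using that by (intro measurable_generated_algebra) auto
  have mY: "Y i \<in> borel_measurable ?GY" if "1 \<le> i" for i
    using that by (intro measurable_generated_algebra) auto
  have subN: "sets ?GN \<subseteq> events" by (rule sets_generated_algebra_subset) auto
  have subY: "sets ?GY \<subseteq> events" by (rule sets_generated_algebra_subset) auto
  have u: "0 \<le> u" using t by simp
  have "{\<omega>\<in>space ?GN. N u \<omega> - N t \<omega> \<in> J} \<in> sets ?GN"
    using t u by measurable
  then have D: "D \<in> sets ?GN" by (simp add: space_generated_algebra D_def)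
  have [measurable]: "Y (Suc n) \<in> borel_measurable ?GY" by (rule mY) simp
  have "{\<omega>\<in>space ?GY. Y (Suc n) \<omega> \<in> B} \<in> sets ?GY"
    using B by measurable
  then have E: "E \<in> sets ?GY" by (simp add: space_generated_algebra E_def)
  have ev: "D \<in> events" "E \<in> events" using D E subN subY by auto
  have hist: "\<exists>C\<in>sets ?GN. \<exists>Q\<in>sets ?GY. a = C \<inter> Q \<and> prob (C \<inter> D) = prob C * prob D \<and> prob (Q \<inter> E) = prob Q * prob E"
    if rect: "a \<in> history_rectangles t n" for a
  proof -
    obtain I B' Q where a: "a = {\<omega>\<in>space M. \<forall>s\<in>I. N s \<omega> \<in> B' s} \<inter> {\<omega>\<in>space M. restrict (\<lambda>i. Y i \<omega>) {1..n} \<in> Q}"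
      and I: "finite I" "I \<subseteq> {0..t}" and Q: "Q \<in> sets (PiM {1..n} (\<lambda>_. borel))"
      using rect unfolding history_rectangles_def by blast
    have "{\<omega>\<in>space ?GN. \<forall>s\<in>I. N s \<omega> \<in> B' s} \<in> sets ?GN"
    proof (rule sets.sets_Collect_finite_All[OF _ I(1)])
      fix s assume "s \<in> I"
      then have "0 \<le> s" using I by auto
      then show "{\<omega>\<in>space ?GN. N s \<omega> \<in> B' s} \<in> sets ?GN" by measurable
    qed
    then have 1: "{\<omega>\<in>space M. \<forall>s\<in>I. N s \<omega> \<in> B' s} \<in> sets ?GN" by (simp add: space_generated_algebra)
    have "(\<lambda>\<omega>. restrict (\<lambda>i. Y i \<omega>) {1..n}) \<in> measurable ?GY (PiM {1..n} (\<lambda>_. borel))"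
    proof (rule measurable_restrict)
      fix i assume "i \<in> {1..n}"
      then show "Y i \<in> borel_measurable ?GY" by (intro mY) auto
    qed
    from measurable_sets[OF this Q] have 2: "{\<omega>\<in>space M. restrict (\<lambda>i. Y i \<omega>) {1..n} \<in> Q} \<in> sets ?GY"
      by (simp add: space_generated_algebra vimage_def Int_def conj_commute)
    show ?thesis
      using 1 2 a indep_cylinder_increment[OF t I, of B' J] indep_Y_next[OF Q B] unfolding D_def E_def by blast
  qed
  have "A \<in> events \<and> prob (A \<inter> (D \<inter> E)) = prob A * (prob D * prob E)"
    using Int_stable_history_rectangles history_rectangles_subset A
  proof (induction rule: sigma_sets_induct_disjoint)
    case (basic a)
    then obtain C Q where a: "C \<in> sets ?GN" "Q \<in> sets ?GY" "a = C \<inter> Q"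
        "prob (C \<inter> D) = prob C * prob D" "prob (Q \<inter> E) = prob Q * prob E"
      using hist by blast
    have "a \<inter> (D \<inter> E) = (C \<inter> D) \<inter> (Q \<inter> E)" using a by auto
    moreover have "prob ((C \<inter> D) \<inter> (Q \<inter> E)) = prob (C \<inter> D) * prob (Q \<inter> E)"
      by (rule indep_N_Y_prob) (use a D E in auto)
    moreover have "prob a = prob C * prob Q" unfolding a(3) by (rule indep_N_Y_prob) (use a in auto)
    ultimately show ?case using a subN subY by auto
  next
    case empty then show ?case by simp
  next
    case (compl a)
    have eq: "(space M - a) \<inter> (D \<inter> E) = (D \<inter> E) - a \<inter> (D \<inter> E)" using ev sets.sets_into_space by blast
    have "prob ((space M - a) \<inter> (D \<inter> E)) = prob (D \<inter> E) - prob (a \<inter> (D \<inter> E))"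
      unfolding eq using compl(2) ev by (intro finite_measure_Diff) auto
    moreover have "prob (D \<inter> E) = prob D * prob E" using indep_N_Y_prob[OF D E] .
    moreover have "prob (space M - a) = 1 - prob a" using compl by (simp add: prob_compl)
    ultimately have "prob ((space M - a) \<inter> (D \<inter> E)) = prob (space M - a) * (prob D * prob E)"
      using compl(2) by algebra
    moreover have "space M - a \<in> events" using compl(2) by (intro sets.compl_sets) simp
    ultimately show ?case by simp
  next
    case (union a)
    then have ev': "range a \<subseteq> events" "range (\<lambda>i. a i \<inter> (D \<inter> E)) \<subseteq> events" using ev by auto
    have dj: "disjoint_family (\<lambda>i. a i \<inter> (D \<inter> E))"
      using union(1) by (auto simp: disjoint_family_on_def)
    have "(\<lambda>i. prob (a i \<inter> (D \<inter> E))) sums prob (\<Union>i. a i \<inter> (D \<inter> E))"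
      by (rule finite_measure_UNION[OF ev'(2) dj])
    moreover have "(\<lambda>i. prob (a i) * (prob D * prob E)) sums (prob (\<Union>i. a i) * (prob D * prob E))"
      by (intro sums_mult2 finite_measure_UNION[OF ev'(1) union(1)])
    moreover have "prob (a i \<inter> (D \<inter> E)) = prob (a i) * (prob D * prob E)" for i using union by auto
    ultimately have "prob (\<Union>i. a i \<inter> (D \<inter> E)) = prob (\<Union>i. a i) * (prob D * prob E)"
      by (simp add: sums_unique2)
    then show ?case using ev' by auto
  qed
  then show ?thesis by (simp add: D_def E_def)
qed

section \<open>Law of the next claim given the past\<close>

lemma prob_increment:
  assumes "0 \<le> t" "t < u"
  shows "prob {\<omega>\<in>space M. N u \<omega> - N t \<omega> \<in> J} = measure (poisson_pmf (r * (u - t))) J"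
proof -
  have "measure (distr M (count_space UNIV) (\<lambda>\<omega>. N u \<omega> - N t \<omega>)) J = measure (poisson_pmf (r * (u - t))) J"
    using poisson_N assms unfolding poisson_process_def by auto
  moreover have "0 \<le> u" using assms by simp
  then have "(\<lambda>\<omega>. N u \<omega> - N t \<omega>) \<in> measurable M (count_space UNIV)"
    using assms by measurable
  ultimately show ?thesis
    by (subst (asm) measure_distr) (auto simp: vimage_def Int_def conj_commute)
qed

lemma prob_claim:
  assumes "B \<in> sets borel" "1 \<le> i"
  shows "emeasure M {\<omega>\<in>space M. Y i \<omega> \<in> B} = emeasure claim_law B"
proof -
  have "emeasure (distr M lborel (Y i)) B = emeasure claim_law B"
    using exponential_Y[OF assms(2)] by (simp add: distributed_distr_eq_density)
  then show ?thesis
    using assms by (subst (asm) emeasure_distr) (auto simp: vimage_def Int_def conj_commute)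
qed

text \<open>The next claim has the random index \<open>Suc (N t)\<close>. Cutting along
  \<open>N t = n\<close> makes the index deterministic, and since all claims share one law the
  factor is the same for every \<open>n\<close> and can be taken out of the sum.\<close>

lemma indep_next_claim:
  assumes t: "0 \<le> t" "t < u" and B: "B \<in> sets borel"
    and A: "A \<in> sets (natural_filtration M (surplus c S x0) t)"
  shows "emeasure M (A \<inter> {\<omega>\<in>space M. N u \<omega> - N t \<omega> \<in> J \<and> Y (Suc (N t \<omega>)) \<omega> \<in> B})
    = emeasure M A * (ennreal (measure (poisson_pmf (r * (u - t))) J) * emeasure claim_law B)"
proof -
  define An where "An n = A \<inter> {\<omega>\<in>space M. N t \<omega> = n}" for n
  define E where "E n = {\<omega>\<in>space M. N u \<omega> - N t \<omega> \<in> J} \<inter> {\<omega>\<in>space M. Y (Suc n) \<omega> \<in> B}" for n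
  have u: "0 \<le> u" using t by simp
  have Aev: "A \<in> events" using A sets_natural_filtration by blast
  have [measurable]: "Y (Suc n) \<in> borel_measurable M" for n by (rule measurable_Y) simp
  have An: "An n \<in> events" for n unfolding An_def using Aev t by measurable
  have E: "E n \<in> events" for n unfolding E_def using t u B by measurable
  have eq: "emeasure M (An n \<inter> E n) = emeasure M (An n) * (ennreal (measure (poisson_pmf (r * (u - t))) J) * emeasure claim_law B)" for n
  proof -
    have "prob (An n \<inter> E n) = prob (An n) * (prob {\<omega>\<in>space M. N u \<omega> - N t \<omega> \<in> J} * prob {\<omega>\<in>space M. Y (Suc n) \<omega> \<in> B})"
      unfolding An_def E_def by (rule indep_history[OF t B natural_filtration_history[OF t(1) A]])
    then show ?thesis
      using prob_claim[OF B, of "Suc n"]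
      by (simp add: emeasure_eq_measure prob_increment[OF t] ennreal_mult)
  qed
  have "A = (\<Union>n. An n)" using Aev sets.sets_into_space by (auto simp: An_def)
  moreover have "(\<Sum>n. emeasure M (An n)) = emeasure M (\<Union>n. An n)"
    using An by (intro suminf_emeasure) (auto simp: An_def disjoint_family_on_def)
  moreover have "(\<Sum>n. emeasure M (An n \<inter> E n)) = emeasure M (\<Union>n. An n \<inter> E n)"
    using An E by (intro suminf_emeasure) (auto simp: An_def disjoint_family_on_def)
  moreover have "A \<inter> {\<omega>\<in>space M. N u \<omega> - N t \<omega> \<in> J \<and> Y (Suc (N t \<omega>)) \<omega> \<in> B} = (\<Union>n. An n \<inter> E n)"
    unfolding An_def E_def by auto
  ultimately have "emeasure M A = (\<Sum>n. emeasure M (An n))"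
    "emeasure M (A \<inter> {\<omega>\<in>space M. N u \<omega> - N t \<omega> \<in> J \<and> Y (Suc (N t \<omega>)) \<omega> \<in> B}) = (\<Sum>n. emeasure M (An n \<inter> E n))"
    by simp_all
  then show ?thesis by (simp add: eq)
qed

text \<open>With \<open>M\<close> weighted by the event that the increment lies in \<open>J\<close>,
  the joint law of \<open>Z\<close> and the next claim agrees with a product measure on rectangles,
  hence everywhere; the integral is then iterated. This is the only form in which independence
  enters the estimates.\<close>

lemma nn_integral_next_claim:
  assumes t: "0 \<le> t" "t < u" and Z: "Z \<in> borel_measurable (natural_filtration M (surplus c S x0) t)"
    and G[measurable]: "G \<in> borel_measurable (borel \<Otimes>\<^sub>M borel)"
  shows "(\<integral>\<^sup>+\<omega>. indicator J (N u \<omega> - N t \<omega>) * G (Z \<omega>, Y (Suc (N t \<omega>)) \<omega>) \<partial>M)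
    = ennreal (measure (poisson_pmf (r * (u - t))) J) * (\<integral>\<^sup>+\<omega>. (\<integral>\<^sup>+y. G (Z \<omega>, y) \<partial>claim_law) \<partial>M)"
proof -
  define k where "k = ennreal (measure (poisson_pmf (r * (u - t))) J)"
  have u: "0 \<le> u" using t by simp
  have Z'[measurable]: "Z \<in> borel_measurable M" using Z by (rule measurable_natural_filtration)
  have [measurable]: "N t \<in> measurable M (count_space UNIV)" "N u \<in> measurable M (count_space UNIV)"
    using t u by auto
  have Y'[measurable]: "(\<lambda>\<omega>. Y (Suc (N t \<omega>)) \<omega>) \<in> borel_measurable M"
    by (rule measurable_compose_countable[where g = "N t" and f = "\<lambda>n \<omega>. Y (Suc n) \<omega>"]) auto
  define R where "R = density M (\<lambda>\<omega>. indicator J (N u \<omega> - N t \<omega>))"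
  interpret claim: prob_space claim_law by (rule prob_space_exponential_density) (rule \<alpha>_pos)
  have "density (distr M borel Z) (\<lambda>_. k) \<Otimes>\<^sub>M claim_law = distr R (borel \<Otimes>\<^sub>M borel) (\<lambda>\<omega>. (Z \<omega>, Y (Suc (N t \<omega>)) \<omega>))"
  proof (rule pair_measure_eqI)
    have "finite_measure (density (distr M borel Z) (\<lambda>_. k))"
      by (rule finite_measureI) (auto simp: emeasure_density nn_integral_cmult emeasure_distr k_def ennreal_mult_eq_top_iff)
    then show "sigma_finite_measure (density (distr M borel Z) (\<lambda>_. k))"
      by (rule finite_measure.axioms)
    show "sigma_finite_measure claim_law" by unfold_locales
    show "sets (density (distr M borel Z) (\<lambda>_. k) \<Otimes>\<^sub>M claim_law) = sets (distr R (borel \<Otimes>\<^sub>M borel) (\<lambda>\<omega>. (Z \<omega>, Y (Suc (N t \<omega>)) \<omega>)))"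
      by (simp cong: sets_pair_measure_cong)
    fix A B assume "A \<in> sets (density (distr M borel Z) (\<lambda>_. k))" "B \<in> sets claim_law"
    then have A: "A \<in> sets borel" and B: "B \<in> sets borel" by auto
    have ZA: "Z -` A \<inter> space M \<in> sets (natural_filtration M (surplus c S x0) t)"
      using measurable_sets[OF Z A] by (simp add: space_natural_filtration)
    have "emeasure (distr R (borel \<Otimes>\<^sub>M borel) (\<lambda>\<omega>. (Z \<omega>, Y (Suc (N t \<omega>)) \<omega>))) (A \<times> B)
      = emeasure R ((\<lambda>\<omega>. (Z \<omega>, Y (Suc (N t \<omega>)) \<omega>)) -` (A \<times> B) \<inter> space M)"
      using A B unfolding R_def by (subst emeasure_distr) auto
    also have "\<dots> = (\<integral>\<^sup>+\<omega>. indicator J (N u \<omega> - N t \<omega>) * indicator ((\<lambda>\<omega>. (Z \<omega>, Y (Suc (N t \<omega>)) \<omega>)) -` (A \<times> B) \<inter> space M) \<omega> \<partial>M)"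
    proof -
      have "(\<lambda>\<omega>. (Z \<omega>, Y (Suc (N t \<omega>)) \<omega>)) -` (A \<times> B) \<inter> space M \<in> events"
        using A B by (intro measurable_sets[of _ M "borel \<Otimes>\<^sub>M borel"]) auto
      then show ?thesis unfolding R_def by (subst emeasure_density) auto
    qed
    also have "\<dots> = (\<integral>\<^sup>+\<omega>. indicator ((Z -` A \<inter> space M) \<inter> {\<omega>\<in>space M. N u \<omega> - N t \<omega> \<in> J \<and> Y (Suc (N t \<omega>)) \<omega> \<in> B}) \<omega> \<partial>M)"
      by (intro nn_integral_cong) (auto simp: indicator_def)
    also have "\<dots> = emeasure M ((Z -` A \<inter> space M) \<inter> {\<omega>\<in>space M. N u \<omega> - N t \<omega> \<in> J \<and> Y (Suc (N t \<omega>)) \<omega> \<in> B})"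
    proof (rule nn_integral_indicator, rule sets.Int)
      show "Z -` A \<inter> space M \<in> events" using measurable_sets[OF Z' A] .
      show "{\<omega>\<in>space M. N u \<omega> - N t \<omega> \<in> J \<and> Y (Suc (N t \<omega>)) \<omega> \<in> B} \<in> events" using B by measurable
    qed
    also have "\<dots> = emeasure M (Z -` A \<inter> space M) * (k * emeasure claim_law B)"
      unfolding k_def by (rule indep_next_claim[OF t B ZA])
    also have "emeasure M (Z -` A \<inter> space M) = emeasure (distr M borel Z) A" using A by (simp add: emeasure_distr)
    also have "\<dots> * (k * emeasure claim_law B) = emeasure (density (distr M borel Z) (\<lambda>_. k)) A * emeasure claim_law B"
      using A by (simp add: emeasure_density nn_integral_cmult mult_ac)
    finally show "emeasure (density (distr M borel Z) (\<lambda>_. k)) A * emeasure claim_law B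
      = emeasure (distr R (borel \<Otimes>\<^sub>M borel) (\<lambda>\<omega>. (Z \<omega>, Y (Suc (N t \<omega>)) \<omega>))) (A \<times> B)" by simp
  qed
  then have "(\<integral>\<^sup>+p. G p \<partial>distr R (borel \<Otimes>\<^sub>M borel) (\<lambda>\<omega>. (Z \<omega>, Y (Suc (N t \<omega>)) \<omega>)))
      = (\<integral>\<^sup>+p. G p \<partial>(density (distr M borel Z) (\<lambda>_. k) \<Otimes>\<^sub>M claim_law))" by simp
  also have "\<dots> = (\<integral>\<^sup>+z. (\<integral>\<^sup>+y. G (z, y) \<partial>claim_law) \<partial>density (distr M borel Z) (\<lambda>_. k))"
    by (rule claim.nn_integral_fst[symmetric]) measurable
  also have "\<dots> = k * (\<integral>\<^sup>+\<omega>. (\<integral>\<^sup>+y. G (Z \<omega>, y) \<partial>claim_law) \<partial>M)"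
    by (simp add: nn_integral_density nn_integral_cmult nn_integral_distr)
  also have "(\<integral>\<^sup>+p. G p \<partial>distr R (borel \<Otimes>\<^sub>M borel) (\<lambda>\<omega>. (Z \<omega>, Y (Suc (N t \<omega>)) \<omega>)))
      = (\<integral>\<^sup>+\<omega>. indicator J (N u \<omega> - N t \<omega>) * G (Z \<omega>, Y (Suc (N t \<omega>)) \<omega>) \<partial>M)"
    unfolding R_def by (subst nn_integral_distr) (auto simp: nn_integral_density)
  finally show ?thesis unfolding k_def .
qed

end

section \<open>Ruin under a dividend strategy\<close>

lemma mono_natural_filtration:
  assumes "s \<le> t"
  shows "sets (natural_filtration M X s) \<subseteq> sets (natural_filtration M X t)"
  unfolding natural_filtration_def sets_generated_algebra
proof (rule sigma_sets_mono')
  have "{0..s} \<subseteq> {0..t}" using assms by auto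
  then show "{X i -` B \<inter> space M | i B. i \<in> {0..s} \<and> B \<in> sets borel}
      \<subseteq> {X i -` B \<inter> space M | i B. i \<in> {0..t} \<and> B \<in> sets borel}" by blast
qed

lemma measurable_natural_filtration_mono:
  assumes "f \<in> measurable (natural_filtration M X s) R" "s \<le> t"
  shows "f \<in> measurable (natural_filtration M X t) R"
  using assms mono_natural_filtration[OF assms(2), of M X]
  by (auto simp: measurable_def natural_filtration_def space_generated_algebra)

text \<open>A right-continuous path is nonnegative on an interval as soon as it is so at the right end point and
  at the rational times.\<close>

lemma sets_path_nonneg:
  fixes P :: "real \<Rightarrow> 'a \<Rightarrow> real"
  assumes cont: "\<And>\<omega> s. \<omega> \<in> space G \<Longrightarrow> u \<le> s \<Longrightarrow> s < v \<Longrightarrow> continuous (at_right s) (\<lambda>t. P t \<omega>)"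
    and meas: "\<And>s. u \<le> s \<Longrightarrow> s \<le> v \<Longrightarrow> P s \<in> borel_measurable G" and uv: "u \<le> v"
  shows "{\<omega>\<in>space G. \<forall>s\<in>{u..v}. 0 \<le> P s \<omega>} \<in> sets G"
proof -
  let ?Q = "insert v (\<rat> \<inter> {u..v})"
  have "(\<forall>s\<in>{u..v}. 0 \<le> P s \<omega>) \<longleftrightarrow> (\<forall>q\<in>?Q. 0 \<le> P q \<omega>)" if \<omega>: "\<omega> \<in> space G" for \<omega>
  proof
    assume *: "\<forall>q\<in>?Q. 0 \<le> P q \<omega>"
    show "\<forall>s\<in>{u..v}. 0 \<le> P s \<omega>"
    proof (rule ballI, rule ccontr)
      fix s assume s: "s \<in> {u..v}" "\<not> 0 \<le> P s \<omega>"
      then have st: "s < v" using * by (cases "s = v") auto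
      have "((\<lambda>t. P t \<omega>) \<longlongrightarrow> P s \<omega>) (at_right s)"
        using cont[OF \<omega>, of s] s st by (simp add: continuous_within)
      then have "eventually (\<lambda>u. P u \<omega> < 0) (at_right s)" using s by (intro order_tendstoD(2)) auto
      then obtain b where b: "s < b" "\<And>u. s < u \<Longrightarrow> u < b \<Longrightarrow> P u \<omega> < 0"
        unfolding eventually_at_right_field by auto
      obtain q where q: "q \<in> \<rat>" "s < q" "q < min b v" using Rats_dense_in_real[of s "min b v"] b st by auto
      then have "P q \<omega> < 0" by (intro b) auto
      moreover have "q \<in> ?Q" using q s by auto
      ultimately show False using * by force
    qed
  next
    assume "\<forall>s\<in>{u..v}. 0 \<le> P s \<omega>" then show "\<forall>q\<in>?Q. 0 \<le> P q \<omega>" using uv by auto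
  qed
  then have "{\<omega>\<in>space G. \<forall>s\<in>{u..v}. 0 \<le> P s \<omega>} = {\<omega>\<in>space G. \<forall>q\<in>?Q. 0 \<le> P q \<omega>}"
    by auto
  also have "\<dots> \<in> sets G"
  proof (rule sets.sets_Collect_countable_All')
    show "countable ?Q" by (auto intro: countable_rat countable_Int1)
    fix q assume "q \<in> ?Q"
    then have "P q \<in> borel_measurable G" using uv by (intro meas) auto
    then show "{\<omega>\<in>space G. 0 \<le> P q \<omega>} \<in> sets G" by measurable
  qed
  finally show ?thesis .
qed

text \<open>Survival up to and including \<open>t\<close> as a condition on the path up to
  \<open>t\<close>. In this form it is an adapted event and splits along time steps, unlike the
  infimum defining the ruin time.\<close>

definition alive :: "real \<Rightarrow> (real \<Rightarrow> 'a \<Rightarrow> real) \<Rightarrow> real \<Rightarrow> (real \<Rightarrow> 'a \<Rightarrow> real) \<Rightarrow> real \<Rightarrow> 'a \<Rightarrow> bool" where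
  "alive c S x0 D t \<omega> \<longleftrightarrow> (\<forall>s\<in>{0..t}. 0 \<le> controlled_surplus c S x0 D s \<omega>)"

section \<open>Local structure of the claim process\<close>

context cramer_lundberg_exponential
begin

text \<open>An integer-valued path that stays within distance less than 1 of its right limit does
  not move. The statement on the left uses 1/2 twice, since the left limit is not known to be an
  integer.\<close>

lemma N_right_const:
  assumes "\<omega> \<in> space M" "0 \<le> t"
  obtains e where "0 < e" "\<And>s. t \<le> s \<Longrightarrow> s < t + e \<Longrightarrow> N s \<omega> = N t \<omega>"
proof -
  have "((\<lambda>t. real (N t \<omega>)) \<longlongrightarrow> real (N t \<omega>)) (at_right t)"
    using N_cadlag[OF assms(1)] assms(2) by (auto simp: cadlag_def continuous_within)
  then have "eventually (\<lambda>s. dist (real (N s \<omega>)) (real (N t \<omega>)) < 1) (at_right t)"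
    by (rule tendstoD) simp
  then obtain b where b: "t < b" "\<And>s. t < s \<Longrightarrow> s < b \<Longrightarrow> dist (real (N s \<omega>)) (real (N t \<omega>)) < 1"
    unfolding eventually_at_right_field by auto
  show ?thesis
  proof (rule that[of "b - t"])
    fix s assume "t \<le> s" "s < t + (b - t)"
    then show "N s \<omega> = N t \<omega>" using b(2)[of s] by (cases "s = t") (auto simp: dist_real_def)
  qed (use b in auto)
qed

lemma N_left_const:
  assumes "\<omega> \<in> space M" "0 < t"
  obtains e n where "0 < e" "e < t" "\<And>s. t - e < s \<Longrightarrow> s < t \<Longrightarrow> N s \<omega> = n"
proof -
  obtain l where "((\<lambda>t. real (N t \<omega>)) \<longlongrightarrow> l) (at_left t)"
    using N_cadlag[OF assms(1)] assms(2) by (auto simp: cadlag_def)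
  then have "eventually (\<lambda>s. dist (real (N s \<omega>)) l < 1 / 2) (at_left t)"
    by (rule tendstoD) simp
  then obtain b where b: "b < t" "\<And>s. b < s \<Longrightarrow> s < t \<Longrightarrow> dist (real (N s \<omega>)) l < 1 / 2"
    unfolding eventually_at_left_field by auto
  define e where "e = min (t - b) (t / 2)"
  define u where "u = t - e / 2"
  have e: "0 < e" "e < t" "b \<le> t - e" using b assms by (auto simp: e_def min_def)
  show ?thesis
  proof (rule that[OF e(1,2), of "N u \<omega>"])
    fix s assume s: "t - e < s" "s < t"
    have "dist (real (N s \<omega>)) l < 1 / 2" using s e by (intro b(2)) auto
    moreover have "dist (real (N u \<omega>)) l < 1 / 2" using e by (intro b(2)) (auto simp: u_def)
    ultimately have "dist (real (N s \<omega>)) (real (N u \<omega>)) < 1" by (rule dist_triangle_half_l)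
    then show "N s \<omega> = N u \<omega>" by (auto simp: dist_real_def)
  qed
qed

lemma S_0: "\<omega> \<in> space M \<Longrightarrow> S 0 \<omega> = 0"
  by (simp add: total_claims_def N_0)

lemma S_left:
  assumes "\<omega> \<in> space M" "0 < t"
  obtains e where "0 < e" "e < t" "\<And>s. t - e < s \<Longrightarrow> s < t \<Longrightarrow> S s \<omega> = left_value 0 (\<lambda>s. S s \<omega>) t"
proof -
  obtain e n where e: "0 < e" "e < t" "\<And>s. t - e < s \<Longrightarrow> s < t \<Longrightarrow> N s \<omega> = n"
    using N_left_const[OF assms] by blast
  define v where "v = (\<Sum>i=1..n. Y i \<omega>)"
  have v: "S s \<omega> = v" if "t - e < s" "s < t" for s
    using e(3)[OF that] by (simp add: total_claims_def v_def)
  have "eventually (\<lambda>s. v = S s \<omega>) (at_left t)"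
    unfolding eventually_at_left_field using e v by (intro exI[of _ "t - e"]) auto
  then have "((\<lambda>s. S s \<omega>) \<longlongrightarrow> v) (at_left t)" by (rule Lim_transform_eventually[OF tendsto_const])
  then have "left_value 0 (\<lambda>s. S s \<omega>) t = v"
    using assms by (auto simp: left_value_def intro!: tendsto_Lim)
  then show ?thesis using that[OF e(1,2)] v by simp
qed

lemma tendsto_S_left:
  assumes "\<omega> \<in> space M" "0 < t"
  shows "((\<lambda>s. S s \<omega>) \<longlongrightarrow> left_value 0 (\<lambda>s. S s \<omega>) t) (at_left t)"
proof -
  obtain e where e: "0 < e" "\<And>s. t - e < s \<Longrightarrow> s < t \<Longrightarrow> S s \<omega> = left_value 0 (\<lambda>s. S s \<omega>) t"
    using S_left[OF assms] by blast
  have "eventually (\<lambda>s. left_value 0 (\<lambda>s. S s \<omega>) t = S s \<omega>) (at_left t)"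
    unfolding eventually_at_left_field using e by (intro exI[of _ "t - e"]) auto
  then show ?thesis by (rule Lim_transform_eventually[OF tendsto_const])
qed

lemma continuous_right_S:
  assumes "\<omega> \<in> space M" "0 \<le> t"
  shows "continuous (at_right t) (\<lambda>t. S t \<omega>)"
proof -
  obtain e where e: "0 < e" "\<And>s. t \<le> s \<Longrightarrow> s < t + e \<Longrightarrow> N s \<omega> = N t \<omega>"
    using N_right_const[OF assms] by blast
  have "S t \<omega> = S s \<omega>" if "t < s" "s < t + e" for s
    using e(2)[of s] that by (simp add: total_claims_def)
  then have "eventually (\<lambda>s. S t \<omega> = S s \<omega>) (at_right t)"
    unfolding eventually_at_right_field using e(1) by (intro exI[of _ "t + e"]) auto
  then show ?thesis
    unfolding continuous_within by (rule Lim_transform_eventually[OF tendsto_const])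
qed

lemma S_mono:
  assumes "\<omega> \<in> space M" "\<And>i. 1 \<le> i \<Longrightarrow> 0 \<le> Y i \<omega>" "0 \<le> s" "s \<le> t"
  shows "S s \<omega> \<le> S t \<omega>"
  unfolding total_claims_def using N_mono[OF assms(1,3,4)] assms(2) by (intro sum_mono2) auto

text \<open>Claims are nonnegative only almost surely, whereas path regularity holds for every
  outcome. Comparisons that need increasing total claims are therefore made almost
  everywhere.\<close>

lemma AE_claims_nonneg: "AE \<omega> in M. \<forall>i\<ge>1. 0 \<le> Y i \<omega>"
proof -
  have "AE \<omega> in M. 1 \<le> i \<longrightarrow> 0 \<le> Y i \<omega>" for i
  proof (cases "1 \<le> i")
    case True
    have "emeasure claim_law {..<0} = (\<integral>\<^sup>+x. ennreal (exponential_density \<alpha> x) * indicator {..<0} x \<partial>lborel)"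
      by (rule emeasure_density) auto
    also have "\<dots> = (\<integral>\<^sup>+(x::real). 0 \<partial>lborel)"
      by (intro nn_integral_cong) (auto simp: exponential_density_def indicator_def)
    finally have "emeasure claim_law {..<0} = 0" by simp
    then have "emeasure M {\<omega>\<in>space M. Y i \<omega> \<in> {..<0}} = 0"
      using prob_claim[of "{..<0}" i] True by simp
    moreover have "{\<omega>\<in>space M. Y i \<omega> \<in> {..<0}} \<in> events" using measurable_Y[OF True] by measurable
    ultimately show ?thesis
      by (intro AE_I[of _ _ "{\<omega>\<in>space M. Y i \<omega> \<in> {..<0}}"]) auto
  qed simp
  then show ?thesis by (subst AE_all_countable) auto
qed

end

section \<open>A fixed strategy: ruin is attained, and survival is an adapted event\<close>

locale dividend_strategy = cramer_lundberg_exponential M N Y c r \<alpha> \<delta>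
  for M :: "'a measure" and N :: "real \<Rightarrow> 'a \<Rightarrow> nat" and Y :: "nat \<Rightarrow> 'a \<Rightarrow> real" and c r \<alpha> \<delta> :: real +
  fixes x0 :: real and D :: "real \<Rightarrow> 'a \<Rightarrow> real"
  assumes x0_nonneg: "0 \<le> x0" and strategy: "D \<in> strategies M c (total_claims N Y) x0"
begin

abbreviation X :: "real \<Rightarrow> 'a \<Rightarrow> real" where "X \<equiv> controlled_surplus c S x0 D"
abbreviation \<tau> :: "'a \<Rightarrow> ereal" where "\<tau> \<equiv> ruin_time c S x0 D"
abbreviation filtration :: "real \<Rightarrow> 'a measure" where
  "filtration \<equiv> natural_filtration M (surplus c S x0)"
abbreviation al :: "real \<Rightarrow> 'a \<Rightarrow> bool" where "al \<equiv> alive c S x0 D"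

lemma X_eq: "X t \<omega> = x0 + c * t - S t \<omega> - D t \<omega>"
  by (simp add: controlled_surplus_def surplus_def)

lemma D_nonneg: "\<omega> \<in> space M \<Longrightarrow> 0 \<le> t \<Longrightarrow> 0 \<le> D t \<omega>"
  using strategy by (auto simp: strategies_def admissible_def)

lemma D_mono: "\<omega> \<in> space M \<Longrightarrow> 0 \<le> s \<Longrightarrow> s \<le> t \<Longrightarrow> D s \<omega> \<le> D t \<omega>"
  using strategy by (auto simp: strategies_def admissible_def mono_on_def)

lemma D_cadlag: "\<omega> \<in> space M \<Longrightarrow> cadlag (\<lambda>t. D t \<omega>)"
  using strategy by (auto simp: strategies_def admissible_def)

lemma D_adapted: "0 \<le> t \<Longrightarrow> D t \<in> borel_measurable (filtration t)"
  using strategy by (auto simp: strategies_def admissible_def)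

lemma X_adapted: assumes "0 \<le> t" shows "X t \<in> borel_measurable (filtration t)"
proof -
  have "surplus c S x0 t \<in> borel_measurable (filtration t)"
    unfolding natural_filtration_def using assms by (intro measurable_generated_algebra) auto
  then show ?thesis unfolding controlled_surplus_def[abs_def] using D_adapted[OF assms] by measurable
qed

lemma D_jump:
  "\<omega> \<in> space M \<Longrightarrow> 0 \<le> t \<Longrightarrow> D t \<omega> - left_value 0 (\<lambda>s. D s \<omega>) t
     \<le> max (left_value x0 (\<lambda>s. X s \<omega>) t - (S t \<omega> - left_value 0 (\<lambda>s. S s \<omega>) t)) 0"
  using strategy by (auto simp: strategies_def)

lemma D_after_ruin:
  "\<omega> \<in> space M \<Longrightarrow> 0 \<le> t \<Longrightarrow> \<tau> \<omega> \<le> ereal t \<Longrightarrow> D t \<omega> = D (real_of_ereal (\<tau> \<omega>)) \<omega>"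
  using strategy by (auto simp: strategies_def)

lemma tendsto_D_left:
  assumes "\<omega> \<in> space M" "0 < t"
  shows "((\<lambda>s. D s \<omega>) \<longlongrightarrow> left_value 0 (\<lambda>s. D s \<omega>) t) (at_left t)"
proof -
  obtain l where "((\<lambda>s. D s \<omega>) \<longlongrightarrow> l) (at_left t)"
    using D_cadlag[OF assms(1)] assms(2) by (auto simp: cadlag_def)
  then show ?thesis using assms by (auto simp: left_value_def tendsto_Lim)
qed

lemma X_left:
  assumes "\<omega> \<in> space M" "0 < t"
  shows "left_value x0 (\<lambda>s. X s \<omega>) t = x0 + c * t - left_value 0 (\<lambda>s. S s \<omega>) t - left_value 0 (\<lambda>s. D s \<omega>) t"
proof -
  have "((\<lambda>s. X s \<omega>) \<longlongrightarrow> x0 + c * t - left_value 0 (\<lambda>s. S s \<omega>) t - left_value 0 (\<lambda>s. D s \<omega>) t) (at_left t)"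
    unfolding X_eq by (intro tendsto_intros tendsto_S_left tendsto_D_left assms)
  then show ?thesis using assms by (auto simp: left_value_def intro!: tendsto_Lim)
qed

lemma continuous_right_X:
  assumes "\<omega> \<in> space M" "0 \<le> t"
  shows "continuous (at_right t) (\<lambda>t. X t \<omega>)"
  unfolding X_eq using D_cadlag[OF assms(1)] assms
  by (intro continuous_intros continuous_right_S) (auto simp: cadlag_def)

lemma X_0: assumes "\<omega> \<in> space M" shows "0 \<le> X 0 \<omega>" "X 0 \<omega> = x0 - D 0 \<omega>"
  using D_jump[OF assms, of 0] x0_nonneg S_0[OF assms] by (auto simp: X_eq left_value_def)

lemma ruin_time_nonneg: "0 \<le> \<tau> \<omega>"
  unfolding ruin_time_def by (rule Inf_greatest) auto

text \<open>If the surplus were nonnegative at the ruin time, it would remain so for a while: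
  dividends are frozen from then on, no claim falls into a small right neighbourhood, and premiums
  increase. A payment at that moment is at most what the claim leaves over; were this bound
  positive, the surplus after the payment would not be negative. So the dividend path does not jump
  at ruin.\<close>

lemma X_ruin:
  assumes "\<omega> \<in> space M" "\<tau> \<omega> = ereal t"
  shows "X t \<omega> < 0" "0 < t" "left_value 0 (\<lambda>s. D s \<omega>) t = D t \<omega>"
proof -
  have t: "0 \<le> t" using ruin_time_nonneg[of \<omega>] assms by simp
  show neg: "X t \<omega> < 0"
  proof (rule ccontr)
    assume nn: "\<not> X t \<omega> < 0"
    obtain e where e: "0 < e" "\<And>s. t \<le> s \<Longrightarrow> s < t + e \<Longrightarrow> N s \<omega> = N t \<omega>"
      using N_right_const[OF assms(1) t] by blast
    have "ereal (t + e) \<le> \<tau> \<omega>"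
      unfolding ruin_time_def
    proof (rule Inf_greatest)
      fix y assume "y \<in> {ereal t |t. 0 \<le> t \<and> X t \<omega> < 0}"
      then obtain s where s: "y = ereal s" "0 \<le> s" "X s \<omega> < 0" by auto
      then have "\<tau> \<omega> \<le> ereal s" unfolding ruin_time_def by (intro Inf_lower) auto
      then have ts: "t \<le> s" using assms by simp
      have "t + e \<le> s"
      proof (rule ccontr)
        assume "\<not> t + e \<le> s"
        then have "S s \<omega> = S t \<omega>" using e(2)[of s] ts by (simp add: total_claims_def)
        moreover have "D s \<omega> = D t \<omega>" using D_after_ruin[OF assms(1), of s] assms(2) ts t by simp
        moreover have "c * t \<le> c * s" using ts c_pos by simp
        ultimately show False using nn s by (simp add: X_eq)
      qed
      then show "ereal (t + e) \<le> y" using s by simp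
    qed
    then show False using assms e by simp
  qed
  show pos: "0 < t" using neg X_0[OF assms(1)] t by (cases "t = 0") auto
  let ?Dm = "left_value 0 (\<lambda>s. D s \<omega>) t" and ?Sm = "left_value 0 (\<lambda>s. S s \<omega>) t"
  have "?Dm \<le> D t \<omega>"
  proof (rule tendsto_upperbound[OF tendsto_D_left[OF assms(1) pos]])
    show "eventually (\<lambda>s. D s \<omega> \<le> D t \<omega>) (at_left t)"
      unfolding eventually_at_left_field using pos D_mono[OF assms(1)] by (intro exI[of _ 0]) auto
  qed simp
  moreover have "D t \<omega> - ?Dm \<le> max (x0 + c * t - ?Dm - S t \<omega>) 0"
    using D_jump[OF assms(1) t] X_left[OF assms(1) pos] by (simp add: algebra_simps)
  ultimately show "?Dm = D t \<omega>" using neg by (auto simp: X_eq max_def split: if_splits)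
qed

text \<open>Survival including time \<open>t\<close> corresponds to the strict inequality because
  the infimum is attained with negative surplus.\<close>

lemma less_ruin_time_iff:
  assumes "\<omega> \<in> space M" "0 \<le> t"
  shows "ereal t < \<tau> \<omega> \<longleftrightarrow> al t \<omega>"
proof
  assume *: "ereal t < \<tau> \<omega>"
  show "al t \<omega>" unfolding alive_def
  proof (rule ballI, rule ccontr)
    fix s assume s: "s \<in> {0..t}" "\<not> 0 \<le> X s \<omega>"
    then have "\<tau> \<omega> \<le> ereal s" unfolding ruin_time_def by (intro Inf_lower) auto
    moreover have "ereal s \<le> ereal t" using s by simp
    ultimately show False using * by (meson leD le_less_trans less_le_trans)
  qed
next
  assume *: "al t \<omega>"
  show "ereal t < \<tau> \<omega>"
  proof (rule ccontr)
    assume le: "\<not> ereal t < \<tau> \<omega>"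
    then obtain u where u: "\<tau> \<omega> = ereal u" using ruin_time_nonneg[of \<omega>] by (cases "\<tau> \<omega>") auto
    then have "u \<in> {0..t}" using X_ruin(2)[OF assms(1) u] le by simp
    then have "0 \<le> X u \<omega>" using * by (simp add: alive_def)
    then show False using X_ruin(1)[OF assms(1) u] by simp
  qed
qed

lemma al_sets:
  assumes "0 \<le> t"
  shows "{\<omega>\<in>space M. al t \<omega>} \<in> sets (filtration t)"
proof -
  have "{\<omega>\<in>space (filtration t). \<forall>s\<in>{0..t}. 0 \<le> X s \<omega>} \<in> sets (filtration t)"
  proof (rule sets_path_nonneg)
    show "X s \<in> borel_measurable (filtration t)" if "0 \<le> s" "s \<le> t" for s
      using X_adapted[OF that(1)] that(2) by (rule measurable_natural_filtration_mono)
  qed (use assms continuous_right_X in \<open>auto simp: space_natural_filtration\<close>)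
  then show ?thesis by (simp add: alive_def space_natural_filtration)
qed

lemma al_events [measurable]: "0 \<le> t \<Longrightarrow> {\<omega>\<in>space M. al t \<omega>} \<in> events"
  using al_sets sets_natural_filtration by blast

lemma measurable_ruin_time [measurable]: "\<tau> \<in> borel_measurable M"
proof (rule borel_measurableI_greater)
  fix y :: ereal
  show "{\<omega>\<in>space M. y < \<tau> \<omega>} \<in> events"
  proof (cases y)
    case (real t)
    show ?thesis
    proof (cases "0 \<le> t")
      case True
      then have "{\<omega>\<in>space M. y < \<tau> \<omega>} = {\<omega>\<in>space M. al t \<omega>}" using less_ruin_time_iff real by auto
      then show ?thesis using al_events[OF True] by simp
    next
      case False
      have "y < \<tau> \<omega>" for \<omega>
        using ruin_time_nonneg[of \<omega>] False real less_le_trans[of y 0 "\<tau> \<omega>"] by simp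
      then show ?thesis by simp
    qed
  next
    case MInf
    have "y < \<tau> \<omega>" for \<omega> using ruin_time_nonneg[of \<omega>] MInf less_le_trans[of y 0 "\<tau> \<omega>"] by simp
    then show ?thesis by simp
  qed simp
qed

end

section \<open>Discounted dividends and lifetime on a time grid\<close>

text \<open>The cells are left open and right closed because a Stieltjes measure gives
  \<open>{u<..v}\<close> the increment of the path; the lump at time 0 is thus a separate
  term.\<close>

lemma nn_integral_grid:
  fixes \<mu> :: "real measure" and h :: real
  assumes f[measurable]: "f \<in> borel_measurable borel" and sets[measurable_cong]: "sets \<mu> = sets borel" and h: "0 < h"
  shows "(\<integral>\<^sup>+t\<in>{0..}. f t \<partial>\<mu>) = (\<integral>\<^sup>+t\<in>{0}. f t \<partial>\<mu>) + (\<Sum>k. \<integral>\<^sup>+t\<in>{real k * h<..real (Suc k) * h}. f t \<partial>\<mu>)"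
proof -
  have U: "(\<Union>k. {real k * h<..real (Suc k) * h}) = {0<..}"
  proof safe
    fix t :: real assume t: "0 < t"
    define k where "k = nat (\<lceil>t / h\<rceil> - 1)"
    have "0 < t / h" using t h by simp
    then have k: "real k = of_int \<lceil>t / h\<rceil> - 1" unfolding k_def by (simp add: le_ceiling_iff)
    have "real k < t / h" "t / h \<le> real (Suc k)" using k ceiling_correct[of "t / h"] by linarith+
    then show "t \<in> (\<Union>k. {real k * h<..real (Suc k) * h})" using h by (auto simp: field_simps intro!: exI[of _ k])
  next
    fix x k assume "x \<in> {real k * h<..real (Suc k) * h}"
    moreover have "0 \<le> real k * h" using h by simp
    ultimately show "0 < x" by simp
  qed
  have dj: "disjoint_family (\<lambda>k. {real k * h<..real (Suc k) * h})"
    unfolding disjoint_family_on_def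
  proof safe
    fix m n :: nat and x assume mn: "m \<noteq> n" and x: "x \<in> {real m * h<..real (Suc m) * h}" "x \<in> {real n * h<..real (Suc n) * h}"
    have "real m * h < real (Suc n) * h" "real n * h < real (Suc m) * h" using x by auto
    then have "real m < real (Suc n)" "real n < real (Suc m)" using h by (auto simp: mult_less_cancel_right)
    then show "x \<in> {}" using mn by simp
  qed
  have "(\<integral>\<^sup>+t\<in>{0..}. f t \<partial>\<mu>) = (\<integral>\<^sup>+t. f t * indicator {0} t + f t * indicator {0<..} t \<partial>\<mu>)"
    by (intro nn_integral_cong) (auto simp: indicator_def)
  also have "\<dots> = (\<integral>\<^sup>+t\<in>{0}. f t \<partial>\<mu>) + (\<integral>\<^sup>+t\<in>{0<..}. f t \<partial>\<mu>)"
    by (intro nn_integral_add) auto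
  also have "(\<integral>\<^sup>+t\<in>{0<..}. f t \<partial>\<mu>) = (\<Sum>k. \<integral>\<^sup>+t\<in>{real k * h<..real (Suc k) * h}. f t \<partial>\<mu>)"
    unfolding U[symmetric] by (rule nn_integral_disjoint_family[OF _ _ dj]) auto
  finally show ?thesis .
qed

lemma set_nn_integral_le_const:
  assumes "A \<in> sets \<mu>" "\<And>t. t \<in> A \<Longrightarrow> f t \<le> a"
  shows "(\<integral>\<^sup>+t\<in>A. f t \<partial>\<mu>) \<le> a * emeasure \<mu> A"
proof -
  have "(\<integral>\<^sup>+t\<in>A. f t \<partial>\<mu>) \<le> (\<integral>\<^sup>+t. a * indicator A t \<partial>\<mu>)"
    by (intro nn_integral_mono) (use assms in \<open>auto simp: indicator_def\<close>)
  then show ?thesis using assms(1) by (simp add: nn_integral_cmult_indicator)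
qed

lemma set_nn_integral_ge_const:
  assumes "B \<in> sets \<mu>" "B \<subseteq> A" "\<And>t. t \<in> B \<Longrightarrow> a \<le> f t"
  shows "a * emeasure \<mu> B \<le> (\<integral>\<^sup>+t\<in>A. f t \<partial>\<mu>)"
proof -
  have "(\<integral>\<^sup>+t. a * indicator B t \<partial>\<mu>) \<le> (\<integral>\<^sup>+t\<in>A. f t \<partial>\<mu>)"
    by (intro nn_integral_mono) (use assms in \<open>auto simp: indicator_def\<close>)
  then show ?thesis using assms(1) by (simp add: nn_integral_cmult_indicator)
qed

section \<open>Bounds for the integral along one dividend path\<close>

locale payout =
  fixes d :: "real \<Rightarrow> real" and \<delta> h :: real and \<tau> :: ereal
  assumes d_nonneg: "\<And>t. 0 \<le> t \<Longrightarrow> 0 \<le> d t" and d_mono: "\<And>s t. 0 \<le> s \<Longrightarrow> s \<le> t \<Longrightarrow> d s \<le> d t"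
    and d_cadlag: "cadlag d" and \<delta>: "0 < \<delta>" and h: "0 < h" and \<tau>: "0 \<le> \<tau>"
begin

abbreviation \<mu> :: "real measure" where "\<mu> \<equiv> interval_measure (\<lambda>t. if t < 0 then 0 else d t)"

lemma emeasure_\<mu>_Ioc:
  assumes "a \<le> b"
  shows "emeasure \<mu> {a<..b} = ennreal ((if b < 0 then 0 else d b) - (if a < 0 then 0 else d a))"
proof (rule emeasure_interval_measure_Ioc[OF assms])
  show "(if x < 0 then 0 else d x) \<le> (if y < 0 then 0 else d y)" if "x \<le> y" for x y
    using that d_nonneg d_mono by auto
  fix a :: real
  show "continuous (at_right a) (\<lambda>t. if t < 0 then 0 else d t)"
  proof (cases "a < 0")
    case True
    have "eventually (\<lambda>t. 0 = (if t < 0 then 0 else d t)) (at_right a)"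
      unfolding eventually_at_right_field using True by (intro exI[of _ 0]) auto
    then show ?thesis using True unfolding continuous_within by (auto intro: Lim_transform_eventually[OF tendsto_const])
  next
    case False
    have "(d \<longlongrightarrow> d a) (at_right a)" using d_cadlag False by (auto simp: cadlag_def continuous_within)
    moreover have "eventually (\<lambda>t. d t = (if t < 0 then 0 else d t)) (at_right a)"
      unfolding eventually_at_right_field using False by (intro exI[of _ "a + 1"]) auto
    ultimately show ?thesis using False unfolding continuous_within by (auto intro: Lim_transform_eventually)
  qed
qed

text \<open>The extension by 0 makes the open interval from -1 to 0 a null set, so all the mass of
  \<open>{-1<..0}\<close> sits at 0.\<close>

lemma emeasure_\<mu>_0: "emeasure \<mu> {0} = ennreal (d 0)"
proof -
  have null: "(\<Union>n. {-1<..- 1 / real (Suc n)}) \<in> null_sets \<mu>"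
  proof (rule null_sets_UN)
    fix n
    have "emeasure \<mu> {-1<..- 1 / real (Suc n)} = 0"
      by (subst emeasure_\<mu>_Ioc) (auto simp: field_simps)
    then show "{-1<..- 1 / real (Suc n)} \<in> null_sets \<mu>" by (auto simp: null_sets_def)
  qed
  have U: "(\<Union>n. {-1<..- 1 / real (Suc n)}) = {-1<..<0}"
  proof safe
    fix x :: real assume x: "x \<in> {-1<..<0}"
    then obtain n where "inverse (real (Suc n)) < - x" using reals_Archimedean[of "- x"] by auto
    then have "x \<le> - 1 / real (Suc n)" by (simp add: field_simps)
    then show "x \<in> (\<Union>n. {-1<..- 1 / real (Suc n)})" using x by auto
  qed (auto intro: le_less_trans)
  have "emeasure \<mu> {-1<..0} = emeasure \<mu> ({0} \<union> {-1<..<0})"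
    by (intro arg_cong[where f = "emeasure \<mu>"]) auto
  also have "\<dots> = emeasure \<mu> {0}" using null unfolding U by (intro emeasure_Un_null_set) auto
  finally show ?thesis using emeasure_\<mu>_Ioc[of "-1" 0] by simp
qed

lemma dividends_grid:
  "discounted_dividends \<delta> d \<tau> = (\<integral>\<^sup>+t\<in>{0}. ennreal (exp (- \<delta> * t)) * indicator {t. ereal t \<le> \<tau>} t \<partial>\<mu>)
    + (\<Sum>k. \<integral>\<^sup>+t\<in>{real k * h<..real (Suc k) * h}. ennreal (exp (- \<delta> * t)) * indicator {t. ereal t \<le> \<tau>} t \<partial>\<mu>)"
proof -
  have "discounted_dividends \<delta> d \<tau> = (\<integral>\<^sup>+t\<in>{0..}. ennreal (exp (- \<delta> * t)) * indicator {t. ereal t \<le> \<tau>} t \<partial>\<mu>)"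
    unfolding discounted_dividends_def by (intro nn_integral_cong) (auto simp: indicator_def)
  also have "\<dots> = (\<integral>\<^sup>+t\<in>{0}. ennreal (exp (- \<delta> * t)) * indicator {t. ereal t \<le> \<tau>} t \<partial>\<mu>)
    + (\<Sum>k. \<integral>\<^sup>+t\<in>{real k * h<..real (Suc k) * h}. ennreal (exp (- \<delta> * t)) * indicator {t. ereal t \<le> \<tau>} t \<partial>\<mu>)"
    by (rule nn_integral_grid) (use h in auto)
  finally show ?thesis .
qed

lemma dividends_upper:
  "discounted_dividends \<delta> d \<tau> \<le> ennreal (d 0)
    + (\<Sum>k. ennreal (exp (- \<delta> * (real k * h))) * ennreal (d (real (Suc k) * h) - d (real k * h)))"
  unfolding dividends_grid
proof (intro add_mono suminf_le)
  have "(\<integral>\<^sup>+t\<in>{0}. ennreal (exp (- \<delta> * t)) * indicator {t. ereal t \<le> \<tau>} t \<partial>\<mu>) \<le> 1 * emeasure \<mu> {0}"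
    by (rule set_nn_integral_le_const) (auto simp: indicator_def)
  then show "(\<integral>\<^sup>+t\<in>{0}. ennreal (exp (- \<delta> * t)) * indicator {t. ereal t \<le> \<tau>} t \<partial>\<mu>) \<le> ennreal (d 0)"
    by (simp add: emeasure_\<mu>_0)
  fix k
  have k: "0 \<le> real k * h" "real k * h \<le> real (Suc k) * h" using h by (auto simp: mult_right_mono)
  have "(\<integral>\<^sup>+t\<in>{real k * h<..real (Suc k) * h}. ennreal (exp (- \<delta> * t)) * indicator {t. ereal t \<le> \<tau>} t \<partial>\<mu>)
    \<le> ennreal (exp (- \<delta> * (real k * h))) * emeasure \<mu> {real k * h<..real (Suc k) * h}"
    by (rule set_nn_integral_le_const) (use \<delta> in \<open>auto simp: indicator_def intro!: ennreal_leI\<close>)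
  then show "(\<integral>\<^sup>+t\<in>{real k * h<..real (Suc k) * h}. ennreal (exp (- \<delta> * t)) * indicator {t. ereal t \<le> \<tau>} t \<partial>\<mu>)
    \<le> ennreal (exp (- \<delta> * (real k * h))) * ennreal (d (real (Suc k) * h) - d (real k * h))"
    using k by (simp add: emeasure_\<mu>_Ioc not_less[THEN iffD2] del: of_nat_Suc)
qed auto

text \<open>The integral stops at \<open>\<tau>\<close>, so the increment over the cell containing
  \<open>\<tau>\<close> is counted in full only because the path is constant from
  \<open>\<tau>\<close> on.\<close>

lemma dividends_lower:
  assumes after: "\<And>t. 0 \<le> t \<Longrightarrow> \<tau> \<le> ereal t \<Longrightarrow> d t = d (real_of_ereal \<tau>)"
  shows "ennreal (d 0) + (\<Sum>k. ennreal (exp (- \<delta> * (real (Suc k) * h))) * ennreal (d (real (Suc k) * h) - d (real k * h)))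
    \<le> discounted_dividends \<delta> d \<tau>"
  unfolding dividends_grid
proof (intro add_mono suminf_le)
  have "1 * emeasure \<mu> {0} \<le> (\<integral>\<^sup>+t\<in>{0}. ennreal (exp (- \<delta> * t)) * indicator {t. ereal t \<le> \<tau>} t \<partial>\<mu>)"
    by (rule set_nn_integral_ge_const) (use \<tau> in \<open>auto simp: indicator_def zero_ereal_def\<close>)
  then show "ennreal (d 0) \<le> (\<integral>\<^sup>+t\<in>{0}. ennreal (exp (- \<delta> * t)) * indicator {t. ereal t \<le> \<tau>} t \<partial>\<mu>)"
    by (simp add: emeasure_\<mu>_0)
  fix k
  define u v where "u = real k * h" and "v = real (Suc k) * h"
  have uv: "0 \<le> u" "u \<le> v" unfolding u_def v_def using h by (auto simp: mult_right_mono)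
  \<comment> \<open>Used with \<open>w = v\<close> if the cell ends by time \<open>\<tau>\<close>,
    and with \<open>w = \<tau>\<close> if \<open>\<tau>\<close> lies inside it.\<close>
  have gen: "ennreal (exp (- \<delta> * v)) * ennreal (d w - d u)
      \<le> (\<integral>\<^sup>+t\<in>{u<..v}. ennreal (exp (- \<delta> * t)) * indicator {t. ereal t \<le> \<tau>} t \<partial>\<mu>)"
    if w: "u \<le> w" "w \<le> v" "ereal w \<le> \<tau>" for w
  proof -
    have "ereal t \<le> \<tau>" if "t \<le> w" for t using that w(3) order_trans[of "ereal t" "ereal w" \<tau>] by simp
    then have "ennreal (exp (- \<delta> * v)) * emeasure \<mu> {u<..w}
      \<le> (\<integral>\<^sup>+t\<in>{u<..v}. ennreal (exp (- \<delta> * t)) * indicator {t. ereal t \<le> \<tau>} t \<partial>\<mu>)"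
      by (intro set_nn_integral_ge_const) (use w \<delta> in \<open>auto simp: indicator_def intro!: ennreal_leI\<close>)
    then show ?thesis using w uv by (simp add: emeasure_\<mu>_Ioc not_less[THEN iffD2])
  qed
  have "ennreal (exp (- \<delta> * v)) * ennreal (d v - d u)
      \<le> (\<integral>\<^sup>+t\<in>{u<..v}. ennreal (exp (- \<delta> * t)) * indicator {t. ereal t \<le> \<tau>} t \<partial>\<mu>)"
  proof (cases "ereal v \<le> \<tau>")
    case True then show ?thesis using gen[of v] uv by simp
  next
    case False
    then obtain w where w: "\<tau> = ereal w" using \<tau> by (cases \<tau>) auto
    show ?thesis
    proof (cases "u \<le> w")
      case True
      then have "d v = d w" using after[of v] uv w False by simp
      then show ?thesis using gen[of w] w True False by simp
    next
      case F: False
      then have "d v = d u" using after[of v] after[of u] uv w False by simp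
      then show ?thesis by simp
    qed
  qed
  then show "ennreal (exp (- \<delta> * (real (Suc k) * h))) * ennreal (d (real (Suc k) * h) - d (real k * h))
    \<le> (\<integral>\<^sup>+t\<in>{real k * h<..real (Suc k) * h}. ennreal (exp (- \<delta> * t)) * indicator {t. ereal t \<le> \<tau>} t \<partial>\<mu>)"
    by (simp only: u_def v_def)
qed auto

end

lemma discounted_time_grid:
  assumes h: "0 < (h::real)"
  shows "discounted_time \<delta> \<tau> = (\<Sum>k. \<integral>\<^sup>+t\<in>{real k * h<..real (Suc k) * h}. ennreal (exp (- \<delta> * t)) * indicator {t. ereal t \<le> \<tau>} t \<partial>lborel)"
proof -
  have "discounted_time \<delta> \<tau> = (\<integral>\<^sup>+t\<in>{0..}. ennreal (exp (- \<delta> * t)) * indicator {t. ereal t \<le> \<tau>} t \<partial>lborel)"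
    unfolding discounted_time_def by (intro nn_integral_cong) (auto simp: indicator_def)
  also have "\<dots> = (\<integral>\<^sup>+t\<in>{0}. ennreal (exp (- \<delta> * t)) * indicator {t. ereal t \<le> \<tau>} t \<partial>lborel)
    + (\<Sum>k. \<integral>\<^sup>+t\<in>{real k * h<..real (Suc k) * h}. ennreal (exp (- \<delta> * t)) * indicator {t. ereal t \<le> \<tau>} t \<partial>lborel)"
    by (rule nn_integral_grid) (use h in auto)
  also have "(\<integral>\<^sup>+t\<in>{0}. ennreal (exp (- \<delta> * t)) * indicator {t. ereal t \<le> \<tau>} t \<partial>lborel) \<le> \<top> * emeasure lborel {0 :: real}"
    by (rule set_nn_integral_le_const) auto
  then have "(\<integral>\<^sup>+t\<in>{0}. ennreal (exp (- \<delta> * t)) * indicator {t. ereal t \<le> \<tau>} t \<partial>lborel) = 0" by simp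
  finally show ?thesis by simp
qed

text \<open>Only the cell containing ruin is counted wrongly: survival at left end points counts it
  entirely, survival at right end points, as in the lower bound further on, not at all.\<close>

lemma discounted_time_upper:
  assumes h: "0 < (h::real)" and \<delta>: "0 < \<delta>"
  shows "discounted_time \<delta> \<tau> \<le> (\<Sum>k. ennreal (h * exp (- \<delta> * (real k * h))) * indicator {\<tau>. ereal (real k * h) < \<tau>} \<tau>)"
  unfolding discounted_time_grid[OF h]
proof (intro suminf_le)
  fix k
  show "(\<integral>\<^sup>+t\<in>{real k * h<..real (Suc k) * h}. ennreal (exp (- \<delta> * t)) * indicator {t. ereal t \<le> \<tau>} t \<partial>lborel)
    \<le> ennreal (h * exp (- \<delta> * (real k * h))) * indicator {\<tau>. ereal (real k * h) < \<tau>} \<tau>"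
  proof (cases "ereal (real k * h) < \<tau>")
    case True
    have "(\<integral>\<^sup>+t\<in>{real k * h<..real (Suc k) * h}. ennreal (exp (- \<delta> * t)) * indicator {t. ereal t \<le> \<tau>} t \<partial>lborel)
      \<le> ennreal (exp (- \<delta> * (real k * h))) * emeasure lborel {real k * h<..real (Suc k) * h}"
      by (rule set_nn_integral_le_const) (use \<delta> in \<open>auto simp: indicator_def intro!: ennreal_leI\<close>)
    also have "emeasure lborel {real k * h<..real (Suc k) * h} = ennreal h"
      using h by (subst emeasure_lborel_Ioc) (auto simp: algebra_simps)
    finally show ?thesis using True h by (simp add: ennreal_mult mult.commute)
  next
    case False
    have "(\<integral>\<^sup>+t\<in>{real k * h<..real (Suc k) * h}. ennreal (exp (- \<delta> * t)) * indicator {t. ereal t \<le> \<tau>} t \<partial>lborel)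
      \<le> 0 * emeasure lborel {real k * h<..real (Suc k) * h}"
    proof (rule set_nn_integral_le_const)
      fix t assume "t \<in> {real k * h<..real (Suc k) * h}"
      then have "\<not> ereal t \<le> \<tau>" using False by (meson ereal_less(1) greaterThanAtMost_iff less_ereal.simps(1) less_le_trans)
      then show "ennreal (exp (- \<delta> * t)) * indicator {t. ereal t \<le> \<tau>} t \<le> 0" by simp
    qed simp
    then show ?thesis by simp
  qed
qed auto

lemma discounted_time_lower:
  assumes h: "0 < (h::real)" and \<delta>: "0 < \<delta>"
  shows "(\<Sum>k. ennreal (h * exp (- \<delta> * (real (Suc k) * h))) * indicator {\<tau>. ereal (real (Suc k) * h) < \<tau>} \<tau>) \<le> discounted_time \<delta> \<tau>"
  unfolding discounted_time_grid[OF h]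
proof (intro suminf_le)
  fix k
  show "ennreal (h * exp (- \<delta> * (real (Suc k) * h))) * indicator {\<tau>. ereal (real (Suc k) * h) < \<tau>} \<tau>
    \<le> (\<integral>\<^sup>+t\<in>{real k * h<..real (Suc k) * h}. ennreal (exp (- \<delta> * t)) * indicator {t. ereal t \<le> \<tau>} t \<partial>lborel)"
  proof (cases "ereal (real (Suc k) * h) < \<tau>")
    case True
    have "ereal t \<le> \<tau>" if "t \<le> real (Suc k) * h" for t
      using True that less_imp_le order_trans[of "ereal t" "ereal (real (Suc k) * h)" \<tau>] by simp
    then have "ennreal (exp (- \<delta> * (real (Suc k) * h))) * emeasure lborel {real k * h<..real (Suc k) * h}
      \<le> (\<integral>\<^sup>+t\<in>{real k * h<..real (Suc k) * h}. ennreal (exp (- \<delta> * t)) * indicator {t. ereal t \<le> \<tau>} t \<partial>lborel)"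
      by (intro set_nn_integral_ge_const) (use \<delta> in \<open>auto simp: indicator_def intro!: ennreal_leI\<close>)
    also have "emeasure lborel {real k * h<..real (Suc k) * h} = ennreal h"
      using h by (subst emeasure_lborel_Ioc) (auto simp: algebra_simps)
    finally show ?thesis using True h by (simp add: ennreal_mult mult.commute)
  qed simp
qed auto

section \<open>Expectation over one time step, by the number of claims\<close>

lemma measure_poisson_0: "0 < m \<Longrightarrow> measure (poisson_pmf m) {0} = exp (- m)"
  by (simp add: measure_pmf_single pmf_poisson)

lemma measure_poisson_1: "0 < m \<Longrightarrow> measure (poisson_pmf m) {1} = m * exp (- m)"
  by (simp add: measure_pmf_single pmf_poisson)

lemma measure_poisson_ge_2:
  assumes "0 < m"
  shows "measure (poisson_pmf m) {2..} \<le> m\<^sup>2"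
proof -
  have "{2..} = UNIV - {0, 1 :: nat}" by auto
  then have "measure (poisson_pmf m) {2..} = 1 - measure (poisson_pmf m) {0, 1}"
    using measure_pmf.prob_compl[of "{0, 1}" "poisson_pmf m"] by simp
  also have "measure (poisson_pmf m) {0, 1} = exp (- m) + m * exp (- m)"
    using assms by (subst measure_measure_pmf_finite) (auto simp: pmf_poisson)
  also have "1 - (exp (- m) + m * exp (- m)) \<le> m\<^sup>2"
  proof -
    have "(1 + m) * (1 - m) \<le> (1 + m) * exp (- m)"
      using assms exp_ge_add_one_self[of "- m"] by (intro mult_left_mono) auto
    then show ?thesis by (simp add: algebra_simps power2_eq_square)
  qed
  finally show ?thesis .
qed

context cramer_lundberg_exponential
begin

text \<open>The substitution \<open>z = x - y\<close> identifies \<open>conv\<close>, so far a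
  purely analytic object, with an expectation over one claim.\<close>

lemma claim_integral:
  assumes F: "continuous_on {0..} F" and [measurable]: "F \<in> borel_measurable borel"
    and nonneg: "\<And>x. 0 \<le> x \<Longrightarrow> 0 \<le> F x" and x: "0 \<le> x"
  shows "(\<integral>\<^sup>+y. ennreal (F (x - y)) * indicator {..x} y \<partial>claim_law) = ennreal (conv F x)"
proof -
  have "(\<integral>\<^sup>+y. ennreal (F (x - y)) * indicator {..x} y \<partial>claim_law)
    = (\<integral>\<^sup>+y. ennreal (exponential_density \<alpha> y) * (ennreal (F (x - y)) * indicator {..x} y) \<partial>lborel)"
    by (subst nn_integral_density) auto
  also have "\<dots> = (\<integral>\<^sup>+y. ennreal (\<alpha> * exp (- \<alpha> * y) * F (x - y)) * indicator {0..x} y \<partial>lborel)"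
  proof (intro nn_integral_cong)
    fix y
    show "ennreal (exponential_density \<alpha> y) * (ennreal (F (x - y)) * indicator {..x} y)
      = ennreal (\<alpha> * exp (- \<alpha> * y) * F (x - y)) * indicator {0..x} y"
      using \<alpha>_pos nonneg[of "x - y"]
      by (cases "0 \<le> y \<and> y \<le> x") (auto simp: exponential_density_def indicator_def ennreal_mult mult_ac)
  qed
  also have "\<dots> = ennreal \<bar>-1\<bar> * (\<integral>\<^sup>+z. ennreal (\<alpha> * exp (- \<alpha> * (x + (-1) * z)) * F (x - (x + (-1) * z))) * indicator {0..x} (x + (-1) * z) \<partial>lborel)"
    by (rule nn_integral_real_affine) auto
  also have "\<dots> = (\<integral>\<^sup>+z. ennreal (exp (- \<alpha> * x)) * (ennreal (\<alpha> * exp (\<alpha> * z) * F z) * indicator {0..x} z) \<partial>lborel)"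
  proof -
    have "exp (- \<alpha> * (x + (-1) * z)) = exp (- \<alpha> * x) * exp (\<alpha> * z)" for z
      by (simp add: algebra_simps flip: exp_add)
    then show ?thesis
      using \<alpha>_pos nonneg by (auto intro!: nn_integral_cong simp: indicator_def mult_ac simp flip: ennreal_mult)
  qed
  also have "\<dots> = ennreal (exp (- \<alpha> * x)) * (\<integral>\<^sup>+z. ennreal (\<alpha> * exp (\<alpha> * z) * F z) * indicator {0..x} z \<partial>lborel)"
    by (rule nn_integral_cmult) auto
  also have "(\<integral>\<^sup>+z. ennreal (\<alpha> * exp (\<alpha> * z) * F z) * indicator {0..x} z \<partial>lborel)
    = ennreal (integral {0..x} (\<lambda>z. \<alpha> * exp (\<alpha> * z) * F z))"
  proof -
    define f where "f z = (if z \<in> {0..x} then \<alpha> * exp (\<alpha> * z) * F z else 0)" for z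
    have "((\<lambda>z. \<alpha> * exp (\<alpha> * z) * F z) has_integral integral {0..x} (\<lambda>z. \<alpha> * exp (\<alpha> * z) * F z)) {0..x}"
      by (intro integrable_integral integrable_continuous_real continuous_intros continuous_on_subset[OF F]) auto
    then have "(f has_integral integral {0..x} (\<lambda>z. \<alpha> * exp (\<alpha> * z) * F z)) UNIV"
      unfolding f_def[abs_def] by (simp only: has_integral_restrict_UNIV)
    then have "(\<integral>\<^sup>+z. ennreal (f z) \<partial>lborel) = ennreal (integral {0..x} (\<lambda>z. \<alpha> * exp (\<alpha> * z) * F z))"
      using \<alpha>_pos nonneg unfolding f_def[abs_def]
      by (intro nn_integral_has_integral_lborel) auto
    moreover have "ennreal (f z) = ennreal (\<alpha> * exp (\<alpha> * z) * F z) * indicator {0..x} z" for z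
      by (simp add: f_def indicator_def)
    ultimately show ?thesis by simp
  qed
  also have "ennreal (exp (- \<alpha> * x)) * ennreal (integral {0..x} (\<lambda>z. \<alpha> * exp (\<alpha> * z) * F z)) = ennreal (conv F x)"
    unfolding conv_def by (rule ennreal_mult'[symmetric]) simp
  finally show ?thesis .
qed


lemma S_increment:
  assumes "\<omega> \<in> space M" "0 \<le> t" "t \<le> u"
  shows "N u \<omega> - N t \<omega> = 0 \<Longrightarrow> S u \<omega> = S t \<omega>"
    and "N u \<omega> - N t \<omega> = 1 \<Longrightarrow> S u \<omega> = S t \<omega> + Y (Suc (N t \<omega>)) \<omega>"
proof -
  have le: "N t \<omega> \<le> N u \<omega>" using N_mono[OF assms] .
  show "S u \<omega> = S t \<omega>" if "N u \<omega> - N t \<omega> = 0"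
  proof -
    have "N u \<omega> = N t \<omega>" using le that by simp
    then show ?thesis by (simp add: total_claims_def)
  qed
  show "S u \<omega> = S t \<omega> + Y (Suc (N t \<omega>)) \<omega>" if "N u \<omega> - N t \<omega> = 1"
  proof -
    have "N u \<omega> = Suc (N t \<omega>)" using le that by simp
    then show ?thesis by (simp add: total_claims_def)
  qed
qed

text \<open>\<open>Z\<close> stands for the surplus at \<open>t\<close>, with negative values
  encoding ruin. With no claim the state is \<open>Z + c * h\<close>; with one claim the expectation
  is a convolution at \<open>Z + c * h\<close>; with more, monotonicity bounds the value by that at
  \<open>Z + c * h\<close>, and the probability is at most \<open>(r * h)\<^sup>2\<close>.\<close>

lemma one_step_expectation_upper:
  assumes F: "continuous_on {0..} F" and [measurable]: "F \<in> borel_measurable borel"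
    and nonneg: "\<And>x. 0 \<le> x \<Longrightarrow> 0 \<le> F x" and mono: "\<And>x y. 0 \<le> x \<Longrightarrow> x \<le> y \<Longrightarrow> F x \<le> F y"
    and step: "\<And>x. 0 \<le> x \<Longrightarrow> exp (- \<delta> * h) * (exp (- r * h) * F (x + c * h)
      + r * h * exp (- r * h) * conv F (x + c * h) + (r * h)\<^sup>2 * F (x + c * h)) + L * h \<le> F x + R x"
    and t: "0 \<le> t" and h: "0 < h" and L: "0 \<le> L"
    and Z: "Z \<in> borel_measurable (natural_filtration M (surplus c S x0) t)"
    and [measurable]: "R \<in> borel_measurable borel" and R: "\<And>x. 0 \<le> x \<Longrightarrow> 0 \<le> R x"
  shows "ennreal (exp (- \<delta> * h)) * (\<integral>\<^sup>+\<omega>. (if 0 \<le> Z \<omega> \<and> 0 \<le> Z \<omega> + c * h - (S (t + h) \<omega> - S t \<omega>)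
        then ennreal (F (Z \<omega> + c * h - (S (t + h) \<omega> - S t \<omega>))) else 0) \<partial>M)
      + (\<integral>\<^sup>+\<omega>. (if 0 \<le> Z \<omega> then ennreal (L * h) else 0) \<partial>M)
    \<le> (\<integral>\<^sup>+\<omega>. (if 0 \<le> Z \<omega> then ennreal (F (Z \<omega>)) + ennreal (R (Z \<omega>)) else 0) \<partial>M)"
proof -
  define u where "u = t + h"
  have u: "t < u" "u - t = h" "0 \<le> u" using h t by (auto simp: u_def)
  have [measurable]: "Z \<in> borel_measurable M" using Z by (rule measurable_natural_filtration)
  have [measurable]: "N t \<in> measurable M (count_space UNIV)" "N u \<in> measurable M (count_space UNIV)"
    using t u by auto
  have [measurable]: "(\<lambda>\<omega>. Y (Suc (N t \<omega>)) \<omega>) \<in> borel_measurable M"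
    by (rule measurable_compose_countable[where g = "N t" and f = "\<lambda>n \<omega>. Y (Suc n) \<omega>"]) auto
  define g0 where "g0 p = (if 0 \<le> fst p then ennreal (F (fst p + c * h)) else 0)" for p :: "real \<times> real"
  define g1 where "g1 p = (if 0 \<le> fst p then ennreal (F (fst p + c * h - snd p)) * indicator {..fst p + c * h} (snd p) else 0)"
    for p :: "real \<times> real"
  have [measurable]: "g0 \<in> borel_measurable (borel \<Otimes>\<^sub>M borel)" unfolding g0_def by measurable
  have ind: "indicator {..fst p + c * h} (snd p) = (if snd p \<le> fst p + c * h then 1 else 0 :: ennreal)" for p :: "real \<times> real"
    by (simp add: indicator_def)
  have [measurable]: "g1 \<in> borel_measurable (borel \<Otimes>\<^sub>M borel)" unfolding g1_def ind by measurable
  let ?Y = "\<lambda>\<omega>. Y (Suc (N t \<omega>)) \<omega>"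
  let ?D = "\<lambda>\<omega>. N u \<omega> - N t \<omega>"
  define p where "p J = ennreal (measure (poisson_pmf (r * h)) J)" for J
  have ch: "0 < c * h" using c_pos h by simp
  have rh: "0 < r * h" using r_pos h by simp
  interpret claim: prob_space claim_law by (rule prob_space_exponential_density) (rule \<alpha>_pos)
  have 0: "(\<integral>\<^sup>+y. g0 (z, y) \<partial>claim_law) = g0 (z, 0)" for z
    by (simp add: g0_def claim.emeasure_space_1[simplified])
  have 1: "(\<integral>\<^sup>+y. g1 (z, y) \<partial>claim_law) = (if 0 \<le> z then ennreal (conv F (z + c * h)) else 0)" for z
    using claim_integral[OF F \<open>F \<in> _\<close> nonneg, of "z + c * h"] ch by (simp add: g1_def)
  have [measurable]: "(\<lambda>\<omega>. g0 (Z \<omega>, 0)) \<in> borel_measurable M"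
    unfolding g0_def fst_conv by measurable
  have "(\<lambda>\<omega>. \<integral>\<^sup>+y. g1 (Z \<omega>, y) \<partial>claim_law) \<in> borel_measurable M"
    by (rule claim.borel_measurable_nn_integral) measurable
  then have [measurable]: "(\<lambda>\<omega>. if 0 \<le> Z \<omega> then ennreal (conv F (Z \<omega> + c * h)) else 0) \<in> borel_measurable M"
    unfolding 1 .
  have "(\<integral>\<^sup>+\<omega>. (if 0 \<le> Z \<omega> \<and> 0 \<le> Z \<omega> + c * h - (S u \<omega> - S t \<omega>)
        then ennreal (F (Z \<omega> + c * h - (S u \<omega> - S t \<omega>))) else 0) \<partial>M)
     \<le> (\<integral>\<^sup>+\<omega>. indicator {0} (?D \<omega>) * g0 (Z \<omega>, ?Y \<omega>) + (indicator {1} (?D \<omega>) * g1 (Z \<omega>, ?Y \<omega>) + indicator {2..} (?D \<omega>) * g0 (Z \<omega>, ?Y \<omega>)) \<partial>M)"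
  proof (rule nn_integral_mono_AE, rule AE_mp[OF AE_claims_nonneg], rule AE_I2, rule impI)
    fix \<omega> assume \<omega>: "\<omega> \<in> space M" and Ypos: "\<forall>i\<ge>1. 0 \<le> Y i \<omega>"
    have Smono: "S t \<omega> \<le> S u \<omega>" using S_mono[OF \<omega> _ t] Ypos u by simp
    note inc = S_increment[OF \<omega> t less_imp_le[OF u(1)]]
    have le: "F (Z \<omega> + c * h - (S u \<omega> - S t \<omega>)) \<le> F (Z \<omega> + c * h)" if "0 \<le> Z \<omega> + c * h - (S u \<omega> - S t \<omega>)"
      using that Smono by (intro mono) auto
    consider "?D \<omega> = 0" | "?D \<omega> = 1" | "2 \<le> ?D \<omega>" by linarith
    then show "(if 0 \<le> Z \<omega> \<and> 0 \<le> Z \<omega> + c * h - (S u \<omega> - S t \<omega>)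
        then ennreal (F (Z \<omega> + c * h - (S u \<omega> - S t \<omega>))) else 0)
      \<le> indicator {0} (?D \<omega>) * g0 (Z \<omega>, ?Y \<omega>) + (indicator {1} (?D \<omega>) * g1 (Z \<omega>, ?Y \<omega>) + indicator {2..} (?D \<omega>) * g0 (Z \<omega>, ?Y \<omega>))"
    proof cases
      case 1 then show ?thesis using inc(1) by (simp add: g0_def)
    next
      case 2 then show ?thesis using inc(2) by (simp add: g1_def indicator_def algebra_simps)
    next
      case 3
      then have "indicator {0} (?D \<omega>) = (0::ennreal)" "indicator {1} (?D \<omega>) = (0::ennreal)" "indicator {2..} (?D \<omega>) = (1::ennreal)"
        by (auto simp: indicator_def)
      then show ?thesis using le by (simp add: g0_def ennreal_leI)
    qed
  qed
  also have "\<dots> = (\<integral>\<^sup>+\<omega>. indicator {0} (?D \<omega>) * g0 (Z \<omega>, ?Y \<omega>) \<partial>M) + ((\<integral>\<^sup>+\<omega>. indicator {1} (?D \<omega>) * g1 (Z \<omega>, ?Y \<omega>) \<partial>M)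
      + (\<integral>\<^sup>+\<omega>. indicator {2..} (?D \<omega>) * g0 (Z \<omega>, ?Y \<omega>) \<partial>M))"
    by (subst nn_integral_add, measurable, subst nn_integral_add, measurable)
  also have "\<dots> = p {0} * (\<integral>\<^sup>+\<omega>. (\<integral>\<^sup>+y. g0 (Z \<omega>, y) \<partial>claim_law) \<partial>M) + (p {1} * (\<integral>\<^sup>+\<omega>. (\<integral>\<^sup>+y. g1 (Z \<omega>, y) \<partial>claim_law) \<partial>M)
      + p {2..} * (\<integral>\<^sup>+\<omega>. (\<integral>\<^sup>+y. g0 (Z \<omega>, y) \<partial>claim_law) \<partial>M))"
    unfolding p_def u(2)[symmetric] by (simp only: nn_integral_next_claim[OF t u(1) Z \<open>g0 \<in> _\<close>] nn_integral_next_claim[OF t u(1) Z \<open>g1 \<in> _\<close>])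
  also have "\<dots> = (\<integral>\<^sup>+\<omega>. p {0} * g0 (Z \<omega>, 0) + (p {1} * (if 0 \<le> Z \<omega> then ennreal (conv F (Z \<omega> + c * h)) else 0) + p {2..} * g0 (Z \<omega>, 0)) \<partial>M)"
    unfolding 0 1
    by (subst nn_integral_add, measurable, subst nn_integral_add, measurable) (simp add: nn_integral_cmult)
  finally have "ennreal (exp (- \<delta> * h)) * (\<integral>\<^sup>+\<omega>. (if 0 \<le> Z \<omega> \<and> 0 \<le> Z \<omega> + c * h - (S u \<omega> - S t \<omega>)
        then ennreal (F (Z \<omega> + c * h - (S u \<omega> - S t \<omega>))) else 0) \<partial>M)
      + (\<integral>\<^sup>+\<omega>. (if 0 \<le> Z \<omega> then ennreal (L * h) else 0) \<partial>M)
    \<le> ennreal (exp (- \<delta> * h)) * (\<integral>\<^sup>+\<omega>. p {0} * g0 (Z \<omega>, 0) + (p {1} * (if 0 \<le> Z \<omega> then ennreal (conv F (Z \<omega> + c * h)) else 0) + p {2..} * g0 (Z \<omega>, 0)) \<partial>M)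
      + (\<integral>\<^sup>+\<omega>. (if 0 \<le> Z \<omega> then ennreal (L * h) else 0) \<partial>M)"
    by (intro add_mono mult_left_mono) auto
  also have "\<dots> = (\<integral>\<^sup>+\<omega>. ennreal (exp (- \<delta> * h)) * (p {0} * g0 (Z \<omega>, 0) + (p {1} * (if 0 \<le> Z \<omega> then ennreal (conv F (Z \<omega> + c * h)) else 0) + p {2..} * g0 (Z \<omega>, 0)))
      + (if 0 \<le> Z \<omega> then ennreal (L * h) else 0) \<partial>M)"
    by (subst nn_integral_add, measurable) (subst nn_integral_cmult, measurable)
  also have "\<dots> \<le> (\<integral>\<^sup>+\<omega>. (if 0 \<le> Z \<omega> then ennreal (F (Z \<omega>)) + ennreal (R (Z \<omega>)) else 0) \<partial>M)"
  proof (rule nn_integral_mono)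
    fix \<omega>
    show "ennreal (exp (- \<delta> * h)) * (p {0} * g0 (Z \<omega>, 0) + (p {1} * (if 0 \<le> Z \<omega> then ennreal (conv F (Z \<omega> + c * h)) else 0) + p {2..} * g0 (Z \<omega>, 0)))
      + (if 0 \<le> Z \<omega> then ennreal (L * h) else 0) \<le> (if 0 \<le> Z \<omega> then ennreal (F (Z \<omega>)) + ennreal (R (Z \<omega>)) else 0)"
    proof (cases "0 \<le> Z \<omega>")
      case True
      define z where "z = Z \<omega>"
      have z: "0 \<le> z" using True by (simp add: z_def)
      have Fz: "0 \<le> F (z + c * h)" "0 \<le> conv F (z + c * h)" "0 \<le> F z" using z ch by (auto intro: nonneg conv_nonneg F)
      let ?m = "measure (poisson_pmf (r * h))"
      have "ennreal (exp (- \<delta> * h)) * (ennreal (?m {0}) * ennreal (F (z + c * h)) + (ennreal (?m {1}) * ennreal (conv F (z + c * h)) + ennreal (?m {2..}) * ennreal (F (z + c * h)))) + ennreal (L * h)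
        = ennreal (exp (- \<delta> * h) * (?m {0} * F (z + c * h) + (?m {1} * conv F (z + c * h) + ?m {2..} * F (z + c * h))) + L * h)"
        using Fz L h by (simp add: ennreal_mult' ennreal_plus)
      also have "\<dots> \<le> ennreal (exp (- \<delta> * h) * (exp (- r * h) * F (z + c * h)
          + r * h * exp (- r * h) * conv F (z + c * h) + (r * h)\<^sup>2 * F (z + c * h)) + L * h)"
      proof (intro ennreal_leI add_right_mono mult_left_mono)
        have "?m {2..} * F (z + c * h) \<le> (r * h)\<^sup>2 * F (z + c * h)"
          using measure_poisson_ge_2[OF rh] Fz by (intro mult_right_mono) auto
        then show "?m {0} * F (z + c * h) + (?m {1} * conv F (z + c * h) + ?m {2..} * F (z + c * h))
          \<le> exp (- r * h) * F (z + c * h) + r * h * exp (- r * h) * conv F (z + c * h) + (r * h)\<^sup>2 * F (z + c * h)"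
          using measure_poisson_0[OF rh] measure_poisson_1[OF rh] by simp
      qed simp
      also have "\<dots> \<le> ennreal (F z + R z)" by (intro ennreal_leI step z)
      also have "\<dots> = ennreal (F z) + ennreal (R z)" using Fz R[OF z] by (simp add: ennreal_plus)
      finally show ?thesis using True by (simp add: g0_def p_def z_def)
    qed (simp add: g0_def)
  qed
  finally show ?thesis unfolding u_def .
qed

text \<open>Two or more claims are dropped, and one claim is accepted only if it is at most
  \<open>Z\<close>, so that the path survives wherever in the step the claim falls. By monotonicity
  the accepted part is at least the convolution at \<open>Z\<close>.\<close>

lemma one_step_expectation_lower:
  assumes F: "continuous_on {0..} F" and [measurable]: "F \<in> borel_measurable borel"
    and nonneg: "\<And>x. 0 \<le> x \<Longrightarrow> 0 \<le> F x" and mono: "\<And>x y. 0 \<le> x \<Longrightarrow> x \<le> y \<Longrightarrow> F x \<le> F y"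
    and step: "\<And>x. x \<in> A \<Longrightarrow> F x \<le> exp (- \<delta> * h) * (exp (- r * h) * F (x + c * h)
      + r * h * exp (- r * h) * conv F x) + L * h + C"
    and t: "0 \<le> t" and h: "0 < h" and L: "0 \<le> L" and C: "0 \<le> C"
    and Z: "Z \<in> borel_measurable (natural_filtration M (surplus c S x0) t)"
    and ZA: "\<And>\<omega>. \<omega> \<in> space M \<Longrightarrow> 0 \<le> Z \<omega> \<Longrightarrow> Z \<omega> \<in> A"
  shows "(\<integral>\<^sup>+\<omega>. (if 0 \<le> Z \<omega> then ennreal (F (Z \<omega>)) else 0) \<partial>M)
    \<le> ennreal (exp (- \<delta> * h)) * (\<integral>\<^sup>+\<omega>. indicator {0} (N (t + h) \<omega> - N t \<omega>) * (if 0 \<le> Z \<omega> then ennreal (F (Z \<omega> + c * h)) else 0)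
        + indicator {1} (N (t + h) \<omega> - N t \<omega>) * (if 0 \<le> Z \<omega> \<and> Y (Suc (N t \<omega>)) \<omega> \<le> Z \<omega>
            then ennreal (F (Z \<omega> + c * h - Y (Suc (N t \<omega>)) \<omega>)) else 0) \<partial>M)
      + (\<integral>\<^sup>+\<omega>. (if 0 \<le> Z \<omega> then ennreal (L * h) else 0) \<partial>M) + ennreal C"
proof -
  define u where "u = t + h"
  have u: "t < u" "u - t = h" "0 \<le> u" using h t by (auto simp: u_def)
  have [measurable]: "Z \<in> borel_measurable M" using Z by (rule measurable_natural_filtration)
  have [measurable]: "N t \<in> measurable M (count_space UNIV)" "N u \<in> measurable M (count_space UNIV)"
    using t u by auto
  have [measurable]: "(\<lambda>\<omega>. Y (Suc (N t \<omega>)) \<omega>) \<in> borel_measurable M"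
    by (rule measurable_compose_countable[where g = "N t" and f = "\<lambda>n \<omega>. Y (Suc n) \<omega>"]) auto
  define g0 where "g0 p = (if 0 \<le> fst p then ennreal (F (fst p + c * h)) else 0)" for p :: "real \<times> real"
  define g1 where "g1 p = (if 0 \<le> fst p \<and> snd p \<le> fst p then ennreal (F (fst p + c * h - snd p)) else 0)"
    for p :: "real \<times> real"
  have [measurable]: "g0 \<in> borel_measurable (borel \<Otimes>\<^sub>M borel)" unfolding g0_def by measurable
  have [measurable]: "g1 \<in> borel_measurable (borel \<Otimes>\<^sub>M borel)" unfolding g1_def by measurable
  let ?Y = "\<lambda>\<omega>. Y (Suc (N t \<omega>)) \<omega>"
  let ?D = "\<lambda>\<omega>. N u \<omega> - N t \<omega>"
  define p where "p J = ennreal (measure (poisson_pmf (r * h)) J)" for J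
  have ch: "0 < c * h" using c_pos h by simp
  have rh: "0 < r * h" using r_pos h by simp
  interpret claim: prob_space claim_law by (rule prob_space_exponential_density) (rule \<alpha>_pos)
  have 0: "(\<integral>\<^sup>+y. g0 (z, y) \<partial>claim_law) = g0 (z, 0)" for z
    by (simp add: g0_def claim.emeasure_space_1[simplified])
  have 1: "(if 0 \<le> z then ennreal (conv F z) else 0) \<le> (\<integral>\<^sup>+y. g1 (z, y) \<partial>claim_law)" for z
  proof (cases "0 \<le> z")
    case True
    have "ennreal (conv F z) = (\<integral>\<^sup>+y. ennreal (F (z - y)) * indicator {..z} y \<partial>claim_law)"
      by (rule claim_integral[OF F \<open>F \<in> _\<close> nonneg True, symmetric])
    also have "\<dots> \<le> (\<integral>\<^sup>+y. g1 (z, y) \<partial>claim_law)"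
      using True ch by (intro nn_integral_mono) (auto simp: g1_def indicator_def intro!: ennreal_leI mono)
    finally show ?thesis using True by simp
  qed simp
  have [measurable]: "(\<lambda>\<omega>. g0 (Z \<omega>, 0)) \<in> borel_measurable M"
    unfolding g0_def fst_conv by measurable
  have [measurable]: "(\<lambda>\<omega>. \<integral>\<^sup>+y. g1 (Z \<omega>, y) \<partial>claim_law) \<in> borel_measurable M"
    by (rule claim.borel_measurable_nn_integral) measurable
  have "(\<integral>\<^sup>+\<omega>. (if 0 \<le> Z \<omega> then ennreal (F (Z \<omega>)) else 0) \<partial>M)
    \<le> (\<integral>\<^sup>+\<omega>. ennreal (exp (- \<delta> * h)) * (p {0} * g0 (Z \<omega>, 0) + p {1} * (\<integral>\<^sup>+y. g1 (Z \<omega>, y) \<partial>claim_law))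
      + ((if 0 \<le> Z \<omega> then ennreal (L * h) else 0) + ennreal C) \<partial>M)"
  proof (rule nn_integral_mono)
    fix \<omega> assume \<omega>: "\<omega> \<in> space M"
    show "(if 0 \<le> Z \<omega> then ennreal (F (Z \<omega>)) else 0)
      \<le> ennreal (exp (- \<delta> * h)) * (p {0} * g0 (Z \<omega>, 0) + p {1} * (\<integral>\<^sup>+y. g1 (Z \<omega>, y) \<partial>claim_law))
      + ((if 0 \<le> Z \<omega> then ennreal (L * h) else 0) + ennreal C)"
    proof (cases "0 \<le> Z \<omega>")
      case True
      define z where "z = Z \<omega>"
      have z: "0 \<le> z" "z \<in> A" using True ZA[OF \<omega>] by (auto simp: z_def)
      have Fz: "0 \<le> F (z + c * h)" "0 \<le> conv F z" using z ch by (auto intro: nonneg conv_nonneg F)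
      let ?m = "measure (poisson_pmf (r * h))"
      have "ennreal (F z) \<le> ennreal (exp (- \<delta> * h) * (?m {0} * F (z + c * h) + ?m {1} * conv F z) + (L * h + C))"
        using step[OF z(2)] measure_poisson_0[OF rh] measure_poisson_1[OF rh] by (intro ennreal_leI) simp
      also have "\<dots> = ennreal (exp (- \<delta> * h)) * (ennreal (?m {0}) * ennreal (F (z + c * h)) + ennreal (?m {1}) * ennreal (conv F z)) + (ennreal (L * h) + ennreal C)"
        using Fz L h C by (simp add: ennreal_mult' ennreal_plus)
      also have "\<dots> \<le> ennreal (exp (- \<delta> * h)) * (p {0} * g0 (z, 0) + p {1} * (\<integral>\<^sup>+y. g1 (z, y) \<partial>claim_law)) + (ennreal (L * h) + ennreal C)"
        unfolding p_def using 1[of z] z by (intro add_mono mult_left_mono) (auto simp: g0_def)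
      finally show ?thesis using True by (simp add: z_def)
    qed simp
  qed
  also have "\<dots> = ennreal (exp (- \<delta> * h)) * (p {0} * (\<integral>\<^sup>+\<omega>. g0 (Z \<omega>, 0) \<partial>M) + p {1} * (\<integral>\<^sup>+\<omega>. (\<integral>\<^sup>+y. g1 (Z \<omega>, y) \<partial>claim_law) \<partial>M))
      + ((\<integral>\<^sup>+\<omega>. (if 0 \<le> Z \<omega> then ennreal (L * h) else 0) \<partial>M) + ennreal C)"
    by (simp add: nn_integral_add nn_integral_cmult emeasure_space_1)
  also have "p {0} * (\<integral>\<^sup>+\<omega>. g0 (Z \<omega>, 0) \<partial>M) = (\<integral>\<^sup>+\<omega>. indicator {0} (?D \<omega>) * g0 (Z \<omega>, ?Y \<omega>) \<partial>M)"
    using nn_integral_next_claim[OF t u(1) Z \<open>g0 \<in> _\<close>, of "{0}"] unfolding 0 p_def u(2) by simp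
  also have "p {1} * (\<integral>\<^sup>+\<omega>. (\<integral>\<^sup>+y. g1 (Z \<omega>, y) \<partial>claim_law) \<partial>M) = (\<integral>\<^sup>+\<omega>. indicator {1} (?D \<omega>) * g1 (Z \<omega>, ?Y \<omega>) \<partial>M)"
    using nn_integral_next_claim[OF t u(1) Z \<open>g1 \<in> _\<close>, of "{1}"] unfolding p_def u(2) by simp
  also have "(\<integral>\<^sup>+\<omega>. indicator {0} (?D \<omega>) * g0 (Z \<omega>, ?Y \<omega>) \<partial>M) + (\<integral>\<^sup>+\<omega>. indicator {1} (?D \<omega>) * g1 (Z \<omega>, ?Y \<omega>) \<partial>M)
      = (\<integral>\<^sup>+\<omega>. indicator {0} (?D \<omega>) * g0 (Z \<omega>, ?Y \<omega>) + indicator {1} (?D \<omega>) * g1 (Z \<omega>, ?Y \<omega>) \<partial>M)"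
    by (rule nn_integral_add[symmetric]) measurable
  finally show ?thesis unfolding g0_def g1_def u_def fst_conv snd_conv add.assoc .
qed

end

section \<open>Upper bound for all strategies\<close>

text \<open>Half of the discounting absorbs the linear growth through
  \<open>t \<le> 2 / \<delta> * exp (\<delta> / 2 * t)\<close>; the other half gives a geometric
  series with \<open>h / (1 - q) \<le> 1 + 2 / \<delta>\<close>. So errors of order
  \<open>h\<^sup>2\<close> per step add up to order \<open>h\<close>.\<close>

lemma discounted_linear_sum:
  fixes \<delta> a b h :: real
  assumes "0 < \<delta>" "0 \<le> a" "0 \<le> b" "0 < h" "h \<le> 1"
  shows "(\<Sum>k. ennreal (exp (- \<delta> * (real k * h)) * (h\<^sup>2 * (a + b * (real k * h)))))
    \<le> ennreal (h * ((a + b * (2 / \<delta>)) * (1 + 2 / \<delta>)))"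
proof -
  define q where "q = exp (- \<delta> / 2 * h)"
  have q: "0 < q" "q < 1" unfolding q_def using assms by auto
  have pow: "exp (- \<delta> / 2 * (real k * h)) = q ^ k" for k
    unfolding q_def by (simp add: exp_of_nat_mult[symmetric] mult_ac)
  have le: "exp (- \<delta> * (real k * h)) * (h\<^sup>2 * (a + b * (real k * h))) \<le> h\<^sup>2 * (a + b * (2 / \<delta>)) * q ^ k" for k
  proof -
    define t where "t = real k * h"
    have t: "0 \<le> t" using assms by (simp add: t_def)
    have e1: "1 \<le> exp (\<delta> / 2 * t)" using t assms by simp
    have "\<delta> / 2 * t \<le> exp (\<delta> / 2 * t)" using exp_ge_add_one_self[of "\<delta> / 2 * t"] by linarith
    then have "t \<le> 2 / \<delta> * exp (\<delta> / 2 * t)" using assms by (simp add: field_simps)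
    then have "b * t \<le> b * (2 / \<delta> * exp (\<delta> / 2 * t))" using assms by (intro mult_left_mono)
    moreover have "a * 1 \<le> a * exp (\<delta> / 2 * t)" using e1 assms by (intro mult_left_mono)
    ultimately have "a + b * t \<le> (a + b * (2 / \<delta>)) * exp (\<delta> / 2 * t)" by (simp add: algebra_simps)
    then have "(exp (- \<delta> * t) * h\<^sup>2) * (a + b * t) \<le> (exp (- \<delta> * t) * h\<^sup>2) * ((a + b * (2 / \<delta>)) * exp (\<delta> / 2 * t))"
      by (intro mult_left_mono) auto
    also have "\<dots> = h\<^sup>2 * (a + b * (2 / \<delta>)) * (exp (- \<delta> * t) * exp (\<delta> / 2 * t))" by (simp add: mult_ac)
    also have "exp (- \<delta> * t) * exp (\<delta> / 2 * t) = exp (- \<delta> / 2 * t)" by (simp flip: exp_add)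
    finally show ?thesis unfolding t_def pow by (simp add: mult_ac)
  qed
  have nn: "0 \<le> h\<^sup>2 * (a + b * (2 / \<delta>))" using assms by simp
  have "(\<Sum>k. ennreal (exp (- \<delta> * (real k * h)) * (h\<^sup>2 * (a + b * (real k * h)))))
    \<le> (\<Sum>k. ennreal (h\<^sup>2 * (a + b * (2 / \<delta>)) * q ^ k))"
    by (intro suminf_le ennreal_leI le) auto
  also have "\<dots> = ennreal (h\<^sup>2 * (a + b * (2 / \<delta>)) * (1 / (1 - q)))"
    using q nn by (intro suminf_ennreal_eq sums_mult geometric_sums) auto
  also have "\<dots> \<le> ennreal (h * ((a + b * (2 / \<delta>)) * (1 + 2 / \<delta>)))"
  proof (rule ennreal_leI)
    have "h / (1 - q) \<le> 1 + 2 / \<delta>"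
    proof -
      define m where "m = \<delta> / 2 * h"
      have m: "0 < m" using assms by (simp add: m_def)
      have "(1 + m) * q \<le> exp m * q" using q exp_ge_add_one_self[of m] by (intro mult_right_mono) auto
      also have "\<dots> = 1" unfolding q_def m_def by (simp flip: exp_add)
      finally have "m \<le> (1 + m) * (1 - q)" by (simp add: algebra_simps)
      then have "m / (1 - q) \<le> 1 + m" using q by (simp add: field_simps)
      then have "2 / \<delta> * (m / (1 - q)) \<le> 2 / \<delta> * (1 + m)" using assms by (intro mult_left_mono) auto
      moreover have "2 / \<delta> * m = h" using assms by (simp add: m_def)
      then have "2 / \<delta> * (m / (1 - q)) = h / (1 - q)" by (metis times_divide_eq_right)
      moreover have "2 / \<delta> * (1 + m) = 2 / \<delta> + h"
        unfolding m_def distrib_left using assms by simp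
      ultimately show ?thesis using assms by simp
    qed
    then have "h * (a + b * (2 / \<delta>)) * (h / (1 - q)) \<le> h * (a + b * (2 / \<delta>)) * (1 + 2 / \<delta>)"
      using assms by (intro mult_left_mono) auto
    then show "h\<^sup>2 * (a + b * (2 / \<delta>)) * (1 / (1 - q)) \<le> h * ((a + b * (2 / \<delta>)) * (1 + 2 / \<delta>))"
      by (simp add: power2_eq_square mult_ac)
  qed
  finally show ?thesis .
qed

section \<open>Accounting along an arbitrary strategy, step by step\<close>

context dividend_strategy
begin

lemma D_measurable [measurable]: "0 \<le> t \<Longrightarrow> D t \<in> borel_measurable M"
  using D_adapted measurable_natural_filtration by blast

lemma X_measurable [measurable]: "0 \<le> t \<Longrightarrow> X t \<in> borel_measurable M"
  using X_adapted measurable_natural_filtration by blast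

lemma al_mono: "s \<le> t \<Longrightarrow> al t \<omega> \<Longrightarrow> al s \<omega>"
  by (auto simp: alive_def)

lemma D_const_dead:
  assumes "\<omega> \<in> space M" "0 \<le> s" "s \<le> t" "\<not> al s \<omega>"
  shows "D t \<omega> = D s \<omega>"
proof -
  have "\<tau> \<omega> \<le> ereal s" using less_ruin_time_iff[OF assms(1,2)] assms(4) by simp
  moreover from this have "\<tau> \<omega> \<le> ereal t" using assms(3) by (metis ereal_less_eq(3) order_trans)
  ultimately show ?thesis using D_after_ruin[OF assms(1), of s] D_after_ruin[OF assms(1), of t] assms(2,3) by simp
qed

definition payment :: "real \<Rightarrow> nat \<Rightarrow> 'a \<Rightarrow> real" where
  "payment h k \<omega> = D (real (Suc k) * h) \<omega> - D (real k * h) \<omega>"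

text \<open>Dividends paid within a time step in which ruin occurs. They are not compensated by the value
  function after the step, but their total vanishes as the step size tends to \<open>0\<close>.\<close>

definition ruin_payment :: "real \<Rightarrow> nat \<Rightarrow> 'a \<Rightarrow> real" where
  "ruin_payment h k \<omega> = (if al (real k * h) \<omega> \<and> \<not> al (real (Suc k) * h) \<omega> then payment h k \<omega> else 0)"

definition potential :: "(real \<Rightarrow> real) \<Rightarrow> real \<Rightarrow> 'a \<Rightarrow> real" where
  "potential F t \<omega> = (if al t \<omega> then F (X t \<omega>) else 0)"

lemma grid_le: "0 < h \<Longrightarrow> 0 \<le> real k * h" "0 < h \<Longrightarrow> real k * h \<le> real (Suc k) * h" for h :: real
  by (auto simp: mult_right_mono)

lemma payment_nonneg: "\<omega> \<in> space M \<Longrightarrow> 0 < h \<Longrightarrow> 0 \<le> payment h k \<omega>"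
  unfolding payment_def using D_mono[OF _ grid_le] by (simp del: of_nat_Suc)

lemma payment_measurable [measurable]: "0 < h \<Longrightarrow> payment h k \<in> borel_measurable M"
  unfolding payment_def[abs_def] using grid_le[of h k] order_trans[OF grid_le]
  by (intro borel_measurable_diff D_measurable) auto

lemma al_pred [measurable]: "0 \<le> t \<Longrightarrow> Measurable.pred M (al t)"
  using al_events by (simp add: pred_def)

lemma ruin_payment_measurable [measurable]: "0 < h \<Longrightarrow> ruin_payment h k \<in> borel_measurable M"
  unfolding ruin_payment_def[abs_def]
  by (intro measurable_If payment_measurable borel_measurable_const al_pred[unfolded pred_def]
      sets.sets_Collect_conj sets.sets_Collect_neg al_events grid_le mult_nonneg_nonneg) auto

lemma potential_measurable:
  assumes "F \<in> borel_measurable borel" "0 \<le> t"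
  shows "potential F t \<in> borel_measurable M"
  unfolding potential_def[abs_def]
  by (intro measurable_If borel_measurable_const al_events measurable_compose[OF X_measurable assms(1)] assms(2))

text \<open>All dividends of the step are charged at its end. On survival the surplus without them
  is at least their amount, so \<open>slope\<close> covers them; if ruin occurs in the step they are
  booked as \<open>ruin_payment\<close>; after ruin there are none.\<close>

lemma pathwise_step_upper:
  fixes k :: nat
  assumes \<omega>: "\<omega> \<in> space M" and h: "0 < h"
    and nonneg: "\<And>x. 0 \<le> x \<Longrightarrow> 0 \<le> F x"
    and slope: "\<And>x d. 0 \<le> d \<Longrightarrow> d \<le> x \<Longrightarrow> F (x - d) + d \<le> F x"
  defines "t \<equiv> real k * h"
  shows "potential F (t + h) \<omega> + payment h k \<omega>
    \<le> (if al t \<omega> \<and> 0 \<le> X t \<omega> + c * h - (S (t + h) \<omega> - S t \<omega>) then F (X t \<omega> + c * h - (S (t + h) \<omega> - S t \<omega>)) else 0)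
      + ruin_payment h k \<omega>"
proof -
  have t: "0 \<le> t" "real (Suc k) * h = t + h" using h by (auto simp: t_def algebra_simps)
  define x where "x = X t \<omega> + c * h - (S (t + h) \<omega> - S t \<omega>)"
  have d: "0 \<le> payment h k \<omega>" by (rule payment_nonneg[OF \<omega> h])
  have X: "X (t + h) \<omega> = x - payment h k \<omega>"
    unfolding X_eq x_def payment_def t(2) t_def[symmetric] by (simp add: algebra_simps)
  have rp: "ruin_payment h k \<omega> = (if al t \<omega> \<and> \<not> al (t + h) \<omega> then payment h k \<omega> else 0)"
    unfolding ruin_payment_def t(2) t_def ..
  show ?thesis
  proof (cases "al (t + h) \<omega>")
    case True
    then have "al t \<omega>" using al_mono[of t "t + h"] h by simp
    moreover have "0 \<le> X (t + h) \<omega>" using True t h by (simp add: alive_def)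
    ultimately have "potential F (t + h) \<omega> + payment h k \<omega> \<le> F x" "0 \<le> x" "al t \<omega>"
      using slope[OF d, of x] X d True by (auto simp: potential_def)
    then show ?thesis using True by (simp add: x_def rp)
  next
    case False
    show ?thesis
    proof (cases "al t \<omega>")
      case True
      then show ?thesis using False nonneg by (simp add: potential_def rp)
    next
      case F: False
      have "payment h k \<omega> = 0"
        unfolding payment_def t(2) using D_const_dead[OF \<omega> t(1) _ F, of "t + h"] h by (simp add: t_def)
      then show ?thesis using False F by (simp add: potential_def rp)
    qed
  qed
qed

lemma X_le: "\<omega> \<in> space M \<Longrightarrow> \<forall>i\<ge>1. 0 \<le> Y i \<omega> \<Longrightarrow> 0 \<le> t \<Longrightarrow> X t \<omega> \<le> x0 + c * t"
  using S_mono[of \<omega> 0 t] S_0[of \<omega>] D_nonneg[of \<omega> t] by (simp add: X_eq)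

lemma step_upper:
  fixes k :: nat
  assumes F: "continuous_on {0..} F" and Fm[measurable]: "F \<in> borel_measurable borel"
    and nonneg: "\<And>x. 0 \<le> x \<Longrightarrow> 0 \<le> F x" and mono: "\<And>x y. 0 \<le> x \<Longrightarrow> x \<le> y \<Longrightarrow> F x \<le> F y"
    and slope: "\<And>x d. 0 \<le> d \<Longrightarrow> d \<le> x \<Longrightarrow> F (x - d) + d \<le> F x"
    and step: "\<And>x. 0 \<le> x \<Longrightarrow> exp (- \<delta> * h) * (exp (- r * h) * F (x + c * h)
      + r * h * exp (- r * h) * conv F (x + c * h) + (r * h)\<^sup>2 * F (x + c * h)) + L * h \<le> F x + C * h\<^sup>2 * (1 + x)"
    and h: "0 < h" and L: "0 \<le> L" and C: "0 \<le> C"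
  defines "t \<equiv> real k * h"
  shows "ennreal (exp (- \<delta> * h)) * ((\<integral>\<^sup>+\<omega>. ennreal (potential F (t + h) \<omega>) \<partial>M) + (\<integral>\<^sup>+\<omega>. ennreal (payment h k \<omega>) \<partial>M))
      + (\<integral>\<^sup>+\<omega>. (if al t \<omega> then ennreal (L * h) else 0) \<partial>M)
    \<le> (\<integral>\<^sup>+\<omega>. ennreal (potential F t \<omega>) \<partial>M) + ennreal (h\<^sup>2 * (C * (1 + x0) + C * c * t))
      + ennreal (exp (- \<delta> * h)) * (\<integral>\<^sup>+\<omega>. ennreal (ruin_payment h k \<omega>) \<partial>M)"
proof -
  have t: "0 \<le> t" "0 \<le> t + h" using h by (auto simp: t_def)
  \<comment> \<open>The value -1 encodes ruin, so that one adapted real variable carries both the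
    surplus and the survival flag.\<close>
  define Z where "Z \<omega> = (if al t \<omega> then X t \<omega> else -1)" for \<omega>
  have Zm: "Z \<in> borel_measurable (filtration t)"
    unfolding Z_def[abs_def]
    by (intro measurable_If X_adapted[OF t(1)] borel_measurable_const) (use al_sets[OF t(1)] in \<open>simp add: space_natural_filtration\<close>)
  have Z0: "0 \<le> Z \<omega> \<longleftrightarrow> al t \<omega>" for \<omega> using t by (auto simp: Z_def alive_def)
  have X0: "0 \<le> X t \<omega>" if "al t \<omega>" for \<omega> using that t by (auto simp: alive_def)
  have [measurable]: "potential F t \<in> borel_measurable M" "potential F (t + h) \<in> borel_measurable M" "X t \<in> borel_measurable M"
    "S t \<in> borel_measurable M" "S (t + h) \<in> borel_measurable M"
    using t h Fm by (auto intro: potential_measurable)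
  have [measurable]: "Measurable.pred M (al t)" using al_pred[OF t(1)] .
  have [measurable]: "payment h k \<in> borel_measurable M" "ruin_payment h k \<in> borel_measurable M" using h by auto
  have pn: "0 \<le> potential F s \<omega>" if "0 \<le> s" for s \<omega>
    using that by (auto simp: potential_def alive_def intro!: nonneg)
  define G where "G \<omega> = (if 0 \<le> Z \<omega> \<and> 0 \<le> Z \<omega> + c * h - (S (t + h) \<omega> - S t \<omega>)
        then ennreal (F (Z \<omega> + c * h - (S (t + h) \<omega> - S t \<omega>))) else 0)" for \<omega>
  have [measurable]: "Z \<in> borel_measurable M" using Zm by (rule measurable_natural_filtration)
  have [measurable]: "G \<in> borel_measurable M" unfolding G_def by measurable
  have "(\<integral>\<^sup>+\<omega>. ennreal (potential F (t + h) \<omega>) \<partial>M) + (\<integral>\<^sup>+\<omega>. ennreal (payment h k \<omega>) \<partial>M)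
    = (\<integral>\<^sup>+\<omega>. ennreal (potential F (t + h) \<omega>) + ennreal (payment h k \<omega>) \<partial>M)"
    by (rule nn_integral_add[symmetric]) measurable
  also have "\<dots> \<le> (\<integral>\<^sup>+\<omega>. G \<omega> + ennreal (ruin_payment h k \<omega>) \<partial>M)"
  proof (rule nn_integral_mono)
    fix \<omega> assume \<omega>: "\<omega> \<in> space M"
    define g where "g = (if al t \<omega> \<and> 0 \<le> X t \<omega> + c * h - (S (t + h) \<omega> - S t \<omega>) then F (X t \<omega> + c * h - (S (t + h) \<omega> - S t \<omega>)) else 0)"
    have g: "0 \<le> g" "ennreal g = G \<omega>" unfolding g_def G_def Z0 by (auto simp: Z_def intro: nonneg)
    have p: "0 \<le> payment h k \<omega>" using payment_nonneg[OF \<omega> h] .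
    have rp: "0 \<le> ruin_payment h k \<omega>" unfolding ruin_payment_def using p by simp
    have "potential F (t + h) \<omega> + payment h k \<omega> \<le> g + ruin_payment h k \<omega>"
      unfolding g_def t_def using pathwise_step_upper[OF \<omega> h nonneg slope] by simp
    then have "ennreal (potential F (t + h) \<omega> + payment h k \<omega>) \<le> ennreal (g + ruin_payment h k \<omega>)" by (rule ennreal_leI)
    then show "ennreal (potential F (t + h) \<omega>) + ennreal (payment h k \<omega>) \<le> G \<omega> + ennreal (ruin_payment h k \<omega>)"
      using g rp p pn[OF t(2)] by (simp add: ennreal_plus)
  qed
  also have "\<dots> = (\<integral>\<^sup>+\<omega>. G \<omega> \<partial>M) + (\<integral>\<^sup>+\<omega>. ennreal (ruin_payment h k \<omega>) \<partial>M)"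
    by (rule nn_integral_add) measurable
  finally have 1: "(\<integral>\<^sup>+\<omega>. ennreal (potential F (t + h) \<omega>) \<partial>M) + (\<integral>\<^sup>+\<omega>. ennreal (payment h k \<omega>) \<partial>M)
    \<le> (\<integral>\<^sup>+\<omega>. G \<omega> \<partial>M) + (\<integral>\<^sup>+\<omega>. ennreal (ruin_payment h k \<omega>) \<partial>M)" .
  have "ennreal (exp (- \<delta> * h)) * (\<integral>\<^sup>+\<omega>. G \<omega> \<partial>M) + (\<integral>\<^sup>+\<omega>. (if 0 \<le> Z \<omega> then ennreal (L * h) else 0) \<partial>M)
    \<le> (\<integral>\<^sup>+\<omega>. (if 0 \<le> Z \<omega> then ennreal (F (Z \<omega>)) + ennreal (C * h\<^sup>2 * (1 + Z \<omega>)) else 0) \<partial>M)"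
    unfolding G_def
    by (rule one_step_expectation_upper[OF F Fm nonneg mono step t(1) h L Zm]) (use C in auto)
  also have "\<dots> \<le> (\<integral>\<^sup>+\<omega>. ennreal (potential F t \<omega>) + ennreal (h\<^sup>2 * (C * (1 + x0) + C * c * t)) \<partial>M)"
  proof (rule nn_integral_mono_AE, rule AE_mp[OF AE_claims_nonneg], rule AE_I2, rule impI)
    fix \<omega> assume \<omega>: "\<omega> \<in> space M" "\<forall>i\<ge>1. 0 \<le> Y i \<omega>"
    \<comment> \<open>Only premiums raise the surplus, which makes the linearly growing error
      deterministic.\<close>
    have "C * h\<^sup>2 * (1 + X t \<omega>) \<le> C * h\<^sup>2 * (1 + (x0 + c * t))"
      using X_le[OF \<omega> t(1)] C by (intro mult_left_mono) auto
    also have "\<dots> = h\<^sup>2 * (C * (1 + x0) + C * c * t)" by (simp add: algebra_simps)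
    finally show "(if 0 \<le> Z \<omega> then ennreal (F (Z \<omega>)) + ennreal (C * h\<^sup>2 * (1 + Z \<omega>)) else 0)
      \<le> ennreal (potential F t \<omega>) + ennreal (h\<^sup>2 * (C * (1 + x0) + C * c * t))"
      unfolding Z0 by (auto simp: Z_def potential_def intro!: add_mono ennreal_leI)
  qed
  also have "\<dots> = (\<integral>\<^sup>+\<omega>. ennreal (potential F t \<omega>) \<partial>M) + ennreal (h\<^sup>2 * (C * (1 + x0) + C * c * t))"
    by (simp add: nn_integral_add emeasure_space_1)
  finally have 2: "ennreal (exp (- \<delta> * h)) * (\<integral>\<^sup>+\<omega>. G \<omega> \<partial>M) + (\<integral>\<^sup>+\<omega>. (if al t \<omega> then ennreal (L * h) else 0) \<partial>M)
    \<le> (\<integral>\<^sup>+\<omega>. ennreal (potential F t \<omega>) \<partial>M) + ennreal (h\<^sup>2 * (C * (1 + x0) + C * c * t))"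
    unfolding Z0 .
  have "ennreal (exp (- \<delta> * h)) * ((\<integral>\<^sup>+\<omega>. ennreal (potential F (t + h) \<omega>) \<partial>M) + (\<integral>\<^sup>+\<omega>. ennreal (payment h k \<omega>) \<partial>M))
      + (\<integral>\<^sup>+\<omega>. (if al t \<omega> then ennreal (L * h) else 0) \<partial>M)
    \<le> ennreal (exp (- \<delta> * h)) * ((\<integral>\<^sup>+\<omega>. G \<omega> \<partial>M) + (\<integral>\<^sup>+\<omega>. ennreal (ruin_payment h k \<omega>) \<partial>M))
      + (\<integral>\<^sup>+\<omega>. (if al t \<omega> then ennreal (L * h) else 0) \<partial>M)"
    by (rule add_mono[OF mult_left_mono[OF 1] order_refl]) simp
  also have "\<dots> = (ennreal (exp (- \<delta> * h)) * (\<integral>\<^sup>+\<omega>. G \<omega> \<partial>M) + (\<integral>\<^sup>+\<omega>. (if al t \<omega> then ennreal (L * h) else 0) \<partial>M))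
      + ennreal (exp (- \<delta> * h)) * (\<integral>\<^sup>+\<omega>. ennreal (ruin_payment h k \<omega>) \<partial>M)"
    by (simp add: distrib_left add_ac)
  also have "\<dots> \<le> (\<integral>\<^sup>+\<omega>. ennreal (potential F t \<omega>) \<partial>M) + ennreal (h\<^sup>2 * (C * (1 + x0) + C * c * t))
      + ennreal (exp (- \<delta> * h)) * (\<integral>\<^sup>+\<omega>. ennreal (ruin_payment h k \<omega>) \<partial>M)"
    by (rule add_mono[OF 2 order_refl])
  finally show ?thesis .
qed


lemma ruin_time_eq_top_or_real: "\<tau> \<omega> = \<infinity> \<or> (\<exists>u. \<tau> \<omega> = ereal u)"
  using ruin_time_nonneg[of \<omega>] by (cases "\<tau> \<omega>") auto

lemma D_le: "0 \<le> t \<Longrightarrow> al t \<omega> \<Longrightarrow> D t \<omega> \<le> x0 + c * t - S t \<omega>"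
  by (auto simp: alive_def X_eq)

text \<open>Only the cell containing the ruin time contributes. Its left end is later than the ruin
  time minus \<open>h\<close>, and dividends stop at ruin, so its payment is at most the increase of
  the dividends over the last \<open>h\<close> units of time before ruin.\<close>

lemma ruin_payment_total:
  assumes \<omega>: "\<omega> \<in> space M" and h: "0 < h"
  shows "(\<Sum>k. ennreal (exp (- \<delta> * (real (Suc k) * h))) * ennreal (ruin_payment h k \<omega>))
    \<le> (if \<tau> \<omega> = \<infinity> then 0 else ennreal (exp (- \<delta> * real_of_ereal (\<tau> \<omega>))
        * (D (real_of_ereal (\<tau> \<omega>)) \<omega> - D (max 0 (real_of_ereal (\<tau> \<omega>) - h)) \<omega>)))"
proof (cases "\<tau> \<omega> = \<infinity>")
  case True
  have "al t \<omega>" if "0 \<le> t" for t using less_ruin_time_iff[OF \<omega> that] True by simp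
  then have "ruin_payment h k \<omega> = 0" for k
    using grid_le(1)[OF h, of "Suc k"] by (simp add: ruin_payment_def del: of_nat_Suc)
  then show ?thesis using True by simp
next
  case False
  then obtain u where u: "\<tau> \<omega> = ereal u" using ruin_time_eq_top_or_real by blast
  have al: "al t \<omega> \<longleftrightarrow> t < u" if "0 \<le> t" for t using less_ruin_time_iff[OF \<omega> that] u by simp
  have upos: "0 < u" using X_ruin(2)[OF \<omega> u] .
  define b where "b = ennreal (exp (- \<delta> * u) * (D u \<omega> - D (max 0 (u - h)) \<omega>))"
  let ?f = "\<lambda>k. ennreal (exp (- \<delta> * (real (Suc k) * h))) * ennreal (ruin_payment h k \<omega>)"
  have le: "?f k \<le> b" for k
  proof (cases "real k * h < u \<and> u \<le> real (Suc k) * h")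
    case True
    let ?s = "real k * h" and ?t = "real (Suc k) * h"
    have st: "0 \<le> ?s" "?t = ?s + h" using h by (auto simp: algebra_simps)
    have "D ?t \<omega> = D u \<omega>"
      using D_after_ruin[OF \<omega>, of ?t] u True st h by simp
    moreover have "D (max 0 (u - h)) \<omega> \<le> D ?s \<omega>"
      using True st by (intro D_mono[OF \<omega>]) auto
    ultimately have 1: "ruin_payment h k \<omega> \<le> D u \<omega> - D (max 0 (u - h)) \<omega>"
      "0 \<le> D u \<omega> - D (max 0 (u - h)) \<omega>"
      using D_mono[OF \<omega>, of "max 0 (u - h)" u] upos h by (auto simp: ruin_payment_def payment_def)
    have "exp (- \<delta> * ?t) \<le> exp (- \<delta> * u)" using True \<delta>_pos by simp
    then have "exp (- \<delta> * ?t) * ruin_payment h k \<omega> \<le> exp (- \<delta> * u) * (D u \<omega> - D (max 0 (u - h)) \<omega>)"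
      using 1 payment_nonneg[OF \<omega> h] by (intro mult_mono) (auto simp: ruin_payment_def)
    then show ?thesis unfolding b_def by (subst ennreal_mult'[symmetric]) (auto intro: ennreal_leI)
  next
    case F: False
    then have "ruin_payment h k \<omega> = 0"
      using al[OF grid_le(1)[OF h, of k]] al[OF grid_le(1)[OF h, of "Suc k"]]
      by (auto simp: ruin_payment_def)
    then show ?thesis by simp
  qed
  \<comment> \<open>Index of the cell \<open>{k0 * h<..(k0 + 1) * h}\<close> containing
    \<open>u\<close>; the ceiling minus 1 reflects that cells are closed on the right.\<close>
  define k0 where "k0 = nat (\<lceil>u / h\<rceil> - 1)"
  have zero: "?f k = 0" if "k \<noteq> k0" for k
  proof (rule ccontr)
    assume "?f k \<noteq> 0"
    then have "real k * h < u" "u \<le> real (Suc k) * h"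
      using al[OF grid_le(1)[OF h, of k]] al[OF grid_le(1)[OF h, of "Suc k"]]
      by (auto simp: ruin_payment_def split: if_splits)
    then have "real k < u / h" "u / h \<le> real k + 1" using h by (auto simp: field_simps)
    then have "\<lceil>u / h\<rceil> = int k + 1" by (intro ceiling_unique) auto
    then show False using that by (simp add: k0_def)
  qed
  have "(\<Sum>k. ?f k) = ?f k0" using suminf_finite[of "{k0}" ?f] zero by simp
  also have "\<dots> \<le> b" by (rule le)
  finally show ?thesis using u by (simp add: b_def)
qed

text \<open>Before ruin the dividends are at most \<open>x0 + c * s\<close>, and they do not jump at
  ruin, so the bound persists; discounting makes it uniform in the ruin time. This is the dominating
  constant for the following limit.\<close>

lemma discounted_D_ruin_le:
  assumes \<omega>: "\<omega> \<in> space M" "\<forall>i\<ge>1. 0 \<le> Y i \<omega>" and u: "\<tau> \<omega> = ereal u"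
  shows "exp (- \<delta> * u) * D u \<omega> \<le> x0 + c / \<delta>"
proof -
  note ru = X_ruin[OF \<omega>(1) u]
  have "D u \<omega> \<le> x0 + c * u"
    unfolding ru(3)[symmetric]
  proof (rule tendsto_upperbound[OF tendsto_D_left[OF \<omega>(1) ru(2)]])
    show "eventually (\<lambda>s. D s \<omega> \<le> x0 + c * u) (at_left u)"
      unfolding eventually_at_left_field
    proof (intro exI[of _ 0] conjI allI impI ru(2))
      fix s assume s: "0 < s" "s < u"
      then have "al s \<omega>" using less_ruin_time_iff[OF \<omega>(1), of s] u by simp
      then have "D s \<omega> \<le> x0 + c * s - S s \<omega>" using s by (intro D_le) auto
      moreover have "0 \<le> S s \<omega>" using S_mono[OF \<omega>(1), of 0 s] \<omega>(2) S_0[OF \<omega>(1)] s by simp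
      moreover have "c * s \<le> c * u" using s c_pos by simp
      ultimately show "D s \<omega> \<le> x0 + c * u" by simp
    qed
  qed simp
  then have "exp (- \<delta> * u) * D u \<omega> \<le> exp (- \<delta> * u) * (x0 + c * u)" by (intro mult_left_mono) auto
  also have "\<dots> = exp (- \<delta> * u) * x0 + c / \<delta> * (\<delta> * u * exp (- \<delta> * u))" using \<delta>_pos by (simp add: algebra_simps)
  also have "\<dots> \<le> 1 * x0 + c / \<delta> * 1"
  proof (intro add_mono mult_right_mono mult_left_mono)
    show "exp (- \<delta> * u) \<le> 1" using ru(2) \<delta>_pos by simp
    have "\<delta> * u \<le> exp (\<delta> * u)" using exp_ge_add_one_self[of "\<delta> * u"] by linarith
    then have "\<delta> * u * exp (- \<delta> * u) \<le> exp (\<delta> * u) * exp (- \<delta> * u)" by (intro mult_right_mono) auto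
    then show "\<delta> * u * exp (- \<delta> * u) \<le> 1" by (simp flip: exp_add)
  qed (use x0_nonneg c_pos \<delta>_pos in auto)
  finally show ?thesis by simp
qed

lemma discounted_time_measurable: "(\<lambda>\<omega>. discounted_time \<delta> (\<tau> \<omega>)) \<in> borel_measurable M"
  unfolding discounted_time_def
proof (rule lborel.borel_measurable_nn_integral)
  have "indicator {s. 0 \<le> s \<and> ereal s \<le> \<tau> \<omega>} s = (if 0 \<le> s \<and> ereal s \<le> \<tau> \<omega> then 1 else 0 :: ennreal)" for s \<omega>
    by (simp add: indicator_def)
  then show "(\<lambda>(\<omega>, s). ennreal (exp (- \<delta> * s)) * indicator {s. 0 \<le> s \<and> ereal s \<le> \<tau> \<omega>} s) \<in> borel_measurable (M \<Otimes>\<^sub>M lborel)"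
    by simp
qed

text \<open>Pointwise the terms vanish because the dividend path is left-continuous at the ruin
  time: this is where it matters that payments do not cause ruin.\<close>

lemma tendsto_ruin_payment_total:
  "(\<lambda>m. \<integral>\<^sup>+\<omega>. (\<Sum>k. ennreal (exp (- \<delta> * (real (Suc k) * (1 / real (Suc m))))) * ennreal (ruin_payment (1 / real (Suc m)) k \<omega>)) \<partial>M)
    \<longlonglongrightarrow> 0"
proof -
  define U where "U m \<omega> = (\<Sum>k. ennreal (exp (- \<delta> * (real (Suc k) * (1 / real (Suc m))))) * ennreal (ruin_payment (1 / real (Suc m)) k \<omega>))" for m \<omega>
  define h where "h m = 1 / real (Suc m)" for m
  have h: "0 < h m" for m by (simp add: h_def)
  have bound: "U m \<omega> \<le> (if \<tau> \<omega> = \<infinity> then 0 else ennreal (exp (- \<delta> * real_of_ereal (\<tau> \<omega>))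
        * (D (real_of_ereal (\<tau> \<omega>)) \<omega> - D (max 0 (real_of_ereal (\<tau> \<omega>) - h m)) \<omega>)))" if "\<omega> \<in> space M" for m \<omega>
    unfolding U_def h_def by (rule ruin_payment_total[OF that]) simp
  have [measurable]: "U m \<in> borel_measurable M" for m
    unfolding U_def[abs_def] by measurable
  have "(\<lambda>m. \<integral>\<^sup>+\<omega>. U m \<omega> \<partial>M) \<longlonglongrightarrow> (\<integral>\<^sup>+\<omega>. 0 \<partial>M)"
  proof (rule nn_integral_dominated_convergence[where w = "\<lambda>_. ennreal (x0 + c / \<delta>)"])
    show "AE \<omega> in M. U m \<omega> \<le> ennreal (x0 + c / \<delta>)" for m
      using AE_claims_nonneg
    proof (rule AE_mp, intro AE_I2 impI)
      fix \<omega> assume \<omega>: "\<omega> \<in> space M" "\<forall>i\<ge>1. 0 \<le> Y i \<omega>"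
      show "U m \<omega> \<le> ennreal (x0 + c / \<delta>)"
      proof (cases "\<tau> \<omega> = \<infinity>")
        case True then show ?thesis using bound[OF \<omega>(1), of m] by simp
      next
        case False
        then obtain u where u: "\<tau> \<omega> = ereal u" using ruin_time_eq_top_or_real by blast
        have "exp (- \<delta> * u) * (D u \<omega> - D (max 0 (u - h m)) \<omega>) \<le> exp (- \<delta> * u) * D u \<omega>"
          using D_nonneg[OF \<omega>(1), of "max 0 (u - h m)"] by (intro mult_left_mono) auto
        also have "\<dots> \<le> x0 + c / \<delta>" by (rule discounted_D_ruin_le[OF \<omega> u])
        finally show ?thesis using bound[OF \<omega>(1), of m] u by (auto intro: order_trans ennreal_leI)
      qed
    qed
    show "AE \<omega> in M. (\<lambda>m. U m \<omega>) \<longlonglongrightarrow> 0"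
    proof (rule AE_I2)
      fix \<omega> assume \<omega>: "\<omega> \<in> space M"
      show "(\<lambda>m. U m \<omega>) \<longlonglongrightarrow> 0"
      proof (cases "\<tau> \<omega> = \<infinity>")
        case True
        then have "U m \<omega> = 0" for m using bound[OF \<omega>, of m] by simp
        then show ?thesis by simp
      next
        case False
        then obtain u where u: "\<tau> \<omega> = ereal u" using ruin_time_eq_top_or_real by blast
        note ru = X_ruin[OF \<omega> u]
        have "filterlim (\<lambda>m. max 0 (u - h m)) (at_left u) sequentially"
        proof (rule tendsto_imp_filterlim_at_left)
          have "(\<lambda>m. max 0 (u - h m)) \<longlonglongrightarrow> max 0 (u - 0)"
            unfolding h_def by (intro tendsto_intros lim_1_over_n[THEN LIMSEQ_Suc])
          then show "(\<lambda>m. max 0 (u - h m)) \<longlonglongrightarrow> u" using ru(2) by simp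
          show "eventually (\<lambda>m. max 0 (u - h m) < u) sequentially"
            using ru(2) h by (intro always_eventually) auto
        qed
        from filterlim_compose[OF tendsto_D_left[OF \<omega> ru(2)] this]
        have "(\<lambda>m. D (max 0 (u - h m)) \<omega>) \<longlonglongrightarrow> D u \<omega>" unfolding ru(3) .
        then have "(\<lambda>m. ennreal (exp (- \<delta> * u) * (D u \<omega> - D (max 0 (u - h m)) \<omega>))) \<longlonglongrightarrow> ennreal (exp (- \<delta> * u) * (D u \<omega> - D u \<omega>))"
          by (intro tendsto_intros)
        then have lim: "(\<lambda>m. ennreal (exp (- \<delta> * u) * (D u \<omega> - D (max 0 (u - h m)) \<omega>))) \<longlonglongrightarrow> 0" by simp
        show ?thesis
          by (rule tendsto_sandwich[OF _ _ tendsto_const lim]) (use bound[OF \<omega>] u in auto)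
      qed
    qed
  qed (auto simp: emeasure_space_1 ennreal_mult_less_top)
  then show ?thesis unfolding U_def by simp
qed

text \<open>The step inequalities are multiplied by the discount factors and summed; the potential
  telescopes and its last value is dropped as nonnegative. The limit is taken along
  \<open>h = 1 / real (Suc m)\<close>.\<close>

lemma value_upper_bound:
  assumes F: "continuous_on {0..} F" and Fm[measurable]: "F \<in> borel_measurable borel"
    and nonneg: "\<And>x. 0 \<le> x \<Longrightarrow> 0 \<le> F x" and mono: "\<And>x y. 0 \<le> x \<Longrightarrow> x \<le> y \<Longrightarrow> F x \<le> F y"
    and slope: "\<And>x d. 0 \<le> d \<Longrightarrow> d \<le> x \<Longrightarrow> F (x - d) + d \<le> F x"
    and step: "\<And>x h. 0 \<le> x \<Longrightarrow> 0 \<le> h \<Longrightarrow> h \<le> 1 \<Longrightarrow> exp (- \<delta> * h) * (exp (- r * h) * F (x + c * h)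
      + r * h * exp (- r * h) * conv F (x + c * h) + (r * h)\<^sup>2 * F (x + c * h)) + L * h \<le> F x + C * h\<^sup>2 * (1 + x)"
    and L: "0 \<le> L" and C: "0 \<le> C"
  shows "(\<integral>\<^sup>+\<omega>. discounted_dividends \<delta> (\<lambda>t. D t \<omega>) (\<tau> \<omega>) + ennreal L * discounted_time \<delta> (\<tau> \<omega>) \<partial>M) \<le> ennreal (F x0)"
proof -
  define Q where "Q = (\<integral>\<^sup>+\<omega>. discounted_dividends \<delta> (\<lambda>t. D t \<omega>) (\<tau> \<omega>) + ennreal L * discounted_time \<delta> (\<tau> \<omega>) \<partial>M)"
  define C' where "C' = (C * (1 + x0) + C * c * (2 / \<delta>)) * (1 + 2 / \<delta>)"
  define E where "E h = (\<integral>\<^sup>+\<omega>. (\<Sum>k. ennreal (exp (- \<delta> * (real (Suc k) * h))) * ennreal (ruin_payment h k \<omega>)) \<partial>M)" for h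
  have main: "Q \<le> ennreal (exp (\<delta> * h)) * (ennreal (F x0) + ennreal (h * C') + E h)" if h: "0 < h" "h \<le> 1" for h
  proof -
    define \<beta> where "\<beta> = exp (- \<delta> * h)"
    define w where "w k = exp (- \<delta> * (real k * h))" for k
    have w: "w (Suc k) = w k * \<beta>" "0 < w k" "w 0 = 1" for k
      unfolding w_def \<beta>_def by (auto simp: algebra_simps simp flip: exp_add)
    \<comment> \<open>The recursion discounts the payments of a step at its right end, the pathwise
      upper bound at its left end; the mismatch is a factor that tends to 1.\<close>
    have Eb: "exp (\<delta> * h) * w (Suc k) = w k" for k
      unfolding w_def by (simp add: algebra_simps flip: exp_add)
    define a where "a k = (\<integral>\<^sup>+\<omega>. ennreal (potential F (real k * h) \<omega>) \<partial>M)" for k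
    define p where "p k = (\<integral>\<^sup>+\<omega>. ennreal (payment h k \<omega>) \<partial>M)" for k
    define e where "e k = (\<integral>\<^sup>+\<omega>. ennreal (ruin_payment h k \<omega>) \<partial>M)" for k
    define l where "l k = (\<integral>\<^sup>+\<omega>. (if al (real k * h) \<omega> then ennreal (L * h) else 0) \<partial>M)" for k
    define q where "q k = ennreal (h\<^sup>2 * (C * (1 + x0) + C * c * (real k * h)))" for k
    have [measurable]: "payment h k \<in> borel_measurable M" "ruin_payment h k \<in> borel_measurable M"
      "Measurable.pred M (al (real k * h))" "D (real k * h) \<in> borel_measurable M" "D 0 \<in> borel_measurable M" for k
      using h grid_le(1)[OF h(1)] by (auto intro: al_pred)
    have st: "ennreal \<beta> * (a (Suc k) + p k) + l k \<le> a k + q k + ennreal \<beta> * e k" for k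
    proof -
      have "real (Suc k) * h = real k * h + h" by (simp add: algebra_simps)
      then show ?thesis
        unfolding a_def p_def e_def l_def q_def \<beta>_def
        using step_upper[OF F Fm nonneg mono slope step h(1) L C, of k] h by simp
    qed
    have ind: "ennreal (w n) * a n + (\<Sum>k<n. ennreal (w (Suc k)) * p k + ennreal (w k) * l k)
      \<le> a 0 + (\<Sum>k<n. ennreal (w k) * q k + ennreal (w (Suc k)) * e k)" for n
    proof (induction n)
      case 0 then show ?case by (simp add: w)
    next
      case (Suc n)
      have "ennreal (w n) * (ennreal \<beta> * (a (Suc n) + p n) + l n) \<le> ennreal (w n) * (a n + q n + ennreal \<beta> * e n)"
        by (rule mult_left_mono[OF st]) simp
      moreover have "ennreal (w n) * (ennreal \<beta> * y) = ennreal (w (Suc n)) * y" for y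
        using w(2)[of n] by (simp add: w(1) ennreal_mult'' ennreal_mult' mult.assoc \<beta>_def)
      ultimately have s: "ennreal (w (Suc n)) * a (Suc n) + (ennreal (w (Suc n)) * p n + ennreal (w n) * l n)
        \<le> ennreal (w n) * a n + (ennreal (w n) * q n + ennreal (w (Suc n)) * e n)"
        by (simp add: distrib_left add.assoc)
      have "ennreal (w (Suc n)) * a (Suc n) + (\<Sum>k<Suc n. ennreal (w (Suc k)) * p k + ennreal (w k) * l k)
        = (ennreal (w (Suc n)) * a (Suc n) + (ennreal (w (Suc n)) * p n + ennreal (w n) * l n))
          + (\<Sum>k<n. ennreal (w (Suc k)) * p k + ennreal (w k) * l k)" by (simp add: add_ac)
      also have "\<dots> \<le> (ennreal (w n) * a n + (ennreal (w n) * q n + ennreal (w (Suc n)) * e n))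
          + (\<Sum>k<n. ennreal (w (Suc k)) * p k + ennreal (w k) * l k)"
        by (rule add_right_mono[OF s])
      also have "\<dots> = (ennreal (w n) * a n + (\<Sum>k<n. ennreal (w (Suc k)) * p k + ennreal (w k) * l k))
          + (ennreal (w n) * q n + ennreal (w (Suc n)) * e n)" by (simp add: add_ac)
      also have "\<dots> \<le> (a 0 + (\<Sum>k<n. ennreal (w k) * q k + ennreal (w (Suc k)) * e k)) + (ennreal (w n) * q n + ennreal (w (Suc n)) * e n)"
        by (rule add_right_mono[OF Suc.IH])
      finally show ?case by (simp add: add_ac)
    qed
    have sum_qe: "(\<Sum>k. ennreal (w k) * q k + ennreal (w (Suc k)) * e k) \<le> ennreal (h * C') + E h"
    proof -
      have "(\<Sum>k. ennreal (w k) * q k + ennreal (w (Suc k)) * e k) = (\<Sum>k. ennreal (w k) * q k) + (\<Sum>k. ennreal (w (Suc k)) * e k)"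
        by (intro suminf_add[symmetric]) auto
      also have "(\<Sum>k. ennreal (w k) * q k) = (\<Sum>k. ennreal (exp (- \<delta> * (real k * h)) * (h\<^sup>2 * (C * (1 + x0) + C * c * (real k * h)))))"
        unfolding q_def w_def by (simp add: ennreal_mult')
      also have "\<dots> \<le> ennreal (h * C')" unfolding C'_def
        using \<delta>_pos c_pos C x0_nonneg h by (intro discounted_linear_sum) auto
      also have "(\<Sum>k. ennreal (w (Suc k)) * e k) = E h"
        unfolding E_def e_def w_def by (subst nn_integral_suminf) (auto intro!: suminf_cong nn_integral_cmult[symmetric])
      finally show ?thesis by (simp add: add_right_mono)
    qed
    have total: "(\<Sum>k. ennreal (w (Suc k)) * p k + ennreal (w k) * l k) \<le> a 0 + (ennreal (h * C') + E h)"
    proof (rule suminf_le_const)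
      show "summable (\<lambda>k. ennreal (w (Suc k)) * p k + ennreal (w k) * l k)" by simp
      fix n
      have "(\<Sum>k<n. ennreal (w (Suc k)) * p k + ennreal (w k) * l k)
        \<le> ennreal (w n) * a n + (\<Sum>k<n. ennreal (w (Suc k)) * p k + ennreal (w k) * l k)"
        by (rule add_increasing) auto
      also note ind[of n]
      also have "(\<Sum>k<n. ennreal (w k) * q k + ennreal (w (Suc k)) * e k) \<le> (\<Sum>k. ennreal (w k) * q k + ennreal (w (Suc k)) * e k)"
        by (rule sum_le_suminf) auto
      also note sum_qe
      finally show "(\<Sum>k<n. ennreal (w (Suc k)) * p k + ennreal (w k) * l k) \<le> a 0 + (ennreal (h * C') + E h)"
        by (simp add: add_left_mono)
    qed
    \<comment> \<open>The lump payment at time 0 precedes the first step and is covered by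
      \<open>slope\<close> from \<open>x0\<close>.\<close>
    have start: "(\<integral>\<^sup>+\<omega>. ennreal (D 0 \<omega>) \<partial>M) + a 0 \<le> ennreal (F x0)"
    proof -
      have [measurable]: "potential F 0 \<in> borel_measurable M" using Fm by (rule potential_measurable) simp
      have "(\<integral>\<^sup>+\<omega>. ennreal (D 0 \<omega>) \<partial>M) + a 0 = (\<integral>\<^sup>+\<omega>. ennreal (D 0 \<omega>) + ennreal (potential F 0 \<omega>) \<partial>M)"
        unfolding a_def by (simp add: nn_integral_add)
      also have "\<dots> \<le> (\<integral>\<^sup>+\<omega>. ennreal (F x0) \<partial>M)"
      proof (rule nn_integral_mono)
        fix \<omega> assume \<omega>: "\<omega> \<in> space M"
        have d: "0 \<le> D 0 \<omega>" "D 0 \<omega> \<le> x0" using D_nonneg[OF \<omega>] X_0[OF \<omega>] by auto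
        have al: "al 0 \<omega>" using X_0[OF \<omega>] by (simp add: alive_def)
        then have "D 0 \<omega> + potential F 0 \<omega> \<le> F x0" using slope[OF d] X_0(2)[OF \<omega>] by (simp add: potential_def)
        moreover have "0 \<le> potential F 0 \<omega>" using al X_0(1)[OF \<omega>] by (simp add: potential_def nonneg)
        ultimately show "ennreal (D 0 \<omega>) + ennreal (potential F 0 \<omega>) \<le> ennreal (F x0)"
          using d ennreal_leI[of "D 0 \<omega> + potential F 0 \<omega>" "F x0"] by (simp add: ennreal_plus)
      qed
      finally show ?thesis by (simp add: emeasure_space_1)
    qed
    define V where "V \<omega> = ennreal (D 0 \<omega>) + (\<Sum>k. ennreal (w (Suc k)) * ennreal (payment h k \<omega>) + ennreal (w k) * (if al (real k * h) \<omega> then ennreal (L * h) else 0))" for \<omega>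
    have [measurable]: "V \<in> borel_measurable M" unfolding V_def by measurable
    have "Q \<le> (\<integral>\<^sup>+\<omega>. ennreal (exp (\<delta> * h)) * V \<omega> \<partial>M)"
      unfolding Q_def
    proof (rule nn_integral_mono)
      fix \<omega> assume \<omega>: "\<omega> \<in> space M"
      interpret payout "\<lambda>t. D t \<omega>" \<delta> h "\<tau> \<omega>"
        by unfold_locales (use D_nonneg[OF \<omega>] D_mono[OF \<omega>] D_cadlag[OF \<omega>] \<delta>_pos h ruin_time_nonneg in auto)
      have E1: "1 \<le> exp (\<delta> * h)" using \<delta>_pos h by simp
      have "discounted_dividends \<delta> (\<lambda>t. D t \<omega>) (\<tau> \<omega>) \<le> ennreal (D 0 \<omega>) + (\<Sum>k. ennreal (w k) * ennreal (payment h k \<omega>))"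
        using dividends_upper unfolding w_def payment_def .
      also have "\<dots> \<le> ennreal (exp (\<delta> * h)) * ennreal (D 0 \<omega>) + (\<Sum>k. ennreal (exp (\<delta> * h)) * (ennreal (w (Suc k)) * ennreal (payment h k \<omega>)))"
      proof (intro add_mono suminf_le)
        have "1 * ennreal (D 0 \<omega>) \<le> ennreal (exp (\<delta> * h)) * ennreal (D 0 \<omega>)"
          using E1 by (intro mult_right_mono) auto
        then show "ennreal (D 0 \<omega>) \<le> ennreal (exp (\<delta> * h)) * ennreal (D 0 \<omega>)" by simp
        show "ennreal (w k) * ennreal (payment h k \<omega>) \<le> ennreal (exp (\<delta> * h)) * (ennreal (w (Suc k)) * ennreal (payment h k \<omega>))" for k
          unfolding Eb[of k, symmetric] using w(2)[of "Suc k"] by (simp add: ennreal_mult mult.assoc)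
      qed auto
      finally have 1: "discounted_dividends \<delta> (\<lambda>t. D t \<omega>) (\<tau> \<omega>)
        \<le> ennreal (exp (\<delta> * h)) * (ennreal (D 0 \<omega>) + (\<Sum>k. ennreal (w (Suc k)) * ennreal (payment h k \<omega>)))"
        by (simp add: distrib_left)
      have "discounted_time \<delta> (\<tau> \<omega>) \<le> (\<Sum>k. ennreal (h * w k) * indicator {\<tau>. ereal (real k * h) < \<tau>} (\<tau> \<omega>))"
        unfolding w_def by (rule discounted_time_upper[OF h(1) \<delta>_pos])
      then have "ennreal L * discounted_time \<delta> (\<tau> \<omega>) \<le> ennreal L * (\<Sum>k. ennreal (h * w k) * indicator {\<tau>. ereal (real k * h) < \<tau>} (\<tau> \<omega>))"
        by (intro mult_left_mono) auto
      also have "\<dots> = (\<Sum>k. ennreal L * (ennreal (h * w k) * indicator {\<tau>. ereal (real k * h) < \<tau>} (\<tau> \<omega>)))" by simp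
      also have "\<dots> = (\<Sum>k. ennreal (w k) * (if al (real k * h) \<omega> then ennreal (L * h) else 0))"
      proof (rule suminf_cong)
        fix k
        have "indicator {\<tau>. ereal (real k * h) < \<tau>} (\<tau> \<omega>) = (if al (real k * h) \<omega> then 1 else 0 :: ennreal)"
          using less_ruin_time_iff[OF \<omega> grid_le(1)[OF h(1), of k]] by (simp add: indicator_def)
        then show "ennreal L * (ennreal (h * w k) * indicator {\<tau>. ereal (real k * h) < \<tau>} (\<tau> \<omega>))
          = ennreal (w k) * (if al (real k * h) \<omega> then ennreal (L * h) else 0)"
          using h L w(2)[of k] by (simp add: ennreal_mult[symmetric] mult_ac)
      qed
      also have "\<dots> \<le> ennreal (exp (\<delta> * h)) * (\<Sum>k. ennreal (w k) * (if al (real k * h) \<omega> then ennreal (L * h) else 0))"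
        using mult_right_mono[of 1 "ennreal (exp (\<delta> * h))"] E1 by fastforce
      finally have 2: "ennreal L * discounted_time \<delta> (\<tau> \<omega>)
        \<le> ennreal (exp (\<delta> * h)) * (\<Sum>k. ennreal (w k) * (if al (real k * h) \<omega> then ennreal (L * h) else 0))" .
      have "V \<omega> = ennreal (D 0 \<omega>) + ((\<Sum>k. ennreal (w (Suc k)) * ennreal (payment h k \<omega>)) + (\<Sum>k. ennreal (w k) * (if al (real k * h) \<omega> then ennreal (L * h) else 0)))"
        unfolding V_def by (subst suminf_add) auto
      then show "discounted_dividends \<delta> (\<lambda>t. D t \<omega>) (\<tau> \<omega>) + ennreal L * discounted_time \<delta> (\<tau> \<omega>) \<le> ennreal (exp (\<delta> * h)) * V \<omega>"
        using add_mono[OF 1 2] by (simp add: distrib_left add.assoc)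
    qed
    also have "\<dots> = ennreal (exp (\<delta> * h)) * (\<integral>\<^sup>+\<omega>. V \<omega> \<partial>M)" by (rule nn_integral_cmult) simp
    also have "(\<integral>\<^sup>+\<omega>. V \<omega> \<partial>M) = (\<integral>\<^sup>+\<omega>. ennreal (D 0 \<omega>) \<partial>M) + (\<Sum>k. ennreal (w (Suc k)) * p k + ennreal (w k) * l k)"
      unfolding V_def p_def l_def
      by (subst nn_integral_add, measurable, subst nn_integral_suminf, measurable)
         (simp add: nn_integral_add nn_integral_cmult)
    also have "\<dots> \<le> (\<integral>\<^sup>+\<omega>. ennreal (D 0 \<omega>) \<partial>M) + (a 0 + (ennreal (h * C') + E h))"
      by (rule add_left_mono[OF total])
    also have "\<dots> \<le> ennreal (F x0) + (ennreal (h * C') + E h)"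
      unfolding add.assoc[symmetric] by (intro add_right_mono start)
    finally show ?thesis by (simp add: add.assoc mult_left_mono)
  qed
  have "(\<lambda>m. ennreal (exp (\<delta> * (1 / real (Suc m)))) * (ennreal (F x0) + ennreal (1 / real (Suc m) * C') + E (1 / real (Suc m))))
    \<longlonglongrightarrow> ennreal (exp (\<delta> * 0)) * (ennreal (F x0) + ennreal (0 * C') + 0)"
  proof (intro tendsto_mult_ennreal tendsto_add tendsto_ennrealI tendsto_mult tendsto_const tendsto_exp)
    show "(\<lambda>m. 1 / real (Suc m)) \<longlonglongrightarrow> 0" "(\<lambda>m. 1 / real (Suc m)) \<longlonglongrightarrow> 0" by (rule lim_1_over_n[THEN LIMSEQ_Suc])+
    show "(\<lambda>m. E (1 / real (Suc m))) \<longlonglongrightarrow> 0" unfolding E_def by (rule tendsto_ruin_payment_total)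
  qed auto
  then have lim: "(\<lambda>m. ennreal (exp (\<delta> * (1 / real (Suc m)))) * (ennreal (F x0) + ennreal (1 / real (Suc m) * C') + E (1 / real (Suc m))))
    \<longlonglongrightarrow> ennreal (F x0)" by simp
  have "Q \<le> ennreal (F x0)"
  proof (rule LIMSEQ_le_const[OF lim], intro exI[of _ 0] allI impI)
    fix m
    show "Q \<le> ennreal (exp (\<delta> * (1 / real (Suc m)))) * (ennreal (F x0) + ennreal (1 / real (Suc m) * C') + E (1 / real (Suc m)))"
      by (rule main) auto
  qed
  then show ?thesis unfolding Q_def .
qed

end

section \<open>Strategies paying on a time grid\<close>

text \<open>Strategies that pay \<open>\<pi> x\<close> at the times \<open>k h\<close> when the surplus just before the payment is \<open>x\<close>. The
  state after the payment at time \<open>k h\<close> consists of the dividends paid so far and of a flag telling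
  whether ruin has not yet occurred.\<close>

locale step_strategy = cramer_lundberg_exponential M N Y c r \<alpha> \<delta>
  for M :: "'a measure" and N :: "real \<Rightarrow> 'a \<Rightarrow> nat" and Y :: "nat \<Rightarrow> 'a \<Rightarrow> real" and c r \<alpha> \<delta> :: real +
  fixes x0 h :: real and \<pi> :: "real \<Rightarrow> real"
  assumes x0_nonneg: "0 \<le> x0" and h_pos: "0 < h" and \<pi>_measurable [measurable]: "\<pi> \<in> borel_measurable borel"
    and \<pi>: "\<And>x. 0 \<le> x \<Longrightarrow> 0 \<le> \<pi> x \<and> \<pi> x \<le> x"
begin

text \<open>Survival is tested over the closed cell with the old amount of dividends; the payment at
  the right end is made only after a passed test, and being at most the surplus it cannot cause
  ruin.\<close>

primrec state :: "nat \<Rightarrow> 'a \<Rightarrow> real \<times> bool" where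
  "state 0 \<omega> = (\<pi> x0, True)"
| "state (Suc k) \<omega> =
    (let d = fst (state k \<omega>);
         a = snd (state k \<omega>) \<and> (\<forall>s\<in>{real k * h..real (Suc k) * h}. 0 \<le> surplus c S x0 s \<omega> - d)
     in (if a then d + \<pi> (surplus c S x0 (real (Suc k) * h) \<omega> - d) else d, a))"

definition D :: "real \<Rightarrow> 'a \<Rightarrow> real" where
  "D t \<omega> = fst (state (nat \<lfloor>t / h\<rfloor>) \<omega>)"

abbreviation X :: "real \<Rightarrow> 'a \<Rightarrow> real" where "X \<equiv> controlled_surplus c S x0 D"
abbreviation filtration :: "real \<Rightarrow> 'a measure" where
  "filtration \<equiv> natural_filtration M (surplus c S x0)"

section \<open>Grid strategies belong to the admissible class\<close>

lemma D_eq: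
  assumes "real k * h \<le> t" "t < real (Suc k) * h"
  shows "D t \<omega> = fst (state k \<omega>)"
proof -
  have "\<lfloor>t / h\<rfloor> = int k"
    using assms h_pos by (intro floor_unique) (auto simp: field_simps)
  then show ?thesis by (simp add: D_def)
qed

lemma D_grid: "D (real k * h) \<omega> = fst (state k \<omega>)"
  using h_pos by (intro D_eq) auto

lemma grid_floor:
  assumes "0 \<le> t"
  obtains k where "real k * h \<le> t" "t < real (Suc k) * h"
proof -
  define k where "k = nat \<lfloor>t / h\<rfloor>"
  have "0 \<le> t / h" using assms h_pos by simp
  then have "real k = of_int \<lfloor>t / h\<rfloor>" unfolding k_def by simp
  then have "real k \<le> t / h" "t / h < real (Suc k)" using floor_correct[of "t / h"] by linarith+
  then show ?thesis using that[of k] h_pos by (auto simp: field_simps)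
qed

lemma grid_ceiling:
  assumes "0 < t"
  obtains k where "real k * h < t" "t \<le> real (Suc k) * h"
proof -
  define k where "k = nat (\<lceil>t / h\<rceil> - 1)"
  have "0 < t / h" using assms h_pos by simp
  then have k: "real k = of_int \<lceil>t / h\<rceil> - 1" unfolding k_def by (simp add: le_ceiling_iff)
  have "real k < t / h" "t / h \<le> real (Suc k)" using k ceiling_correct[of "t / h"] by linarith+
  then show ?thesis using that[of k] h_pos by (auto simp: field_simps)
qed

lemma state_mono_Suc: "fst (state k \<omega>) \<le> fst (state (Suc k) \<omega>)"
proof -
  have "real k * h \<le> real (Suc k) * h" using h_pos by (simp add: mult_right_mono)
  then show ?thesis using \<pi> by (auto simp: Let_def)
qed

lemma state_mono: "j \<le> k \<Longrightarrow> fst (state j \<omega>) \<le> fst (state k \<omega>)"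
  by (rule lift_Suc_mono_le[of "\<lambda>k. fst (state k \<omega>)"]) (rule state_mono_Suc)

lemma D_0: "D 0 \<omega> = \<pi> x0"
  using D_grid[of 0] by simp

lemma state_nonneg: "0 \<le> fst (state k \<omega>)"
  using state_mono[of 0 k \<omega>] \<pi>[OF x0_nonneg] by simp

lemma D_left:
  assumes "real k * h < t" "t \<le> real (Suc k) * h"
  shows "((\<lambda>s. D s \<omega>) \<longlongrightarrow> fst (state k \<omega>)) (at_left t)"
proof -
  have "eventually (\<lambda>s. fst (state k \<omega>) = D s \<omega>) (at_left t)"
    unfolding eventually_at_left_field
    using assms by (intro exI[of _ "real k * h"]) (auto intro!: D_eq[symmetric])
  then show ?thesis by (rule Lim_transform_eventually[OF tendsto_const])
qed

lemma D_right:
  assumes "0 \<le> t"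
  obtains e where "0 < e" "\<And>s. t \<le> s \<Longrightarrow> s < t + e \<Longrightarrow> D s \<omega> = D t \<omega>"
proof -
  obtain k where k: "real k * h \<le> t" "t < real (Suc k) * h" using grid_floor[OF assms] .
  show ?thesis
    by (rule that[of "real (Suc k) * h - t"]) (use k in \<open>auto simp: D_eq[of k] simp del: of_nat_Suc\<close>)
qed

lemma continuous_right_surplus:
  assumes "\<omega> \<in> space M" "0 \<le> t"
  shows "continuous (at_right t) (\<lambda>t. surplus c S x0 t \<omega>)"
  unfolding surplus_def by (intro continuous_intros continuous_right_S assms)

lemma surplus_adapted: "0 \<le> s \<Longrightarrow> s \<le> t \<Longrightarrow> surplus c S x0 s \<in> borel_measurable (filtration t)"
  unfolding natural_filtration_def by (intro measurable_generated_algebra) auto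

lemma state_measurable:
  "(\<lambda>\<omega>. fst (state k \<omega>)) \<in> borel_measurable (filtration (real k * h)) \<and>
   {\<omega>\<in>space M. snd (state k \<omega>)} \<in> sets (filtration (real k * h))"
proof (induction k)
  case 0
  have "{\<omega>\<in>space M. True} = space (filtration 0)" by (simp add: space_natural_filtration)
  then show ?case by simp
next
  case (Suc k)
  define u v where "u = real k * h" and "v = real (Suc k) * h"
  have uv: "0 \<le> u" "u \<le> v" unfolding u_def v_def using h_pos by (auto simp: mult_right_mono)
  have m1: "(\<lambda>\<omega>. fst (state k \<omega>)) \<in> borel_measurable (filtration v)"
    using Suc.IH uv(2) unfolding u_def[symmetric] by (auto intro: measurable_natural_filtration_mono)
  have m2: "{\<omega>\<in>space M. snd (state k \<omega>)} \<in> sets (filtration v)"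
    using Suc.IH mono_natural_filtration[OF uv(2)] unfolding u_def[symmetric] by blast
  have path: "{\<omega>\<in>space (filtration v). \<forall>s\<in>{u..v}. 0 \<le> surplus c S x0 s \<omega> - fst (state k \<omega>)} \<in> sets (filtration v)"
  proof (rule sets_path_nonneg)
    show "(\<lambda>\<omega>. surplus c S x0 s \<omega> - fst (state k \<omega>)) \<in> borel_measurable (filtration v)" if "u \<le> s" "s \<le> v" for s
      using that uv m1 by (intro borel_measurable_diff surplus_adapted) auto
    show "continuous (at_right s) (\<lambda>t. surplus c S x0 t \<omega> - fst (state k \<omega>))"
      if "\<omega> \<in> space (filtration v)" "u \<le> s" "s < v" for \<omega> s
      using that uv by (intro continuous_intros continuous_right_surplus) (auto simp: space_natural_filtration)
  qed (rule uv)
  have "{\<omega>\<in>space M. snd (state (Suc k) \<omega>)} = {\<omega>\<in>space M. snd (state k \<omega>)}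
      \<inter> {\<omega>\<in>space (filtration v). \<forall>s\<in>{u..v}. 0 \<le> surplus c S x0 s \<omega> - fst (state k \<omega>)}"
    unfolding state.simps Let_def snd_conv u_def[symmetric] v_def[symmetric] space_natural_filtration by blast
  with m2 path have a: "{\<omega>\<in>space M. snd (state (Suc k) \<omega>)} \<in> sets (filtration v)" by simp
  have "fst (state (Suc k) \<omega>) = (if snd (state (Suc k) \<omega>) then fst (state k \<omega>) + \<pi> (surplus c S x0 v \<omega> - fst (state k \<omega>)) else fst (state k \<omega>))" for \<omega>
    by (simp add: Let_def v_def)
  moreover have "(\<lambda>\<omega>. if snd (state (Suc k) \<omega>) then fst (state k \<omega>) + \<pi> (surplus c S x0 v \<omega> - fst (state k \<omega>)) else fst (state k \<omega>)) \<in> borel_measurable (filtration v)"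
  proof (rule measurable_If)
    show "(\<lambda>\<omega>. fst (state k \<omega>) + \<pi> (surplus c S x0 v \<omega> - fst (state k \<omega>))) \<in> borel_measurable (filtration v)"
      using uv m1 by (intro borel_measurable_add measurable_compose[OF _ \<pi>_measurable] borel_measurable_diff surplus_adapted) auto
    show "{\<omega>\<in>space (filtration v). snd (state (Suc k) \<omega>)} \<in> sets (filtration v)"
      using a unfolding space_natural_filtration .
  qed (rule m1)
  ultimately show ?case using a unfolding v_def by (simp del: state.simps of_nat_Suc)
qed

text \<open>Inside a cell both conditions concern the same path. At the right end they differ by the
  payment there, which is nonnegative and at most the surplus, so it affects neither
  direction.\<close>

lemma alive_grid_iff:
  assumes "\<omega> \<in> space M"
  shows "alive c S x0 D (real k * h) \<omega> \<longleftrightarrow> snd (state k \<omega>)"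
proof (induction k)
  case 0
  show ?case using \<pi>[OF x0_nonneg] S_0[OF assms] D_0 by (simp add: alive_def controlled_surplus_def surplus_def)
next
  case (Suc k)
  define u v where "u = real k * h" and "v = real (Suc k) * h"
  have uv: "0 \<le> u" "u < v" unfolding u_def v_def using h_pos by auto
  define d where "d = fst (state k \<omega>)"
  have D: "D s \<omega> = d" if "u \<le> s" "s < v" for s unfolding d_def using that by (intro D_eq) (auto simp: u_def v_def)
  have split: "alive c S x0 D v \<omega> \<longleftrightarrow> alive c S x0 D u \<omega> \<and> (\<forall>s\<in>{u..v}. 0 \<le> X s \<omega>)"
    using uv by (auto simp: alive_def)
  show ?case
  proof
    assume "alive c S x0 D (real (Suc k) * h) \<omega>"
    then have al: "snd (state k \<omega>)" "\<forall>s\<in>{u..v}. 0 \<le> X s \<omega>" using Suc.IH split by (auto simp: u_def v_def)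
    have "0 \<le> surplus c S x0 s \<omega> - d" if s: "s \<in> {u..v}" for s
    proof (cases "s < v")
      case True then show ?thesis using al(2) s D[of s] by (auto simp: controlled_surplus_def)
    next
      case False
      then have sv: "s = v" using s by simp
      show ?thesis
      proof -
        have "d \<le> D v \<omega>" unfolding d_def v_def D_grid by (rule state_mono) simp
        moreover have "0 \<le> X v \<omega>" using al(2) uv by auto
        ultimately show ?thesis unfolding sv by (simp add: controlled_surplus_def)
      qed
    qed
    then show "snd (state (Suc k) \<omega>)" using al by (simp add: Let_def u_def v_def d_def)
  next
    assume "snd (state (Suc k) \<omega>)"
    then have a: "snd (state k \<omega>)" "\<forall>s\<in>{u..v}. 0 \<le> surplus c S x0 s \<omega> - d"
      and Dv: "D v \<omega> = d + \<pi> (surplus c S x0 v \<omega> - d)"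
      unfolding v_def D_grid by (auto simp: Let_def u_def d_def)
    have "0 \<le> X s \<omega>" if s: "s \<in> {u..v}" for s
    proof (cases "s < v")
      case True then show ?thesis using a(2) s D[of s] by (auto simp: controlled_surplus_def)
    next
      case False
      then have sv: "s = v" using s by simp
      then have "0 \<le> surplus c S x0 v \<omega> - d" using a(2) s by auto
      from \<pi>[OF this] show ?thesis unfolding sv controlled_surplus_def Dv by simp
    qed
    then show "alive c S x0 D (real (Suc k) * h) \<omega>" using a split Suc.IH by (auto simp: u_def v_def)
  qed
qed

lemma D_mono:
  assumes "0 \<le> s" "s \<le> t" shows "D s \<omega> \<le> D t \<omega>"
  unfolding D_def using assms h_pos by (intro state_mono nat_mono floor_mono divide_right_mono) auto

lemma state_dead:
  assumes "\<not> snd (state k \<omega>)" "k \<le> j"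
  shows "\<not> snd (state j \<omega>) \<and> fst (state j \<omega>) = fst (state k \<omega>)"
  using assms(2)
proof (induction rule: dec_induct)
  case base then show ?case using assms by simp
next
  case (step n) then show ?case by (simp add: Let_def)
qed

text \<open>Repeats the argument of \<open>X_ruin\<close> at a stage where \<open>D\<close> is not
  yet known to be a strategy; instead of the freezing of dividends after ruin it uses that
  \<open>D\<close> is a right-continuous step function.\<close>

lemma not_alive_ruin:
  assumes \<omega>: "\<omega> \<in> space M" and u: "ruin_time c S x0 D \<omega> = ereal u" "0 \<le> u"
  shows "\<not> alive c S x0 D u \<omega>"
proof
  assume al: "alive c S x0 D u \<omega>"
  obtain e1 where e1: "0 < e1" "\<And>s. u \<le> s \<Longrightarrow> s < u + e1 \<Longrightarrow> N s \<omega> = N u \<omega>"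
    using N_right_const[OF \<omega> u(2)] by blast
  obtain e2 where e2: "0 < e2" "\<And>s. u \<le> s \<Longrightarrow> s < u + e2 \<Longrightarrow> D s \<omega> = D u \<omega>"
    using D_right[OF u(2)] by blast
  have "ereal (u + min e1 e2) \<le> ruin_time c S x0 D \<omega>"
    unfolding ruin_time_def
  proof (rule Inf_greatest)
    fix y assume "y \<in> {ereal t |t. 0 \<le> t \<and> X t \<omega> < 0}"
    then obtain s where s: "y = ereal s" "0 \<le> s" "X s \<omega> < 0" by auto
    have us: "u < s" using al s by (force simp: alive_def)
    have "u + min e1 e2 \<le> s"
    proof (rule ccontr)
      assume "\<not> u + min e1 e2 \<le> s"
      then have "S s \<omega> = S u \<omega>" "D s \<omega> = D u \<omega>" using e1(2)[of s] e2(2)[of s] us by (auto simp: total_claims_def)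
      moreover have "c * u \<le> c * s" using us c_pos by simp
      moreover have "0 \<le> X u \<omega>" using al u by (auto simp: alive_def)
      ultimately show False using s by (simp add: controlled_surplus_def surplus_def)
    qed
    then show "ereal (u + min e1 e2) \<le> y" using s by simp
  qed
  then show False using u e1 e2 by simp
qed

lemma in_strategies: "D \<in> strategies M c S x0"
  unfolding strategies_def admissible_def
proof (intro CollectI conjI ballI allI impI)
  fix t :: real assume t: "0 \<le> t"
  obtain k where k: "real k * h \<le> t" "t < real (Suc k) * h" using grid_floor[OF t] .
  have "D t = (\<lambda>\<omega>. fst (state k \<omega>))" using D_eq[OF k] by auto
  then show "D t \<in> borel_measurable (filtration t)"
    using state_measurable[of k] k(1) by (auto intro: measurable_natural_filtration_mono)
next
  fix \<omega> t assume "\<omega> \<in> space M" "0 \<le> (t::real)"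
  show "0 \<le> D t \<omega>" unfolding D_def by (rule state_nonneg)
next
  fix \<omega> show "mono_on {0..} (\<lambda>t. D t \<omega>)" by (auto simp: mono_on_def intro: D_mono)
next
  fix \<omega>
  show "cadlag (\<lambda>t. D t \<omega>)" unfolding cadlag_def
  proof (intro conjI allI impI)
    fix t :: real assume "0 \<le> t"
    then obtain e where e: "0 < e" "\<And>s. t \<le> s \<Longrightarrow> s < t + e \<Longrightarrow> D s \<omega> = D t \<omega>" using D_right by blast
    have "eventually (\<lambda>s. D t \<omega> = D s \<omega>) (at_right t)"
      unfolding eventually_at_right_field
    proof (intro exI[of _ "t + e"] conjI allI impI)
      fix s assume "t < s" "s < t + e"
      then show "D t \<omega> = D s \<omega>" using e(2)[of s] by simp
    qed (use e in simp)
    then show "continuous (at_right t) (\<lambda>t. D t \<omega>)"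
      unfolding continuous_within by (rule Lim_transform_eventually[OF tendsto_const])
  next
    fix t :: real assume "0 < t"
    then obtain k where "real k * h < t" "t \<le> real (Suc k) * h" using grid_ceiling by blast
    then show "\<exists>l. ((\<lambda>s. D s \<omega>) \<longlongrightarrow> l) (at_left t)" using D_left by blast
  qed
next
  fix \<omega> and t :: real assume \<omega>: "\<omega> \<in> space M" and t: "0 \<le> t"
  show "D t \<omega> - left_value 0 (\<lambda>s. D s \<omega>) t \<le> max (left_value x0 (\<lambda>s. X s \<omega>) t - (S t \<omega> - left_value 0 (\<lambda>s. S s \<omega>) t)) 0"
  proof (cases "t = 0")
    case True
    then show ?thesis using \<pi>[OF x0_nonneg] S_0[OF \<omega>] D_0 by (simp add: left_value_def)
  next
    case False
    then have tpos: "0 < t" using t by simp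
    then obtain k where k: "real k * h < t" "t \<le> real (Suc k) * h" using grid_ceiling by blast
    define d where "d = fst (state k \<omega>)"
    have Dl: "left_value 0 (\<lambda>s. D s \<omega>) t = d"
      using D_left[OF k, of \<omega>] False by (auto simp: left_value_def d_def intro!: tendsto_Lim)
    have "((\<lambda>s. X s \<omega>) \<longlongrightarrow> x0 + c * t - left_value 0 (\<lambda>s. S s \<omega>) t - d) (at_left t)"
      unfolding controlled_surplus_def surplus_def d_def
      by (intro tendsto_intros tendsto_S_left D_left[OF k] \<omega> tpos)
    then have Xl: "left_value x0 (\<lambda>s. X s \<omega>) t = x0 + c * t - left_value 0 (\<lambda>s. S s \<omega>) t - d"
      using False by (auto simp: left_value_def intro!: tendsto_Lim)
    show ?thesis
    proof (cases "t < real (Suc k) * h")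
      case True
      then have "D t \<omega> = d" using k unfolding d_def by (intro D_eq) auto
      then show ?thesis by (simp add: Dl)
    next
      case F: False
      then have tk: "t = real (Suc k) * h" using k by simp
      have "D t \<omega> - d \<le> max (surplus c S x0 t \<omega> - d) 0"
        unfolding tk D_grid d_def
        using \<pi>[of "surplus c S x0 (real (Suc k) * h) \<omega> - fst (state k \<omega>)"] h_pos
        by (auto simp: Let_def mult_right_mono)
      then show ?thesis unfolding Dl Xl surplus_def by (simp add: algebra_simps)
    qed
  qed
next
  fix \<omega> and t :: real assume \<omega>: "\<omega> \<in> space M" and t: "0 \<le> t" "ruin_time c S x0 D \<omega> \<le> ereal t"
  have "0 \<le> ruin_time c S x0 D \<omega>" unfolding ruin_time_def by (rule Inf_greatest) auto
  then obtain u where u: "ruin_time c S x0 D \<omega> = ereal u" "0 \<le> u"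
    using t by (cases "ruin_time c S x0 D \<omega>") auto
  have ut: "u \<le> t" using t u by simp
  obtain k where k: "real k * h \<le> u" "u < real (Suc k) * h" using grid_floor[OF u(2)] .
  obtain j where j: "real j * h \<le> t" "t < real (Suc j) * h" using grid_floor[OF t(1)] .
  \<comment> \<open>Ruin within a cell switches the flag off at the end of that cell, which also
    cancels the payment due there; dividends thus keep the value they had in the cell.\<close>
  have "\<not> alive c S x0 D (real (Suc k) * h) \<omega>"
    using not_alive_ruin[OF \<omega> u] k(2) by (auto simp: alive_def)
  then have dead: "\<not> snd (state (Suc k) \<omega>)" by (simp only: alive_grid_iff[OF \<omega>] not_False_eq_True)
  have "real k * h < real (Suc j) * h" using k j ut by linarith
  then have "real k < real (Suc j)" using h_pos by (simp only: mult_less_cancel_right)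
  then have kj: "k \<le> j" by simp
  have "fst (state j \<omega>) = fst (state k \<omega>)"
  proof (cases "k = j")
    case False
    then have "fst (state j \<omega>) = fst (state (Suc k) \<omega>)" using state_dead[OF dead, of j] kj by simp
    moreover have "fst (state (Suc k) \<omega>) = (if snd (state (Suc k) \<omega>)
      then fst (state k \<omega>) + \<pi> (surplus c S x0 (real (Suc k) * h) \<omega> - fst (state k \<omega>)) else fst (state k \<omega>))"
      by (simp add: Let_def)
    ultimately show ?thesis using dead by (simp del: state.simps of_nat_Suc)
  qed simp
  then show "D t \<omega> = D (real_of_ereal (ruin_time c S x0 D \<omega>)) \<omega>"
    using D_eq[OF k] D_eq[OF j] u by simp
qed

end

sublocale step_strategy \<subseteq> strat: dividend_strategy M N Y c r \<alpha> \<delta> x0 D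
  by (unfold_locales; (rule x0_nonneg | rule in_strategies))

section \<open>Lower bound for the value of grid strategies\<close>

context step_strategy
begin

lemma post_payment:
  assumes "\<omega> \<in> space M" "strat.al (real k * h) \<omega>"
  obtains x where "0 \<le> x" "X (real k * h) \<omega> = x - \<pi> x"
proof (cases k)
  case 0
  then show ?thesis
    using that[OF x0_nonneg] D_0[of \<omega>] S_0[OF assms(1)] by (simp add: controlled_surplus_def surplus_def)
next
  case (Suc j)
  have a: "snd (state (Suc j) \<omega>)" using assms(2) unfolding Suc alive_grid_iff[OF assms(1)] .
  define x where "x = surplus c S x0 (real (Suc j) * h) \<omega> - fst (state j \<omega>)"
  have "real j * h \<le> real (Suc j) * h" using h_pos by (simp add: mult_right_mono)
  then have "0 \<le> x" using a unfolding x_def state.simps Let_def snd_conv by simp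
  moreover have "D (real (Suc j) * h) \<omega> = fst (state j \<omega>) + \<pi> x"
    using a unfolding x_def D_grid state.simps Let_def by simp
  ultimately show ?thesis
    using that[of x] unfolding Suc controlled_surplus_def by (simp add: x_def del: of_nat_Suc)
qed

lemma survive_step:
  fixes k :: nat
  assumes \<omega>: "\<omega> \<in> space M" and al: "strat.al (real k * h) \<omega>"
    and nonneg: "\<And>s. real k * h \<le> s \<Longrightarrow> s \<le> real k * h + h \<Longrightarrow> 0 \<le> surplus c S x0 s \<omega> - D (real k * h) \<omega>"
  defines "x \<equiv> surplus c S x0 (real k * h + h) \<omega> - D (real k * h) \<omega>"
  shows "strat.al (real k * h + h) \<omega>" "strat.payment h k \<omega> = \<pi> x" "X (real k * h + h) \<omega> = x - \<pi> x" "0 \<le> x"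
proof -
  have eq: "real (Suc k) * h = real k * h + h" by (simp add: algebra_simps)
  have "snd (state k \<omega>)" using al alive_grid_iff[OF \<omega>] by simp
  then have a: "snd (state (Suc k) \<omega>)"
    using nonneg unfolding state.simps Let_def eq by (simp add: D_grid)
  then show "strat.al (real k * h + h) \<omega>" using alive_grid_iff[OF \<omega>, of "Suc k"] unfolding eq by simp
  have D: "D (real k * h + h) \<omega> = D (real k * h) \<omega> + \<pi> x"
    unfolding x_def eq[symmetric] D_grid using a unfolding state.simps Let_def by simp
  then show "strat.payment h k \<omega> = \<pi> x" unfolding strat.payment_def eq by simp
  show "X (real k * h + h) \<omega> = x - \<pi> x" unfolding controlled_surplus_def D by (simp add: x_def)
  show "0 \<le> x" unfolding x_def using h_pos by (intro nonneg) auto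
qed

text \<open>Survival through the whole step follows from the size of the claim alone, and at the
  grid point \<open>jump\<close> converts the value before the payment into payment plus value after
  it. The weight \<open>\<theta>\<close> lets one inequality serve dividends and lifetime.\<close>

lemma step_lower:
  fixes k :: nat
  assumes F: "continuous_on {0..} F" and Fm[measurable]: "F \<in> borel_measurable borel"
    and nonneg: "\<And>x. 0 \<le> x \<Longrightarrow> 0 \<le> F x" and mono: "\<And>x y. 0 \<le> x \<Longrightarrow> x \<le> y \<Longrightarrow> F x \<le> F y"
    and jump: "\<And>x. 0 \<le> x \<Longrightarrow> F x \<le> F (x - \<pi> x) + \<theta> * \<pi> x"
    and post: "\<And>x. 0 \<le> x \<Longrightarrow> x - \<pi> x \<in> A"
    and step: "\<And>x. x \<in> A \<Longrightarrow> F x \<le> exp (- \<delta> * h) * (exp (- r * h) * F (x + c * h)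
      + r * h * exp (- r * h) * conv F x) + L * h + C * h\<^sup>2"
    and \<theta>: "0 \<le> \<theta>" and L: "0 \<le> L" and C: "0 \<le> C"
  defines "t \<equiv> real k * h"
  shows "(\<integral>\<^sup>+\<omega>. ennreal (strat.potential F t \<omega>) \<partial>M)
    \<le> ennreal (exp (- \<delta> * h)) * ((\<integral>\<^sup>+\<omega>. ennreal (strat.potential F (t + h) \<omega>) \<partial>M) + ennreal \<theta> * (\<integral>\<^sup>+\<omega>. ennreal (strat.payment h k \<omega>) \<partial>M))
      + (\<integral>\<^sup>+\<omega>. (if strat.al t \<omega> then ennreal (L * h) else 0) \<partial>M) + ennreal (C * h\<^sup>2)"
proof -
  have t: "0 \<le> t" "0 \<le> t + h" using h_pos by (auto simp: t_def)
  define Z where "Z \<omega> = (if strat.al t \<omega> then X t \<omega> else -1)" for \<omega>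
  have Zm: "Z \<in> borel_measurable (filtration t)"
    unfolding Z_def[abs_def]
    by (intro measurable_If strat.X_adapted[OF t(1)] borel_measurable_const) (use strat.al_sets[OF t(1)] in \<open>simp add: space_natural_filtration\<close>)
  have Z0: "0 \<le> Z \<omega> \<longleftrightarrow> strat.al t \<omega>" for \<omega> using t by (auto simp: Z_def alive_def)
  have pot: "strat.potential F t \<omega> = (if 0 \<le> Z \<omega> then F (Z \<omega>) else 0)" for \<omega>
    unfolding Z0 by (auto simp: Z_def strat.potential_def)
  have [measurable]: "strat.potential F (t + h) \<in> borel_measurable M" "strat.payment h k \<in> borel_measurable M"
    using t h_pos Fm by (auto intro: strat.potential_measurable)
  have pn: "0 \<le> strat.potential F (t + h) \<omega>" for \<omega>
    using t by (auto simp: strat.potential_def alive_def intro!: nonneg)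
  have "(\<integral>\<^sup>+\<omega>. ennreal (strat.potential F t \<omega>) \<partial>M) = (\<integral>\<^sup>+\<omega>. (if 0 \<le> Z \<omega> then ennreal (F (Z \<omega>)) else 0) \<partial>M)"
    unfolding pot by (intro nn_integral_cong) auto
  also have "\<dots> \<le> ennreal (exp (- \<delta> * h)) * (\<integral>\<^sup>+\<omega>. indicator {0} (N (t + h) \<omega> - N t \<omega>) * (if 0 \<le> Z \<omega> then ennreal (F (Z \<omega> + c * h)) else 0)
        + indicator {1} (N (t + h) \<omega> - N t \<omega>) * (if 0 \<le> Z \<omega> \<and> Y (Suc (N t \<omega>)) \<omega> \<le> Z \<omega>
            then ennreal (F (Z \<omega> + c * h - Y (Suc (N t \<omega>)) \<omega>)) else 0) \<partial>M)
      + (\<integral>\<^sup>+\<omega>. (if 0 \<le> Z \<omega> then ennreal (L * h) else 0) \<partial>M) + ennreal (C * h\<^sup>2)"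
  proof (rule one_step_expectation_lower[OF F Fm nonneg mono step t(1) h_pos L _ Zm])
    fix \<omega> assume \<omega>: "\<omega> \<in> space M" "0 \<le> Z \<omega>"
    then have al: "strat.al (real k * h) \<omega>" unfolding Z0 t_def by simp
    obtain x where "0 \<le> x" "X (real k * h) \<omega> = x - \<pi> x" using post_payment[OF \<omega>(1) al] .
    then show "Z \<omega> \<in> A" using post[of x] al by (simp add: Z_def t_def)
  qed (use C in auto)
  also have "(\<integral>\<^sup>+\<omega>. indicator {0} (N (t + h) \<omega> - N t \<omega>) * (if 0 \<le> Z \<omega> then ennreal (F (Z \<omega> + c * h)) else 0)
        + indicator {1} (N (t + h) \<omega> - N t \<omega>) * (if 0 \<le> Z \<omega> \<and> Y (Suc (N t \<omega>)) \<omega> \<le> Z \<omega>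
            then ennreal (F (Z \<omega> + c * h - Y (Suc (N t \<omega>)) \<omega>)) else 0) \<partial>M)
     \<le> (\<integral>\<^sup>+\<omega>. ennreal (strat.potential F (t + h) \<omega>) + ennreal \<theta> * ennreal (strat.payment h k \<omega>) \<partial>M)"
  proof (rule nn_integral_mono_AE, rule AE_mp[OF AE_claims_nonneg], rule AE_I2, rule impI)
    fix \<omega> assume \<omega>: "\<omega> \<in> space M" and Ypos: "\<forall>i\<ge>1. 0 \<le> Y i \<omega>"
    let ?y = "Y (Suc (N t \<omega>)) \<omega>"
    have y0: "0 \<le> ?y" using Ypos by simp
    have th: "t \<le> t + h" using h_pos by simp
    have Nmono: "N t \<omega> \<le> N s \<omega>" "N s \<omega> \<le> N (t + h) \<omega>" if "t \<le> s" "s \<le> t + h" for s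
      using N_mono[OF \<omega>, of t s] N_mono[OF \<omega>, of s "t + h"] that t by auto
    \<comment> \<open>\<open>z\<close> is the total of the claims in the step: 0 without a claim,
      the claim itself otherwise. At every moment the claims so far are at most
      \<open>z \<le> X t \<omega>\<close>, so the surplus stays nonnegative.\<close>
    have surv: "ennreal (F (X t \<omega> + c * h - z)) \<le> ennreal (strat.potential F (t + h) \<omega>) + ennreal \<theta> * ennreal (strat.payment h k \<omega>)"
      if al: "strat.al t \<omega>" and z: "S (t + h) \<omega> = S t \<omega> + z" "z \<le> X t \<omega>" "\<And>s. t \<le> s \<Longrightarrow> s \<le> t + h \<Longrightarrow> S s \<omega> \<le> S t \<omega> + z" for z
    proof -
      have nn: "0 \<le> surplus c S x0 s \<omega> - D (real k * h) \<omega>" if "real k * h \<le> s" "s \<le> real k * h + h" for s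
      proof -
        have "c * t \<le> c * s" using that c_pos by (simp add: t_def)
        then show ?thesis using z(2) z(3)[of s] that by (simp add: t_def controlled_surplus_def surplus_def)
      qed
      define x where "x = surplus c S x0 (real k * h + h) \<omega> - D (real k * h) \<omega>"
      note sv = survive_step[OF \<omega> al[unfolded t_def] nn, folded x_def t_def]
      have "x = X t \<omega> + c * h - z"
        unfolding x_def controlled_surplus_def surplus_def t_def[symmetric] z(1) by (simp add: algebra_simps)
      moreover have "F x \<le> strat.potential F (t + h) \<omega> + \<theta> * strat.payment h k \<omega>"
        using jump[OF sv(4)] sv by (simp add: strat.potential_def)
      moreover have "0 \<le> strat.payment h k \<omega>" using strat.payment_nonneg[OF \<omega> h_pos] .
      ultimately have "ennreal (F (X t \<omega> + c * h - z)) \<le> ennreal (strat.potential F (t + h) \<omega> + \<theta> * strat.payment h k \<omega>)"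
        by (intro ennreal_leI) simp
      then show ?thesis using pn[of \<omega>] \<theta> \<open>0 \<le> strat.payment h k \<omega>\<close> by (simp add: ennreal_plus ennreal_mult)
    qed
    consider "N (t + h) \<omega> - N t \<omega> = 0" | "N (t + h) \<omega> - N t \<omega> = 1" | "2 \<le> N (t + h) \<omega> - N t \<omega>" by linarith
    then show "indicator {0} (N (t + h) \<omega> - N t \<omega>) * (if 0 \<le> Z \<omega> then ennreal (F (Z \<omega> + c * h)) else 0)
        + indicator {1} (N (t + h) \<omega> - N t \<omega>) * (if 0 \<le> Z \<omega> \<and> ?y \<le> Z \<omega> then ennreal (F (Z \<omega> + c * h - ?y)) else 0)
      \<le> ennreal (strat.potential F (t + h) \<omega>) + ennreal \<theta> * ennreal (strat.payment h k \<omega>)"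
    proof cases
      case 1
      have "ennreal (F (X t \<omega> + c * h - 0)) \<le> ennreal (strat.potential F (t + h) \<omega>) + ennreal \<theta> * ennreal (strat.payment h k \<omega>)"
        if "strat.al t \<omega>"
      proof (rule surv[OF that])
        show "S (t + h) \<omega> = S t \<omega> + 0" using S_increment(1)[OF \<omega> t(1) th 1] by simp
        show "0 \<le> X t \<omega>" using that t by (auto simp: alive_def)
        fix s assume s: "t \<le> s" "s \<le> t + h"
        then have "N s \<omega> = N t \<omega>" using Nmono[OF s] 1 by simp
        then show "S s \<omega> \<le> S t \<omega> + 0" by (simp add: total_claims_def)
      qed
      then show ?thesis using 1 by (auto simp: Z0) (auto simp: Z_def)
    next
      case 2
      have "ennreal (F (X t \<omega> + c * h - ?y)) \<le> ennreal (strat.potential F (t + h) \<omega>) + ennreal \<theta> * ennreal (strat.payment h k \<omega>)"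
        if "strat.al t \<omega>" "?y \<le> X t \<omega>"
      proof (rule surv[OF that(1) _ that(2)])
        show S1: "S (t + h) \<omega> = S t \<omega> + ?y" using S_increment(2)[OF \<omega> t(1) th 2] .
        fix s assume s: "t \<le> s" "s \<le> t + h"
        then show "S s \<omega> \<le> S t \<omega> + ?y" unfolding S1[symmetric] using S_mono[OF \<omega>, of s "t + h"] Ypos t by simp
      qed
      then show ?thesis using 2 by (auto simp: Z0) (auto simp: Z_def)
    qed (auto simp: indicator_def)
  qed
  also have "\<dots> = (\<integral>\<^sup>+\<omega>. ennreal (strat.potential F (t + h) \<omega>) \<partial>M) + ennreal \<theta> * (\<integral>\<^sup>+\<omega>. ennreal (strat.payment h k \<omega>) \<partial>M)"
    by (simp add: nn_integral_add nn_integral_cmult)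
  finally show ?thesis unfolding Z0 by (simp add: add_mono mult_left_mono)
qed

text \<open>The payments of a step are discounted at its right end both here and in
  \<open>dividends_lower\<close>, so no correction factor appears. The error consists of
  \<open>h * L\<close> for the shift in the survival times and of the accumulated step
  errors.\<close>

lemma value_lower_bound:
  assumes F: "continuous_on {0..} F" and Fm[measurable]: "F \<in> borel_measurable borel"
    and nonneg: "\<And>x. 0 \<le> x \<Longrightarrow> 0 \<le> F x" and mono: "\<And>x y. 0 \<le> x \<Longrightarrow> x \<le> y \<Longrightarrow> F x \<le> F y"
    and jump: "\<And>x. 0 \<le> x \<Longrightarrow> F x \<le> F (x - \<pi> x) + \<theta> * \<pi> x"
    and post: "\<And>x. 0 \<le> x \<Longrightarrow> x - \<pi> x \<in> A"
    and step: "\<And>x. x \<in> A \<Longrightarrow> F x \<le> exp (- \<delta> * h) * (exp (- r * h) * F (x + c * h)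
      + r * h * exp (- r * h) * conv F x) + L * h + C * h\<^sup>2"
    and bound: "\<And>x. x \<in> A \<Longrightarrow> F x \<le> B"
    and \<theta>: "0 \<le> \<theta>" and L: "0 \<le> L" and C: "0 \<le> C" and h1: "h \<le> 1"
  shows "ennreal (F x0) \<le> ennreal \<theta> * (\<integral>\<^sup>+\<omega>. discounted_dividends \<delta> (\<lambda>t. D t \<omega>) (ruin_time c S x0 D \<omega>) \<partial>M)
    + ennreal L * (\<integral>\<^sup>+\<omega>. discounted_time \<delta> (ruin_time c S x0 D \<omega>) \<partial>M) + ennreal (h * (L + C * (1 + 2 / \<delta>)))"
proof -
  define \<beta> where "\<beta> = exp (- \<delta> * h)"
  define w where "w k = exp (- \<delta> * (real k * h))" for k
  have w: "w (Suc k) = w k * \<beta>" "0 < w k" "w 0 = 1" for k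
    unfolding w_def \<beta>_def by (auto simp: algebra_simps simp flip: exp_add)
  define a where "a k = (\<integral>\<^sup>+\<omega>. ennreal (strat.potential F (real k * h) \<omega>) \<partial>M)" for k
  define p where "p k = (\<integral>\<^sup>+\<omega>. ennreal (strat.payment h k \<omega>) \<partial>M)" for k
  define l where "l k = (\<integral>\<^sup>+\<omega>. (if strat.al (real k * h) \<omega> then ennreal (L * h) else 0) \<partial>M)" for k
  have [measurable]: "strat.payment h k \<in> borel_measurable M"
    "Measurable.pred M (strat.al (real k * h))" "D 0 \<in> borel_measurable M" for k
    using h_pos strat.grid_le(1)[OF h_pos] by (auto intro: strat.al_pred strat.D_measurable)
  have st: "a k \<le> ennreal \<beta> * (a (Suc k) + ennreal \<theta> * p k) + l k + ennreal (C * h\<^sup>2)" for k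
  proof -
    have "real (Suc k) * h = real k * h + h" by (simp add: algebra_simps)
    then show ?thesis
      unfolding a_def p_def l_def \<beta>_def
      using step_lower[OF F Fm nonneg mono jump post step \<theta> L C, of k] by simp
  qed
  define g where "g k = ennreal (w (Suc k)) * (ennreal \<theta> * p k) + (ennreal (w k) * l k + ennreal (w k) * ennreal (C * h\<^sup>2))" for k
  have ind: "a 0 \<le> ennreal (w n) * a n + (\<Sum>k<n. g k)" for n
  proof (induction n)
    case 0 then show ?case by (simp add: w)
  next
    case (Suc n)
    have e: "ennreal (w n) * (ennreal \<beta> * y) = ennreal (w (Suc n)) * y" for y
      using w(2)[of n] by (simp add: w(1) ennreal_mult' mult.assoc \<beta>_def)
    have "ennreal (w n) * a n \<le> ennreal (w n) * (ennreal \<beta> * (a (Suc n) + ennreal \<theta> * p n) + l n + ennreal (C * h\<^sup>2))"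
      by (rule mult_left_mono[OF st]) simp
    also have "\<dots> = ennreal (w (Suc n)) * a (Suc n) + g n"
      unfolding g_def by (simp only: distrib_left e add.assoc)
    finally have "ennreal (w n) * a n + (\<Sum>k<n. g k) \<le> ennreal (w (Suc n)) * a (Suc n) + g n + (\<Sum>k<n. g k)"
      by (rule add_right_mono)
    from order_trans[OF Suc.IH this] show ?case by (simp add: add_ac)
  qed
  \<comment> \<open>The last term of the telescoping sum cannot be dropped in a lower bound. It
    vanishes after discounting because \<open>F\<close> is bounded on the states after a
    payment.\<close>
  have aB: "a n \<le> ennreal B" for n
  proof -
    have "a n \<le> (\<integral>\<^sup>+\<omega>. ennreal B \<partial>M)"
      unfolding a_def
    proof (rule nn_integral_mono)
      fix \<omega> assume \<omega>: "\<omega> \<in> space M"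
      show "ennreal (strat.potential F (real n * h) \<omega>) \<le> ennreal B"
      proof (cases "strat.al (real n * h) \<omega>")
        case True
        obtain x where x: "0 \<le> x" "X (real n * h) \<omega> = x - \<pi> x" using post_payment[OF \<omega> True] .
        then show ?thesis using bound[OF post[OF x(1)]] True by (simp add: strat.potential_def ennreal_leI)
      qed (simp add: strat.potential_def)
    qed
    then show ?thesis by (simp add: emeasure_space_1)
  qed
  have "a 0 \<le> (\<Sum>k. g k)"
  proof -
    have le: "a 0 \<le> ennreal (w n * B) + (\<Sum>k. g k)" for n
    proof -
      have "ennreal (w n) * a n \<le> ennreal (w n) * ennreal B" by (intro mult_left_mono aB) simp
      also have "\<dots> = ennreal (w n * B)" using w(2)[of n] by (simp add: ennreal_mult')
      finally have "ennreal (w n) * a n + (\<Sum>k<n. g k) \<le> ennreal (w n * B) + (\<Sum>k. g k)"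
        by (intro add_mono sum_le_suminf) auto
      then show ?thesis using ind[of n] by (rule order_trans[rotated])
    qed
    have "(\<lambda>n. w n) \<longlonglongrightarrow> 0"
    proof -
      have "w n = \<beta> ^ n" for n by (induction n) (auto simp: w)
      moreover have "norm \<beta> < 1" unfolding \<beta>_def using h_pos \<delta>_pos by simp
      ultimately show ?thesis using LIMSEQ_power_zero[of \<beta>] by simp
    qed
    then have "(\<lambda>n. ennreal (w n * B) + (\<Sum>k. g k)) \<longlonglongrightarrow> ennreal (0 * B) + (\<Sum>k. g k)"
      by (intro tendsto_add tendsto_ennrealI tendsto_mult tendsto_const)
    from LIMSEQ_le_const[OF this, of "a 0"] le show ?thesis by auto
  qed
  also have "(\<Sum>k. g k) = (\<Sum>k. ennreal (w (Suc k)) * (ennreal \<theta> * p k)) + ((\<Sum>k. ennreal (w k) * l k) + (\<Sum>k. ennreal (w k) * ennreal (C * h\<^sup>2)))"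
    unfolding g_def by (simp only: suminf_add summableI)
  finally have a0: "a 0 \<le> (\<Sum>k. ennreal (w (Suc k)) * (ennreal \<theta> * p k)) + ((\<Sum>k. ennreal (w k) * l k) + (\<Sum>k. ennreal (w k) * ennreal (C * h\<^sup>2)))" .
  have sC: "(\<Sum>k. ennreal (w k) * ennreal (C * h\<^sup>2)) \<le> ennreal (h * (C * (1 + 2 / \<delta>)))"
  proof -
    have "(\<Sum>k. ennreal (w k) * ennreal (C * h\<^sup>2)) = (\<Sum>k. ennreal (exp (- \<delta> * (real k * h)) * (h\<^sup>2 * (C + 0 * (real k * h)))))"
      unfolding w_def
    proof (rule suminf_cong)
      fix k
      have "0 \<le> C * h\<^sup>2" using C by simp
      then show "ennreal (exp (- \<delta> * (real k * h))) * ennreal (C * h\<^sup>2)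
        = ennreal (exp (- \<delta> * (real k * h)) * (h\<^sup>2 * (C + 0 * (real k * h))))"
        by (subst ennreal_mult'[symmetric]) (simp_all add: mult_ac)
    qed
    also have "\<dots> \<le> ennreal (h * ((C + 0 * (2 / \<delta>)) * (1 + 2 / \<delta>)))"
      using \<delta>_pos C h_pos h1 by (intro discounted_linear_sum) auto
    finally show ?thesis by simp
  qed
  \<comment> \<open>The recursion counts survival at left end points,
    \<open>discounted_time_lower\<close> at right ones. Shifting the index by one leaves only the
    term for \<open>k = 0\<close>, at most \<open>h * L\<close>.\<close>
  have sl: "(\<Sum>k. ennreal (w k) * l k) \<le> ennreal (h * L) + ennreal L * (\<integral>\<^sup>+\<omega>. discounted_time \<delta> (ruin_time c S x0 D \<omega>) \<partial>M)"
  proof -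
    have "(\<Sum>k. ennreal (w k) * l k) = (\<Sum>k. ennreal (w (Suc k)) * l (Suc k)) + ennreal (w 0) * l 0"
      using suminf_offset[of "\<lambda>k. ennreal (w k) * l k" 1] by (simp add: add.commute)
    also have "ennreal (w 0) * l 0 \<le> ennreal (h * L)"
    proof -
      have "l 0 \<le> (\<integral>\<^sup>+\<omega>. ennreal (L * h) \<partial>M)" unfolding l_def by (intro nn_integral_mono) auto
      then show ?thesis by (simp add: w emeasure_space_1 mult.commute)
    qed
    also have "(\<Sum>k. ennreal (w (Suc k)) * l (Suc k)) \<le> ennreal L * (\<integral>\<^sup>+\<omega>. discounted_time \<delta> (ruin_time c S x0 D \<omega>) \<partial>M)"
    proof -
      have "(\<Sum>k. ennreal (w (Suc k)) * l (Suc k))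
        = (\<integral>\<^sup>+\<omega>. (\<Sum>k. ennreal (w (Suc k)) * (if strat.al (real (Suc k) * h) \<omega> then ennreal (L * h) else 0)) \<partial>M)"
      proof -
        have m: "(\<lambda>\<omega>. if strat.al (real (Suc k) * h) \<omega> then ennreal (L * h) else 0) \<in> borel_measurable M" for k
          by (intro measurable_If borel_measurable_const strat.al_events strat.grid_le(1)[OF h_pos])
        have "(\<integral>\<^sup>+\<omega>. (\<Sum>k. ennreal (w (Suc k)) * (if strat.al (real (Suc k) * h) \<omega> then ennreal (L * h) else 0)) \<partial>M)
          = (\<Sum>k. \<integral>\<^sup>+\<omega>. ennreal (w (Suc k)) * (if strat.al (real (Suc k) * h) \<omega> then ennreal (L * h) else 0) \<partial>M)"
          by (rule nn_integral_suminf) (rule borel_measurable_times_ennreal[OF borel_measurable_const m])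
        also have "\<dots> = (\<Sum>k. ennreal (w (Suc k)) * l (Suc k))"
          unfolding l_def by (rule suminf_cong) (rule nn_integral_cmult[OF m])
        finally show ?thesis by (rule sym)
      qed
      also have "\<dots> = (\<integral>\<^sup>+\<omega>. ennreal L * (\<Sum>k. ennreal (h * w (Suc k)) * indicator {\<tau>. ereal (real (Suc k) * h) < \<tau>} (ruin_time c S x0 D \<omega>)) \<partial>M)"
      proof (rule nn_integral_cong)
        fix \<omega> assume \<omega>: "\<omega> \<in> space M"
        have "ennreal (w (Suc k)) * (if strat.al (real (Suc k) * h) \<omega> then ennreal (L * h) else 0)
          = ennreal L * (ennreal (h * w (Suc k)) * indicator {\<tau>. ereal (real (Suc k) * h) < \<tau>} (ruin_time c S x0 D \<omega>))" for k
        proof -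
          have "indicator {\<tau>. ereal (real (Suc k) * h) < \<tau>} (ruin_time c S x0 D \<omega>) = (if strat.al (real (Suc k) * h) \<omega> then 1 else 0 :: ennreal)"
            using strat.less_ruin_time_iff[OF \<omega> strat.grid_le(1)[OF h_pos, of "Suc k"]] by (simp add: indicator_def del: of_nat_Suc)
          then show ?thesis
            using h_pos L w(2)[of "Suc k"] by (simp add: ennreal_mult[symmetric] mult_ac del: of_nat_Suc)
        qed
        then show "(\<Sum>k. ennreal (w (Suc k)) * (if strat.al (real (Suc k) * h) \<omega> then ennreal (L * h) else 0))
          = ennreal L * (\<Sum>k. ennreal (h * w (Suc k)) * indicator {\<tau>. ereal (real (Suc k) * h) < \<tau>} (ruin_time c S x0 D \<omega>))"
          unfolding ennreal_suminf_cmult[symmetric] by (rule suminf_cong)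
      qed
      also have "\<dots> \<le> (\<integral>\<^sup>+\<omega>. ennreal L * discounted_time \<delta> (ruin_time c S x0 D \<omega>) \<partial>M)"
        unfolding w_def by (intro nn_integral_mono mult_left_mono discounted_time_lower h_pos \<delta>_pos) simp
      also have "\<dots> = ennreal L * (\<integral>\<^sup>+\<omega>. discounted_time \<delta> (ruin_time c S x0 D \<omega>) \<partial>M)"
        by (rule nn_integral_cmult[OF strat.discounted_time_measurable])
      finally show ?thesis .
    qed
    finally show ?thesis by (simp add: add.commute add_mono)
  qed
  have start: "ennreal (F x0) \<le> a 0 + ennreal \<theta> * (\<integral>\<^sup>+\<omega>. ennreal (D 0 \<omega>) \<partial>M)"
  proof -
    have [measurable]: "strat.potential F 0 \<in> borel_measurable M" using Fm by (rule strat.potential_measurable) simp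
    have "ennreal (F x0) = (\<integral>\<^sup>+\<omega>. ennreal (F x0) \<partial>M)" by (simp add: emeasure_space_1)
    also have "\<dots> \<le> (\<integral>\<^sup>+\<omega>. ennreal (strat.potential F 0 \<omega>) + ennreal \<theta> * ennreal (D 0 \<omega>) \<partial>M)"
    proof (rule nn_integral_mono)
      fix \<omega> assume \<omega>: "\<omega> \<in> space M"
      have al: "strat.al 0 \<omega>" using strat.X_0[OF \<omega>] by (simp add: alive_def)
      have "F x0 \<le> strat.potential F 0 \<omega> + \<theta> * D 0 \<omega>"
        using jump[OF x0_nonneg] al strat.X_0(2)[OF \<omega>] D_0[of \<omega>] by (simp add: strat.potential_def)
      then have "ennreal (F x0) \<le> ennreal (strat.potential F 0 \<omega> + \<theta> * D 0 \<omega>)" by (rule ennreal_leI)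
      moreover have "0 \<le> strat.potential F 0 \<omega>" using al strat.X_0(1)[OF \<omega>] by (simp add: strat.potential_def nonneg)
      ultimately show "ennreal (F x0) \<le> ennreal (strat.potential F 0 \<omega>) + ennreal \<theta> * ennreal (D 0 \<omega>)"
        using \<theta> strat.D_nonneg[OF \<omega>, of 0] by (simp add: ennreal_plus ennreal_mult)
    qed
    also have "\<dots> = a 0 + ennreal \<theta> * (\<integral>\<^sup>+\<omega>. ennreal (D 0 \<omega>) \<partial>M)"
      unfolding a_def by (simp add: nn_integral_add nn_integral_cmult)
    finally show ?thesis .
  qed
  have sp: "(\<Sum>k. ennreal (w (Suc k)) * (ennreal \<theta> * p k)) + ennreal \<theta> * (\<integral>\<^sup>+\<omega>. ennreal (D 0 \<omega>) \<partial>M)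
    \<le> ennreal \<theta> * (\<integral>\<^sup>+\<omega>. discounted_dividends \<delta> (\<lambda>t. D t \<omega>) (ruin_time c S x0 D \<omega>) \<partial>M)"
  proof -
    have eq: "(\<Sum>k. ennreal (w (Suc k)) * (ennreal \<theta> * p k)) = ennreal \<theta> * (\<Sum>k. ennreal (w (Suc k)) * p k)"
      unfolding ennreal_suminf_cmult[symmetric] by (rule suminf_cong) (rule mult.left_commute)
    have "(\<Sum>k. ennreal (w (Suc k)) * (ennreal \<theta> * p k)) + ennreal \<theta> * (\<integral>\<^sup>+\<omega>. ennreal (D 0 \<omega>) \<partial>M)
      = ennreal \<theta> * ((\<integral>\<^sup>+\<omega>. ennreal (D 0 \<omega>) \<partial>M) + (\<Sum>k. ennreal (w (Suc k)) * p k))"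
      unfolding eq distrib_left by (rule add.commute)
    moreover have "(\<integral>\<^sup>+\<omega>. ennreal (D 0 \<omega>) \<partial>M) + (\<Sum>k. ennreal (w (Suc k)) * p k)
      = (\<integral>\<^sup>+\<omega>. ennreal (D 0 \<omega>) + (\<Sum>k. ennreal (w (Suc k)) * ennreal (strat.payment h k \<omega>)) \<partial>M)"
    proof -
      define v where "v k \<omega> = ennreal (strat.payment h k \<omega>)" for k \<omega>
      have v[measurable]: "v k \<in> borel_measurable M" for k
        unfolding v_def[abs_def] by (rule measurable_compose[OF strat.payment_measurable[OF h_pos] measurable_ennreal])
      define d where "d \<omega> = ennreal (D 0 \<omega>)" for \<omega>
      have d[measurable]: "d \<in> borel_measurable M"
        unfolding d_def[abs_def] by (rule measurable_compose[OF strat.D_measurable[OF order_refl] measurable_ennreal])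
      have "(\<integral>\<^sup>+\<omega>. d \<omega> + (\<Sum>k. ennreal (w (Suc k)) * v k \<omega>) \<partial>M)
        = (\<integral>\<^sup>+\<omega>. d \<omega> \<partial>M) + (\<integral>\<^sup>+\<omega>. (\<Sum>k. ennreal (w (Suc k)) * v k \<omega>) \<partial>M)"
        by (rule nn_integral_add) measurable
      also have "(\<integral>\<^sup>+\<omega>. (\<Sum>k. ennreal (w (Suc k)) * v k \<omega>) \<partial>M) = (\<Sum>k. \<integral>\<^sup>+\<omega>. ennreal (w (Suc k)) * v k \<omega> \<partial>M)"
        by (rule nn_integral_suminf) measurable
      also have "\<dots> = (\<Sum>k. ennreal (w (Suc k)) * p k)"
        unfolding p_def v_def[symmetric] by (rule suminf_cong) (rule nn_integral_cmult[OF v])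
      finally have "(\<integral>\<^sup>+\<omega>. d \<omega> + (\<Sum>k. ennreal (w (Suc k)) * v k \<omega>) \<partial>M) = (\<integral>\<^sup>+\<omega>. d \<omega> \<partial>M) + (\<Sum>k. ennreal (w (Suc k)) * p k)" .
      then show ?thesis unfolding d_def v_def by (rule sym)
    qed
    moreover have "(\<integral>\<^sup>+\<omega>. ennreal (D 0 \<omega>) + (\<Sum>k. ennreal (w (Suc k)) * ennreal (strat.payment h k \<omega>)) \<partial>M)
      \<le> (\<integral>\<^sup>+\<omega>. discounted_dividends \<delta> (\<lambda>t. D t \<omega>) (ruin_time c S x0 D \<omega>) \<partial>M)"
    proof (rule nn_integral_mono)
      fix \<omega> assume \<omega>: "\<omega> \<in> space M"
      interpret payout "\<lambda>t. D t \<omega>" \<delta> h "ruin_time c S x0 D \<omega>"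
        by unfold_locales (use strat.D_nonneg[OF \<omega>] strat.D_mono[OF \<omega>] strat.D_cadlag[OF \<omega>] \<delta>_pos h_pos strat.ruin_time_nonneg in auto)
      show "ennreal (D 0 \<omega>) + (\<Sum>k. ennreal (w (Suc k)) * ennreal (strat.payment h k \<omega>)) \<le> discounted_dividends \<delta> (\<lambda>t. D t \<omega>) (ruin_time c S x0 D \<omega>)"
        unfolding w_def strat.payment_def by (rule dividends_lower) (rule strat.D_after_ruin[OF \<omega>])
    qed
    ultimately show ?thesis by (simp only: mult_left_mono zero_le)
  qed
  have "ennreal (F x0) \<le> (\<Sum>k. ennreal (w (Suc k)) * (ennreal \<theta> * p k)) + ((\<Sum>k. ennreal (w k) * l k) + (\<Sum>k. ennreal (w k) * ennreal (C * h\<^sup>2)))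
      + ennreal \<theta> * (\<integral>\<^sup>+\<omega>. ennreal (D 0 \<omega>) \<partial>M)"
    using start a0 by (meson add_right_mono order_trans)
  also have "\<dots> = ((\<Sum>k. ennreal (w (Suc k)) * (ennreal \<theta> * p k)) + ennreal \<theta> * (\<integral>\<^sup>+\<omega>. ennreal (D 0 \<omega>) \<partial>M))
      + ((\<Sum>k. ennreal (w k) * l k) + (\<Sum>k. ennreal (w k) * ennreal (C * h\<^sup>2)))" by (simp add: add_ac)
  also have "\<dots> \<le> ennreal \<theta> * (\<integral>\<^sup>+\<omega>. discounted_dividends \<delta> (\<lambda>t. D t \<omega>) (ruin_time c S x0 D \<omega>) \<partial>M)
      + ((ennreal (h * L) + ennreal L * (\<integral>\<^sup>+\<omega>. discounted_time \<delta> (ruin_time c S x0 D \<omega>) \<partial>M)) + ennreal (h * (C * (1 + 2 / \<delta>))))"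
    by (intro add_mono sp sl sC)
  also have "\<dots> = ennreal \<theta> * (\<integral>\<^sup>+\<omega>. discounted_dividends \<delta> (\<lambda>t. D t \<omega>) (ruin_time c S x0 D \<omega>) \<partial>M)
    + ennreal L * (\<integral>\<^sup>+\<omega>. discounted_time \<delta> (ruin_time c S x0 D \<omega>) \<partial>M) + (ennreal (h * L) + ennreal (h * (C * (1 + 2 / \<delta>))))"
    by (simp add: add_ac)
  also have "ennreal (h * L) + ennreal (h * (C * (1 + 2 / \<delta>))) = ennreal (h * (L + C * (1 + 2 / \<delta>)))"
    using h_pos L C \<delta>_pos by (simp add: distrib_left ennreal_plus)
  finally show ?thesis .
qed

end

section \<open>Duality\<close>

text \<open>Approximating \<open>f\<close> from below by simple functions gives this half of
  additivity for arbitrary \<open>f\<close>. It is applied with the pathwise dividends as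
  \<open>f\<close>, and this half is the one weak duality needs.\<close>

lemma nn_integral_superadd:
  assumes [measurable]: "g \<in> borel_measurable M"
  shows "(\<integral>\<^sup>+x. f x \<partial>M) + (\<integral>\<^sup>+x. g x \<partial>M) \<le> (\<integral>\<^sup>+x. f x + g x \<partial>M)"
proof -
  let ?S = "{s. simple_function M s \<and> s \<le> f}"
  have ne: "?S \<noteq> {}" by (auto intro!: exI[of _ "\<lambda>_. 0"] simp: le_fun_def)
  have "(\<integral>\<^sup>+x. f x \<partial>M) + (\<integral>\<^sup>+x. g x \<partial>M) = (SUP s\<in>?S. integral\<^sup>S M s + (\<integral>\<^sup>+x. g x \<partial>M))"
    unfolding nn_integral_def[of M f] using ne by (simp add: ennreal_SUP_add_left)
  also have "\<dots> \<le> (\<integral>\<^sup>+x. f x + g x \<partial>M)"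
  proof (rule SUP_least)
    fix s assume s: "s \<in> ?S"
    then have [measurable]: "s \<in> borel_measurable M" by (auto intro: borel_measurable_simple_function)
    have "integral\<^sup>S M s + (\<integral>\<^sup>+x. g x \<partial>M) = (\<integral>\<^sup>+x. s x + g x \<partial>M)"
      using s by (simp add: nn_integral_eq_simple_integral[symmetric] nn_integral_add)
    also have "\<dots> \<le> (\<integral>\<^sup>+x. f x + g x \<partial>M)"
      using s by (intro nn_integral_mono add_right_mono) (auto simp: le_fun_def)
    finally show "integral\<^sup>S M s + (\<integral>\<^sup>+x. g x \<partial>M) \<le> (\<integral>\<^sup>+x. f x + g x \<partial>M)" .
  qed
  finally show ?thesis .
qed

lemma K_nonneg: "0 \<le> K \<delta> T"
  unfolding K_def set_lebesgue_integral_def by (rule Bochner_Integration.integral_nonneg) auto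

lemma ennreal_minus_le_of_le_add:
  assumes "ennreal u \<le> x + ennreal e" "0 \<le> e"
  shows "ennreal (u - e) \<le> x"
proof (cases x)
  case (real y)
  then show ?thesis using assms by (cases "0 \<le> u") (auto simp: ennreal_plus[symmetric] ennreal_le_iff2 simp del: ennreal_plus)
qed simp

context dividend_strategy
begin

lemma dividend_value_le_lagrangian:
  assumes feasible: "ennreal (K \<delta> T) \<le> (\<integral>\<^sup>+\<omega>. discounted_time \<delta> (\<tau> \<omega>) \<partial>M)" and L: "0 \<le> L"
  shows "dividend_value M c \<delta> S x0 D \<le> lagrangian_value M c \<delta> S x0 T L D"
proof -
  let ?V = "\<integral>\<^sup>+\<omega>. discounted_dividends \<delta> (\<lambda>t. D t \<omega>) (\<tau> \<omega>) \<partial>M"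
  let ?W = "\<integral>\<^sup>+\<omega>. discounted_dividends \<delta> (\<lambda>t. D t \<omega>) (\<tau> \<omega>) + ennreal L * discounted_time \<delta> (\<tau> \<omega>) \<partial>M"
  note [measurable] = discounted_time_measurable
  have "ennreal (L * K \<delta> T) = ennreal L * ennreal (K \<delta> T)" using L by (simp add: ennreal_mult')
  also have "\<dots> \<le> ennreal L * (\<integral>\<^sup>+\<omega>. discounted_time \<delta> (\<tau> \<omega>) \<partial>M)" by (intro mult_left_mono feasible) simp
  also have "\<dots> = (\<integral>\<^sup>+\<omega>. ennreal L * discounted_time \<delta> (\<tau> \<omega>) \<partial>M)" by (simp add: nn_integral_cmult)
  finally have "?V + ennreal (L * K \<delta> T) \<le> ?V + (\<integral>\<^sup>+\<omega>. ennreal L * discounted_time \<delta> (\<tau> \<omega>) \<partial>M)"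
    by (rule add_left_mono)
  also have "\<dots> \<le> ?W" by (rule nn_integral_superadd) measurable
  finally have "enn2ereal (?V + ennreal (L * K \<delta> T)) \<le> enn2ereal ?W" by (simp add: less_eq_ennreal.rep_eq)
  then have "enn2ereal ?V + ereal (L * K \<delta> T) \<le> enn2ereal ?W"
    using L K_nonneg[of \<delta> T] by (simp add: plus_ennreal.rep_eq)
  then show ?thesis
    unfolding dividend_value_def lagrangian_value_def by (simp add: ereal_le_minus_iff)
qed

end

section \<open>Dual bounds from barriers, approximating strategies, closing the gap\<close>

context cramer_lundberg_exponential
begin

lemma weak_duality:
  assumes x0: "0 \<le> x0" and L: "0 \<le> L"
  shows "constrained_value M c \<delta> S x0 T \<le> dual_value M c \<delta> S x0 T L"
  unfolding constrained_value_def
proof (rule SUP_least)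
  fix D assume D: "D \<in> {D \<in> strategies M c S x0. ennreal (K \<delta> T) \<le> (\<integral>\<^sup>+\<omega>. discounted_time \<delta> (ruin_time c S x0 D \<omega>) \<partial>M)}"
  interpret dividend_strategy M N Y c r \<alpha> \<delta> x0 D
    by unfold_locales (use x0 D in auto)
  have "dividend_value M c \<delta> S x0 D \<le> lagrangian_value M c \<delta> S x0 T L D"
    using D by (intro dividend_value_le_lagrangian L) simp
  also have "\<dots> \<le> dual_value M c \<delta> S x0 T L" unfolding dual_value_def using D by (intro SUP_upper) simp
  finally show "dividend_value M c \<delta> S x0 D \<le> dual_value M c \<delta> S x0 T L" .
qed

lemma barrier_value_measurable: "barrier_value \<theta> L b \<in> borel_measurable borel"
  by (intro borel_measurable_continuous_onI continuous_on_barrier_value)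

lemma dual_value_le:
  assumes x0: "0 \<le> x0" and L: "0 \<le> L" and b: "0 \<le> b" "0 \<le> harm'' (barrier_coeff 1 L b) L b"
    and concave: "\<And>x. 0 \<le> x \<Longrightarrow> x < b \<Longrightarrow> harm'' (barrier_coeff 1 L b) L x \<le> 0"
  shows "dual_value M c \<delta> S x0 T L \<le> ereal (barrier_value 1 L b x0 - L * K \<delta> T)"
  unfolding dual_value_def
proof (rule SUP_least)
  fix D assume D: "D \<in> strategies M c S x0"
  interpret dividend_strategy M N Y c r \<alpha> \<delta> x0 D
    by unfold_locales (use x0 D in auto)
  obtain C where C: "0 \<le> C" "\<And>x h. 0 \<le> x \<Longrightarrow> 0 \<le> h \<Longrightarrow> h \<le> 1 \<Longrightarrow>
    exp (- \<delta> * h) * (exp (- r * h) * barrier_value 1 L b (x + c * h)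
      + r * h * exp (- r * h) * conv (barrier_value 1 L b) (x + c * h)
      + (r * h)\<^sup>2 * barrier_value 1 L b (x + c * h)) + L * h \<le> barrier_value 1 L b x + C * h\<^sup>2 * (1 + x)"
    "\<And>x d. 0 \<le> d \<Longrightarrow> d \<le> x \<Longrightarrow> barrier_value 1 L b (x - d) + d \<le> barrier_value 1 L b x"
    using barrier_value_supersolution[OF L b concave] by blast
  have F0: "0 \<le> barrier_value 1 L b x0" using L b x0 by (intro barrier_value_nonneg) auto
  have "(\<integral>\<^sup>+\<omega>. discounted_dividends \<delta> (\<lambda>t. D t \<omega>) (\<tau> \<omega>) + ennreal L * discounted_time \<delta> (\<tau> \<omega>) \<partial>M) \<le> ennreal (barrier_value 1 L b x0)"
    by (rule value_upper_bound[OF continuous_on_barrier_value barrier_value_measurable _ _ C(3) C(2) L C(1)])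
       (use L b in \<open>auto intro: barrier_value_nonneg barrier_value_mono\<close>)
  then have "enn2ereal (\<integral>\<^sup>+\<omega>. discounted_dividends \<delta> (\<lambda>t. D t \<omega>) (\<tau> \<omega>) + ennreal L * discounted_time \<delta> (\<tau> \<omega>) \<partial>M) \<le> ereal (barrier_value 1 L b x0)"
    using F0 by (simp add: less_eq_ennreal.rep_eq)
  then show "lagrangian_value M c \<delta> S x0 T L D \<le> ereal (barrier_value 1 L b x0 - L * K \<delta> T)"
    unfolding lagrangian_value_def ereal_minus(1)[symmetric] by (rule ereal_minus_mono) simp
qed

lemma small_step:
  fixes a e :: real
  assumes "0 < e" "0 \<le> a"
  obtains h where "0 < h" "h \<le> 1" "h * a \<le> e"
proof
  show "0 < min 1 (e / (a + 1))" using assms by simp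
  have "min 1 (e / (a + 1)) * a \<le> e / (a + 1) * a" using assms by (intro mult_right_mono) auto
  also have "\<dots> \<le> e" using assms by (simp add: field_simps)
  finally show "min 1 (e / (a + 1)) * a \<le> e" .
qed simp

text \<open>One and the same grid strategy has to approximate dividends and lifetime simultaneously,
  so the lower bound is applied to it twice, with weights 1, 0 and 0, 1.\<close>

lemma barrier_strategy:
  assumes x0: "0 \<le> x0" and b: "0 \<le> b" and e: "0 < e"
  obtains D where "D \<in> strategies M c S x0"
    "ereal (barrier_value 1 0 b x0 - e) \<le> dividend_value M c \<delta> S x0 D"
    "ennreal (barrier_value 0 1 b x0 - e) \<le> (\<integral>\<^sup>+\<omega>. discounted_time \<delta> (ruin_time c S x0 D \<omega>) \<partial>M)"
proof -
  obtain C1 where C1: "0 \<le> C1" "\<And>x h. x \<in> {0..b} \<Longrightarrow> 0 \<le> h \<Longrightarrow> h \<le> 1 \<Longrightarrow>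
    barrier_value 1 0 b x \<le> exp (- \<delta> * h) * (exp (- r * h) * barrier_value 1 0 b (x + c * h)
      + r * h * exp (- r * h) * conv (barrier_value 1 0 b) x) + 0 * h + C1 * h\<^sup>2"
    using barrier_value_one_step_lower[of 1 0 b] b by auto
  obtain C2 where C2: "0 \<le> C2" "\<And>x h. x \<in> {0..b} \<Longrightarrow> 0 \<le> h \<Longrightarrow> h \<le> 1 \<Longrightarrow>
    barrier_value 0 1 b x \<le> exp (- \<delta> * h) * (exp (- r * h) * barrier_value 0 1 b (x + c * h)
      + r * h * exp (- r * h) * conv (barrier_value 0 1 b) x) + 1 * h + C2 * h\<^sup>2"
    using barrier_value_one_step_lower[of 0 1 b] b by auto
  \<comment> \<open>Sum of the error rates of both applications, so that a single step size
    \<open>h\<close> keeps each error below \<open>e\<close>.\<close>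
  define a where "a = (0 + C1 * (1 + 2 / \<delta>)) + (1 + C2 * (1 + 2 / \<delta>))"
  have a: "0 \<le> 0 + C1 * (1 + 2 / \<delta>)" "0 \<le> 1 + C2 * (1 + 2 / \<delta>)" using C1 C2 \<delta>_pos by auto
  then obtain h where h: "0 < h" "h \<le> 1" "h * a \<le> e"
    using small_step[OF e, of a] by (auto simp: a_def)
  have ha: "h * (0 + C1 * (1 + 2 / \<delta>)) \<le> e" "h * (1 + C2 * (1 + 2 / \<delta>)) \<le> e"
    using h(3) mult_nonneg_nonneg[OF less_imp_le[OF h(1)] a(1)] mult_nonneg_nonneg[OF less_imp_le[OF h(1)] a(2)]
    unfolding a_def distrib_left[of h "0 + C1 * (1 + 2 / \<delta>)"] by linarith+
  interpret step_strategy M N Y c r \<alpha> \<delta> x0 h "\<lambda>x. max (x - b) 0"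
    by unfold_locales (use x0 b h in auto)
  have post: "x - max (x - b) 0 = min b x" for x by auto
  have jump: "barrier_value \<theta> L b x \<le> barrier_value \<theta> L b (x - max (x - b) 0) + \<theta> * max (x - b) 0" for \<theta> L x
    unfolding post using barrier_value_jump[of \<theta> L b x] by simp
  have A: "x - max (x - b) 0 \<in> {0..b}" if "0 \<le> x" for x using that b by auto
  have "ennreal (barrier_value 1 0 b x0) \<le> ennreal 1 * (\<integral>\<^sup>+\<omega>. discounted_dividends \<delta> (\<lambda>t. D t \<omega>) (ruin_time c S x0 D \<omega>) \<partial>M)
    + ennreal 0 * (\<integral>\<^sup>+\<omega>. discounted_time \<delta> (ruin_time c S x0 D \<omega>) \<partial>M) + ennreal (h * (0 + C1 * (1 + 2 / \<delta>)))"
    by (rule value_lower_bound[OF continuous_on_barrier_value barrier_value_measurable _ _ jump A C1(2) barrier_value_mono[of 1 0 _ b] _ _ C1(1) h(2)])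
       (use b h in \<open>auto intro: barrier_value_nonneg barrier_value_mono\<close>)
  also have "\<dots> \<le> (\<integral>\<^sup>+\<omega>. discounted_dividends \<delta> (\<lambda>t. D t \<omega>) (ruin_time c S x0 D \<omega>) \<partial>M) + ennreal e"
    using ha(1) by (simp add: ennreal_leI add_left_mono)
  finally have "ennreal (barrier_value 1 0 b x0 - e) \<le> (\<integral>\<^sup>+\<omega>. discounted_dividends \<delta> (\<lambda>t. D t \<omega>) (ruin_time c S x0 D \<omega>) \<partial>M)"
    using e by (intro ennreal_minus_le_of_le_add) auto
  then have "enn2ereal (ennreal (barrier_value 1 0 b x0 - e)) \<le> dividend_value M c \<delta> S x0 D"
    unfolding dividend_value_def less_eq_ennreal.rep_eq .
  moreover have "ereal (barrier_value 1 0 b x0 - e) \<le> enn2ereal (ennreal (barrier_value 1 0 b x0 - e))"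
    by (cases "0 \<le> barrier_value 1 0 b x0 - e") (auto simp: ennreal_neg zero_ennreal.rep_eq)
  ultimately have v: "ereal (barrier_value 1 0 b x0 - e) \<le> dividend_value M c \<delta> S x0 D" by (rule order_trans[rotated])
  have "ennreal (barrier_value 0 1 b x0) \<le> ennreal 0 * (\<integral>\<^sup>+\<omega>. discounted_dividends \<delta> (\<lambda>t. D t \<omega>) (ruin_time c S x0 D \<omega>) \<partial>M)
    + ennreal 1 * (\<integral>\<^sup>+\<omega>. discounted_time \<delta> (ruin_time c S x0 D \<omega>) \<partial>M) + ennreal (h * (1 + C2 * (1 + 2 / \<delta>)))"
    by (rule value_lower_bound[OF continuous_on_barrier_value barrier_value_measurable _ _ jump A C2(2) barrier_value_mono[of 0 1 _ b] _ _ C2(1) h(2)])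
       (use b h in \<open>auto intro: barrier_value_nonneg barrier_value_mono\<close>)
  also have "\<dots> \<le> (\<integral>\<^sup>+\<omega>. discounted_time \<delta> (ruin_time c S x0 D \<omega>) \<partial>M) + ennreal e"
    using ha(2) by (simp add: ennreal_leI add_left_mono)
  finally have "ennreal (barrier_value 0 1 b x0 - e) \<le> (\<integral>\<^sup>+\<omega>. discounted_time \<delta> (ruin_time c S x0 D \<omega>) \<partial>M)"
    using e by (intro ennreal_minus_le_of_le_add) auto
  from that[OF in_strategies v this] show ?thesis .
qed

text \<open>Paying nothing is a grid strategy for every \<open>h\<close>. As the strategy does not
  change with \<open>h\<close>, the error can be sent to 0 and the lifetime bound holds exactly, as
  needed when \<open>K\<^sub>T\<close> equals that lifetime.\<close>

lemma zero_strategy: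
  assumes x0: "0 \<le> x0"
  shows "(\<lambda>t \<omega>. 0) \<in> strategies M c S x0"
    and "ennreal (lifetime x0) \<le> (\<integral>\<^sup>+\<omega>. discounted_time \<delta> (ruin_time c S x0 (\<lambda>t \<omega>. 0) \<omega>) \<partial>M)"
proof -
  obtain C where C: "0 \<le> C" "\<And>x h. x \<in> {0..} \<Longrightarrow> 0 \<le> h \<Longrightarrow> h \<le> 1 \<Longrightarrow>
    lifetime x \<le> exp (- \<delta> * h) * (exp (- r * h) * lifetime (x + c * h)
      + r * h * exp (- r * h) * conv lifetime x) + 1 * h + C * h\<^sup>2"
    using lifetime_one_step_lower by auto
  define a where "a = 1 + C * (1 + 2 / \<delta>)"
  have a: "0 \<le> a" unfolding a_def using C \<delta>_pos by auto
  have cont: "continuous_on A lifetime" for A using DERIV_lifetime DERIV_continuous_on by blast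
  have main: "(\<lambda>t \<omega>. 0) \<in> strategies M c S x0 \<and>
    ennreal (lifetime x0) \<le> (\<integral>\<^sup>+\<omega>. discounted_time \<delta> (ruin_time c S x0 (\<lambda>t \<omega>. 0) \<omega>) \<partial>M) + ennreal e" if e: "0 < e" for e
  proof -
    obtain h where h: "0 < h" "h \<le> 1" "h * a \<le> e" using small_step[OF e a] by auto
    interpret step_strategy M N Y c r \<alpha> \<delta> x0 h "\<lambda>_. 0"
      by unfold_locales (use x0 h in auto)
    have "fst (state k \<omega>) = 0" for k \<omega> by (induction k) (auto simp: Let_def)
    then have D: "D = (\<lambda>t \<omega>. 0)" unfolding D_def by (auto simp: fun_eq_iff)
    have "ennreal (lifetime x0) \<le> ennreal 0 * (\<integral>\<^sup>+\<omega>. discounted_dividends \<delta> (\<lambda>t. D t \<omega>) (ruin_time c S x0 D \<omega>) \<partial>M)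
      + ennreal 1 * (\<integral>\<^sup>+\<omega>. discounted_time \<delta> (ruin_time c S x0 D \<omega>) \<partial>M) + ennreal (h * (1 + C * (1 + 2 / \<delta>)))"
    proof (rule value_lower_bound[OF cont _ lifetime_nonneg _ _ _ C(2) lifetime_le _ _ C(1) h(2)])
      show "lifetime x \<le> lifetime y" if "0 \<le> x" "x \<le> y" for x y
        by (rule DERIV_nonneg_imp_nondecreasing[OF that(2)]) (use DERIV_lifetime lifetime'_pos less_imp_le in blast)
      show "lifetime \<in> borel_measurable borel" by (rule borel_measurable_continuous_onI[OF cont])
    qed (use h in auto)
    also have "\<dots> \<le> (\<integral>\<^sup>+\<omega>. discounted_time \<delta> (ruin_time c S x0 D \<omega>) \<partial>M) + ennreal e"
      using h(3) by (simp add: a_def ennreal_leI add_left_mono)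
    finally show ?thesis using in_strategies unfolding D by simp
  qed
  show "(\<lambda>t \<omega>. 0) \<in> strategies M c S x0" using main[of 1] by simp
  show "ennreal (lifetime x0) \<le> (\<integral>\<^sup>+\<omega>. discounted_time \<delta> (ruin_time c S x0 (\<lambda>t \<omega>. 0) \<omega>) \<partial>M)"
    by (rule ennreal_le_epsilon) (use main in auto)
qed

lemma dual_multiplier_le:
  assumes x0: "0 \<le> x0" and b: "0 \<le> b" "0 \<le> scale'' b"
  shows "(INF \<Lambda>\<in>{0..}. dual_value M c \<delta> S x0 T \<Lambda>)
    \<le> ereal (barrier_value 1 (multiplier b) b x0 - multiplier b * K \<delta> T)"
proof -
  have "(INF \<Lambda>\<in>{0..}. dual_value M c \<delta> S x0 T \<Lambda>) \<le> dual_value M c \<delta> S x0 T (multiplier b)"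
    using multiplier_nonneg[OF b(2)] by (intro INF_lower) simp
  also have "\<dots> \<le> ereal (barrier_value 1 (multiplier b) b x0 - multiplier b * K \<delta> T)"
    using x0 b multiplier_nonneg[OF b(2)] multiplier_supersolution[OF b(2)] harm''_multiplier[of b]
    by (intro dual_value_le) auto
  finally show ?thesis .
qed

lemma barrier_value_inside:
  assumes "x \<le> b"
  shows "barrier_value 1 (multiplier b) b x
    = barrier_coeff 1 (multiplier b) b * scale x + multiplier b * lifetime x"
  using assms by (simp add: barrier_value_def harm_def min_absorb2)

lemma constrained_value_ge:
  assumes "D \<in> strategies M c S x0" "ennreal (K \<delta> T) \<le> (\<integral>\<^sup>+\<omega>. discounted_time \<delta> (ruin_time c S x0 D \<omega>) \<partial>M)"
  shows "dividend_value M c \<delta> S x0 D \<le> constrained_value M c \<delta> S x0 T"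
  unfolding constrained_value_def using assms by (intro SUP_upper) simp

lemma strong_duality:
  assumes x0: "0 \<le> x0"
  shows "(INF \<Lambda>\<in>{0..}. dual_value M c \<delta> S x0 T \<Lambda>) \<le> constrained_value M c \<delta> S x0 T" (is "?I \<le> ?V")
proof -
  define \<kappa> where "\<kappa> = K \<delta> T"
  obtain b0 where b0: "0 \<le> b0" "0 \<le> scale'' b0" "\<And>x. 0 \<le> x \<Longrightarrow> x < b0 \<Longrightarrow> scale'' x \<le> 0"
    using optimal_barrier_zero by blast
  have sc: "0 \<le> scale'' b" if "b0 \<le> b" for b using scale''_mono[OF that] b0 by simp
  have outer: "?I \<le> ereal (barrier_coeff 1 (multiplier b) b * scale x0 + multiplier b * (lifetime x0 - \<kappa>))"
    if "max b0 x0 \<le> b" for b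
    using dual_multiplier_le[OF x0, of b T] that sc[of b] b0(1) barrier_value_inside[of x0 b]
    by (simp add: \<kappa>_def algebra_simps)
  show ?thesis
  proof (cases "lifetime x0" \<kappa> rule: linorder_cases)
    case less
    \<comment> \<open>In \<open>outer\<close> the coefficient of \<open>scale x0\<close> tends to 0,
      while the multiplier tends to infinity against the negative gap
      \<open>lifetime x0 - \<kappa>\<close>.\<close>
    have "filterlim (\<lambda>b. multiplier b * (\<kappa> - lifetime x0)) at_top at_top"
      using less by (intro filterlim_at_top_mult_tendsto_pos[OF tendsto_const] filterlim_multiplier) auto
    moreover have "((\<lambda>b. - (barrier_coeff 1 (multiplier b) b * scale x0)) \<longlongrightarrow> - (0 * scale x0)) at_top"
      by (intro tendsto_minus tendsto_mult tendsto_const tendsto_coeff_multiplier)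
    ultimately have "filterlim (\<lambda>b. - (barrier_coeff 1 (multiplier b) b * scale x0) + multiplier b * (\<kappa> - lifetime x0)) at_top at_top"
      by (rule filterlim_tendsto_add_at_top[rotated])
    then have ev: "eventually (\<lambda>b. Z \<le> - (barrier_coeff 1 (multiplier b) b * scale x0) + multiplier b * (\<kappa> - lifetime x0)) at_top" for Z
      unfolding filterlim_at_top by blast
    have "?I \<le> ereal y" for y
    proof -
      obtain b where b: "max b0 x0 \<le> b" "- y \<le> - (barrier_coeff 1 (multiplier b) b * scale x0) + multiplier b * (\<kappa> - lifetime x0)"
        using eventually_happens'[OF trivial_limit_at_top_linorder eventually_conj[OF eventually_ge_at_top[of "max b0 x0"] ev[of "- y"]]]
        by blast
      have "barrier_coeff 1 (multiplier b) b * scale x0 + multiplier b * (lifetime x0 - \<kappa>) \<le> y"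
        using b(2) by (simp add: algebra_simps)
      with outer[OF b(1)] show ?thesis by (meson ereal_less_eq(3) order_trans)
    qed
    then have "?I = -\<infinity>" by (rule ereal_bot)
    then show ?thesis by simp
  next
    case equal
    \<comment> \<open>Paying nothing is feasible, so the primal value is nonnegative; the lifetime
      term in \<open>outer\<close> disappears, and the rest tends to 0.\<close>
    have "0 \<le> dividend_value M c \<delta> S x0 (\<lambda>t \<omega>. 0)" unfolding dividend_value_def by simp
    also have "\<dots> \<le> ?V"
      using zero_strategy[OF x0] equal by (intro constrained_value_ge) (auto simp: \<kappa>_def)
    finally have V: "0 \<le> ?V" .
    have lim: "((\<lambda>b. barrier_coeff 1 (multiplier b) b * scale x0) \<longlongrightarrow> 0 * scale x0) at_top"
      by (intro tendsto_mult tendsto_const tendsto_coeff_multiplier)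
    have "?I \<le> ?V + ereal e" if e: "0 < e" for e
    proof -
      have ev: "eventually (\<lambda>b. barrier_coeff 1 (multiplier b) b * scale x0 < e) at_top"
        by (rule order_tendstoD(2)[OF lim]) (use e in simp)
      obtain b where b: "max b0 x0 \<le> b" "barrier_coeff 1 (multiplier b) b * scale x0 < e"
        using eventually_happens'[OF trivial_limit_at_top_linorder eventually_conj[OF eventually_ge_at_top[of "max b0 x0"] ev]]
        by blast
      have "?I \<le> ereal (barrier_coeff 1 (multiplier b) b * scale x0)" using outer[OF b(1)] equal by simp
      also have "\<dots> \<le> 0 + ereal e" using b(2) by simp
      also have "\<dots> \<le> ?V + ereal e" by (intro add_right_mono V)
      finally show ?thesis .
    qed
    then show ?thesis by (rule ereal_le_epsilon2)
  next
    case greater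
    have gap: "?I \<le> ?V + ereal (2 * e)" if e: "0 < e" for e
    proof -
      \<comment> \<open>The slack \<open>\<eta>\<close> is what an approximating strategy may lose
        in lifetime while remaining feasible.\<close>
      obtain b \<eta> where b: "0 \<le> b" and \<eta>: "0 < \<eta>" "\<kappa> \<le> barrier_value 0 1 b x0 - \<eta>"
        and I: "?I \<le> ereal (barrier_value 1 0 b x0 + e)"
      proof (cases "\<kappa> < barrier_value 0 1 b0 x0")
        case True
        \<comment> \<open>The unconstrained optimal barrier already lives long enough: the
          constraint is not binding and the multiplier is 0.\<close>
        have "?I \<le> dual_value M c \<delta> S x0 T 0" by (intro INF_lower) simp
        also have "\<dots> \<le> ereal (barrier_value 1 0 b0 x0 - 0 * K \<delta> T)"
        proof (rule dual_value_le[OF x0 order_refl b0(1)])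
          have p: "0 \<le> barrier_coeff 1 0 b0" unfolding barrier_coeff_def using scale'_pos[of b0] by simp
          show "0 \<le> harm'' (barrier_coeff 1 0 b0) 0 b0" unfolding harm''_def using p b0(2) by simp
          show "harm'' (barrier_coeff 1 0 b0) 0 x \<le> 0" if "0 \<le> x" "x < b0" for x
            unfolding harm''_def using p b0(3)[OF that] by (simp add: mult_nonneg_nonpos)
        qed
        also have "\<dots> \<le> ereal (barrier_value 1 0 b0 x0 + e)" using e by simp
        finally show ?thesis using that[of b0 "barrier_value 0 1 b0 x0 - \<kappa>"] True b0(1) by simp
      next
        case False
        have ev: "eventually (\<lambda>b. \<kappa> < barrier_value 0 1 b x0) at_top"
          using order_tendstoD(1)[OF tendsto_barrier_lifetime greater] .
        obtain b1 where b1: "b0 \<le> b1" "\<kappa> < barrier_value 0 1 b1 x0"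
          using eventually_happens'[OF trivial_limit_at_top_linorder eventually_conj[OF eventually_ge_at_top[of b0] ev]] by blast
        \<comment> \<open>The barrier \<open>b\<close> depends on \<open>\<eta>\<close>, so
          \<open>multiplier b * \<eta> \<le> e\<close> requires a bound on the multiplier that is
          uniform over the interval in which \<open>b\<close> will be found.\<close>
        have "bounded (multiplier ` {b0..b1})"
          by (intro compact_imp_bounded compact_continuous_image continuous_on_multiplier) auto
        then obtain B where B: "0 < B" "\<forall>b\<in>{b0..b1}. \<bar>multiplier b\<bar> \<le> B" unfolding bounded_pos by auto
        define \<eta> where "\<eta> = min (e / B) (barrier_value 0 1 b1 x0 - \<kappa>)"
        have \<eta>: "0 < \<eta>" "\<eta> \<le> e / B" "\<kappa> + \<eta> \<le> barrier_value 0 1 b1 x0" unfolding \<eta>_def using e B b1 by auto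
        obtain b where b: "b0 \<le> b" "b \<le> b1" "barrier_value 0 1 b x0 = \<kappa> + \<eta>"
          using IVT'[of "\<lambda>b. barrier_value 0 1 b x0" b0 "\<kappa> + \<eta>" b1] False \<eta> b1 continuous_on_barrier_lifetime by auto
        have "multiplier b * \<eta> \<le> B * (e / B)" using B b \<eta> by (intro mult_mono) (auto dest: abs_le_D1)
        then have "multiplier b * \<eta> \<le> e" using B by simp
        then have "barrier_value 1 (multiplier b) b x0 - multiplier b * K \<delta> T \<le> barrier_value 1 0 b x0 + e"
          unfolding barrier_value_split[of "multiplier b"] b(3) by (simp add: \<kappa>_def algebra_simps)
        then have "?I \<le> ereal (barrier_value 1 0 b x0 + e)"
          using dual_multiplier_le[OF x0, of b T] b b0(1) sc[of b] by (meson ereal_less_eq(3) order_trans)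
        then show ?thesis using that[of b \<eta>] b b0(1) \<eta>(1) by simp
      qed
      obtain D where D: "D \<in> strategies M c S x0"
        "ereal (barrier_value 1 0 b x0 - min e \<eta>) \<le> dividend_value M c \<delta> S x0 D"
        "ennreal (barrier_value 0 1 b x0 - min e \<eta>) \<le> (\<integral>\<^sup>+\<omega>. discounted_time \<delta> (ruin_time c S x0 D \<omega>) \<partial>M)"
        using barrier_strategy[OF x0 b, of "min e \<eta>"] e \<eta>(1) by auto
      have "ennreal (K \<delta> T) \<le> ennreal (barrier_value 0 1 b x0 - min e \<eta>)"
        using \<eta>(2) by (intro ennreal_leI) (simp add: \<kappa>_def)
      also note D(3)
      finally have "dividend_value M c \<delta> S x0 D \<le> ?V" by (rule constrained_value_ge[OF D(1)])
      with D(2) have "ereal (barrier_value 1 0 b x0 - min e \<eta>) \<le> ?V" by (rule order_trans)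
      then have "ereal (barrier_value 1 0 b x0 - min e \<eta>) + ereal (2 * e) \<le> ?V + ereal (2 * e)" by (rule add_right_mono)
      \<comment> \<open>One \<open>e\<close> pays for the dual bound, the other for the dividends
        lost by the approximating strategy.\<close>
      moreover have "ereal (barrier_value 1 0 b x0 + e) \<le> ereal (barrier_value 1 0 b x0 - min e \<eta>) + ereal (2 * e)" by simp
      ultimately show ?thesis using I by (meson order_trans)
    qed
    show ?thesis
    proof (rule ereal_le_epsilon2)
      fix e :: real assume "0 < e"
      then show "?I \<le> ?V + ereal e" using gap[of "e / 2"] by simp
    qed
  qed
qed

end

theorem theorem4p2:
  fixes M :: "'a measure"
    and N :: "real \<Rightarrow> 'a \<Rightarrow> nat"
    and Y :: "nat \<Rightarrow> 'a \<Rightarrow> real"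
    and c r \<alpha> \<delta> x0 T :: real
  assumes "cramer_lundberg_exponential M N Y c r \<alpha> \<delta>"
    and "x0 \<ge> 0" and "T \<ge> 0"
  shows "constrained_value M c \<delta> (total_claims N Y) x0 T
           \<le> (INF \<Lambda>\<in>{0..}. dual_value M c \<delta> (total_claims N Y) x0 T \<Lambda>)
         \<and> (INF \<Lambda>\<in>{0..}. dual_value M c \<delta> (total_claims N Y) x0 T \<Lambda>)
           \<le> constrained_value M c \<delta> (total_claims N Y) x0 T
         \<and> (INF \<Lambda>\<in>{0..}. dual_value M c \<delta> (total_claims N Y) x0 T \<Lambda>)
           = constrained_value M c \<delta> (total_claims N Y) x0 T"
proof -
  interpret cramer_lundberg_exponential M N Y c r \<alpha> \<delta> by (rule assms(1))
  have weak: "constrained_value M c \<delta> (total_claims N Y) x0 T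
      \<le> (INF \<Lambda>\<in>{0..}. dual_value M c \<delta> (total_claims N Y) x0 T \<Lambda>)"
    using weak_duality[OF assms(2)] by (intro INF_greatest) auto
  show ?thesis
    using weak strong_duality[OF assms(2)] by (blast intro: antisym)
qed

end
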